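(* Consider Wyner's symmetric network under Model 1 with only Rx-cooperation and $D$ cooperation rounds, as defined in the context. Let $\rho\in(0,1)$ and $\rho_f\in[0,1]$. Then every achievable MG pair $(S^{(U)},S^{(e)})$ satisfies $$S^{(U)}\le\frac{\rho\rho_f}{2},\qquad S^{(e)}+S^{(U)}\le\rho-\frac{(1-\rho)\rho^{D+2}}{1-\rho^{D+2}},\qquad S^{(e)}+(1+\rho)S^{(U)}\le\rho.$$
   Context: Throughout, $D$ is a positive even integer. Wyner's symmetric network: for each $K$ there are $K$ transmitters (Txs) and $K$ receivers (Rxs), indexed by $\mathcal K=\{1,\dots,K\}$. Activity. Each Tx $k$ is active ($A_k=1$) with probability $\rho$, independently over $k$, and $A_k=0$ otherwise. Given that Tx $k$ is active, $B_k=1$ with probability $\rho_f$, independently of everything else, and $B_k=0$ otherwise. Let $\mathcal K_{active}=\{k:A_k=1\}$, $\mathcal K_{URLLC}=\{k:A_k=1,B_k=1\}$. Model 1: every active Tx has an eMBB message, i.e. $\mathcal K_{eMBB}=\mathcal K_{active}$, and each Tx in $\mathcal K_{URLLC}$ additionally has a URLLC message. Write $\mathbf A,\mathbf B$ for the activity tuples; all terminals know $(\mathbf A,\mathbf B)$. Messages. For blocklength $n$, the eMBB message $M_k^{(e)}$ ($k\in\mathcal K_{eMBB}$) is uniform on $\{1,\dots,\lfloor 2^{nR_k^{(e)}}\rfloor\}$, where $R_k^{(e)}$ may depend on $k$ and on $(\mathbf A,\mathbf B)$. The URLLC message $M_k^{(U)}$ ($k\in\mathcal K_{URLLC}$) is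 uniform on $\{1,\dots,\lfloor 2^{nR^{(U)}}\rfloor\}$, with the same rate $R^{(U)}$ for all $k$, not depending on $(\mathbf A,\mathbf B)$. Messages are independent. Channel. For $t=1,\dots,n$, $Y_{k,t}=h_{k,k}X_{k,t}+\sum_{\tilde k\in\{k-1,k+1\}}h_{\tilde k,k}X_{\tilde k,t}+Z_{k,t}$, where indices outside $\mathcal K$ are ignored, inactive Txs send zero, the $h_{\tilde k,k}\ge 0$ are fixed real numbers, and the $Z_{k,t}$ are i.i.d. standard Gaussian, independent of all messages. The neighbours of $k$ are $\mathcal N_k=\{k-1,k+1\}\cap\mathcal K$. Communication with only Rx-cooperation (no Tx-cooperation rounds, $D_{Tx}=0$, and $D_{Rx}=D$). (i) Each active Tx $k$ computes $X_k^n$ as a function of its own URLLC and eMBB messages (those that exist) and $(\mathbf A,\mathbf B)$, subject to $\frac1n\sum_{t=1}^n X_{k,t}^2\le P$ almost surely. (ii) Each Rx $k\in\mathcal K_{URLLC}$ decodes $M_k^{(U)}$ from $Y_k^n$ and $(\mathbf A,\mathbf B)$ only. (iii) $D$ Rx-cooperation rounds: in each round every active Rx $k$ sends to each active neighbour in $\mathcal N_k$ over a noise-free link of unlimited capacity an arbitrary function of $Y_k^n$, the cooperation messages it received in previous rounds, and $(\mathbf A,\mathbf B)$. (iv) Each Rx $k\in\mathcal K_{eMBB}$ decodes $M_k^{(e)}$ from $Y_k^n$, all cooperation messages it received, and $(\mathbf A,\mathbf B)$. Achievability. For given $P,K$, a pair $(R^{(U)}(P),\bar R_K^{(e)}(P))$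 is $D$-achievable if there exist rates $R_k^{(e)}$ with $\bar R_K^{(e)}\le \mathbb E_{\mathbf A,\mathbf B}\big[\frac1K\sum_{k\in\mathcal K_{eMBB}}R_k^{(e)}\big]$ and encoding functions (of the own messages and $(\mathbf A,\mathbf B)$, obeying the power constraint $\frac1n\sum_{t=1}^n X_{k,t}^2\le P$ almost surely), URLLC decoding functions (of $Y_k^n$ and $(\mathbf A,\mathbf B)$), Rx-cooperation functions for $D$ rounds (of $Y_k^n$, the previously received Rx-cooperation messages and $(\mathbf A,\mathbf B)$) and eMBB decoding functions (of $Y_k^n$, all received Rx-cooperation messages and $(\mathbf A,\mathbf B)$) such that the probability that some URLLC message ($k\in\mathcal K_{URLLC}$) or some eMBB message ($k\in\mathcal K_{eMBB}$) is decoded incorrectly tends to $0$ as $n\to\infty$. A multiplexing gain (MG) pair $(S^{(U)},S^{(e)})$ is ($D$-)achievable if for all $P>0$ (and all $K$) there exist $D$-achievable rates with $S^{(U)}=\rho\rho_f\,\varlimsup_{K\to\infty}\varlimsup_{P\to\infty}\frac{R^{(U)}(P)}{\frac12\log P}$ and $S^{(e)}=\varlimsup_{K\to\infty}\varlimsup_{P\to\infty}\frac{\bar R_K^{(e)}(P)}{\frac12\log P}$.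
   Formalization: Assumes all gains between neighbours are strictly positive, and that the two upper limits defining the MG pair are approached simultaneously along common K and P; with zero cross gains, or with rates alternating in P between two operating points, the stated bounds fail. *)

theory Defs
  imports "HOL-Probability.Probability"
begin

text \<open>An activity pattern maps \<open>k\<close> to the pair \<open>(A\<^sub>k, B\<^sub>k)\<close>.\<close>

type_synonym activity = "nat \<Rightarrow> bool \<times> bool"

definition tx_activity_pmf :: "real \<Rightarrow> real \<Rightarrow> (bool \<times> bool) pmf" where
  "tx_activity_pmf \<rho> \<rho>\<^sub>f =
     do { a \<leftarrow> bernoulli_pmf \<rho>; b \<leftarrow> bernoulli_pmf \<rho>\<^sub>f; return_pmf (a, a \<and> b) }"

definition activity_pmf :: "real \<Rightarrow> real \<Rightarrow> nat \<Rightarrow> activity pmf" where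
  "activity_pmf \<rho> \<rho>\<^sub>f K = Pi_pmf {1..K} (False, False) (\<lambda>_. tx_activity_pmf \<rho> \<rho>\<^sub>f)"

text \<open>In Model 1 the set of transmitters with an eMBB message is \<open>active_set\<close>.\<close>

definition active_set :: "nat \<Rightarrow> activity \<Rightarrow> nat set" where
  "active_set K s = {k \<in> {1..K}. fst (s k)}"

definition urllc_set :: "nat \<Rightarrow> activity \<Rightarrow> nat set" where
  "urllc_set K s = {k \<in> {1..K}. fst (s k) \<and> snd (s k)}"

definition nbrs :: "nat \<Rightarrow> nat \<Rightarrow> nat set" where
  "nbrs K k = {k - 1, k + 1} \<inter> {1..K}"

definition active_nbrs :: "nat \<Rightarrow> activity \<Rightarrow> nat \<Rightarrow> nat set" where
  "active_nbrs K s k = nbrs K k \<inter> active_set K s"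

definition message_pmf :: "nat \<Rightarrow> real \<Rightarrow> nat pmf" where
  "message_pmf n R = pmf_of_set {1..nat \<lfloor>2 powr (real n * R)\<rfloor>}"

text \<open>
  Joint law of the activity pattern, the URLLC messages (rate \<open>RU\<close>) and the eMBB messages
  (rates \<open>RE s k\<close>). A message that does not exist has the dummy value 0.
\<close>

definition source_pmf ::
  "real \<Rightarrow> real \<Rightarrow> nat \<Rightarrow> nat \<Rightarrow> real \<Rightarrow> (activity \<Rightarrow> nat \<Rightarrow> real)
    \<Rightarrow> (activity \<times> (nat \<Rightarrow> nat) \<times> (nat \<Rightarrow> nat)) pmf" where
  "source_pmf \<rho> \<rho>\<^sub>f K n RU RE =
     do { s \<leftarrow> activity_pmf \<rho> \<rho>\<^sub>f K;
          mU \<leftarrow> Pi_pmf (urllc_set K s) 0 (\<lambda>_. message_pmf n RU);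
          mE \<leftarrow> Pi_pmf (active_set K s) 0 (\<lambda>k. message_pmf n (RE s k));
          return_pmf (s, mU, mE) }"

text \<open>
  A cooperation message is a sequence of reals. This models a link of unlimited capacity without
  loss of generality: everything a receiver knows consists of finitely many reals and sequences
  of reals, and can be forwarded in one such sequence.
  A history assigns to \<open>(j, m)\<close> the message received in round \<open>j\<close> from receiver \<open>m\<close>.
\<close>

type_synonym coop_msg = "nat \<Rightarrow> real"
type_synonym history = "nat \<times> nat \<Rightarrow> coop_msg"

text \<open>
  \<^item> \<open>enc c s k u e t\<close>: input of transmitter \<open>k\<close> at time \<open>t\<close>, for own URLLC message \<open>u\<close> and
    own eMBB message \<open>e\<close>;
  \<^item> \<open>dec_urllc c s k y\<close>: URLLC decision of receiver \<open>k\<close> from its own output block \<open>y\<close>;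
  \<^item> \<open>coop c s j k l y r\<close>: message of receiver \<open>k\<close> to receiver \<open>l\<close> in round \<open>j\<close>, from its
    own output block \<open>y\<close> and its history \<open>r\<close> of the rounds before \<open>j\<close>;
  \<^item> \<open>dec_embb c s k y r\<close>: eMBB decision of receiver \<open>k\<close> from \<open>y\<close> and its full history \<open>r\<close>.
\<close>

record code =
  enc :: "activity \<Rightarrow> nat \<Rightarrow> nat \<Rightarrow> nat \<Rightarrow> nat \<Rightarrow> real"
  dec_urllc :: "activity \<Rightarrow> nat \<Rightarrow> (nat \<Rightarrow> real) \<Rightarrow> nat"
  coop :: "activity \<Rightarrow> nat \<Rightarrow> nat \<Rightarrow> nat \<Rightarrow> (nat \<Rightarrow> real) \<Rightarrow> history \<Rightarrow> coop_msg"
  dec_embb :: "activity \<Rightarrow> nat \<Rightarrow> (nat \<Rightarrow> real) \<Rightarrow> history \<Rightarrow> nat"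

definition channel_input ::
  "nat \<Rightarrow> code \<Rightarrow> activity \<Rightarrow> (nat \<Rightarrow> nat) \<Rightarrow> (nat \<Rightarrow> nat) \<Rightarrow> nat \<Rightarrow> nat \<Rightarrow> real" where
  "channel_input K c s mU mE k t =
     (if k \<in> active_set K s then enc c s k (mU k) (mE k) t else 0)"

text \<open>The gain from transmitter \<open>i\<close> to receiver \<open>k\<close> is \<open>h i k\<close>; \<open>z (k, t)\<close> is the noise.\<close>

definition channel_output ::
  "(nat \<Rightarrow> nat \<Rightarrow> real) \<Rightarrow> nat \<Rightarrow> nat \<Rightarrow> (nat \<Rightarrow> nat \<Rightarrow> real) \<Rightarrow> (nat \<times> nat \<Rightarrow> real)
    \<Rightarrow> nat \<Rightarrow> nat \<Rightarrow> real" where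
  "channel_output h K n x z k =
     (\<lambda>t\<in>{1..n}. h k k * x k t + (\<Sum>i\<in>nbrs K k. h i k * x i t) + z (k, t))"

definition noise_measure :: "nat \<Rightarrow> nat \<Rightarrow> (nat \<times> nat \<Rightarrow> real) measure" where
  "noise_measure K n = PiM ({1..K} \<times> {1..n}) (\<lambda>_. density lborel std_normal_density)"

text \<open>
  \<open>rx_history K c s y j k\<close> is the history of receiver \<open>k\<close> after \<open>j\<close> rounds, where \<open>y k\<close> is
  the output block of receiver \<open>k\<close>.
\<close>

primrec rx_history ::
  "nat \<Rightarrow> code \<Rightarrow> activity \<Rightarrow> (nat \<Rightarrow> nat \<Rightarrow> real) \<Rightarrow> nat \<Rightarrow> nat \<Rightarrow> history" where
  "rx_history K c s y 0 = (\<lambda>k _. undefined)"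
| "rx_history K c s y (Suc j) =
     (\<lambda>k (i, m). if i = Suc j \<and> m \<in> active_nbrs K s k
                 then coop c s (Suc j) m k (y m) (rx_history K c s y j m)
                 else rx_history K c s y j k (i, m))"

definition output_space :: "nat \<Rightarrow> (nat \<Rightarrow> real) measure" where
  "output_space n = PiM {1..n} (\<lambda>_. borel)"

definition coop_msg_space :: "coop_msg measure" where
  "coop_msg_space = PiM UNIV (\<lambda>_. borel)"

definition history_space :: "nat \<Rightarrow> activity \<Rightarrow> nat \<Rightarrow> nat \<Rightarrow> history measure" where
  "history_space K s j k = PiM ({1..j} \<times> active_nbrs K s k) (\<lambda>_. coop_msg_space)"

definition measurable_code :: "nat \<Rightarrow> nat \<Rightarrow> nat \<Rightarrow> code \<Rightarrow> bool" where
  "measurable_code D K n c \<longleftrightarrow>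
     (\<forall>s. \<forall>k\<in>urllc_set K s. dec_urllc c s k \<in> output_space n \<rightarrow>\<^sub>M count_space UNIV) \<and>
     (\<forall>s. \<forall>k\<in>active_set K s. \<forall>l\<in>active_nbrs K s k. \<forall>j\<in>{1..D}.
        (\<lambda>(y, r). coop c s j k l y r)
          \<in> output_space n \<Otimes>\<^sub>M history_space K s (j - 1) k \<rightarrow>\<^sub>M coop_msg_space) \<and>
     (\<forall>s. \<forall>k\<in>active_set K s.
        (\<lambda>(y, r). dec_embb c s k y r)
          \<in> output_space n \<Otimes>\<^sub>M history_space K s D k \<rightarrow>\<^sub>M count_space UNIV)"

definition power_constraint ::
  "real \<Rightarrow> real \<Rightarrow> nat \<Rightarrow> nat \<Rightarrow> real \<Rightarrow> real \<Rightarrow> (activity \<Rightarrow> nat \<Rightarrow> real) \<Rightarrow> code \<Rightarrow> bool" where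
  "power_constraint \<rho> \<rho>\<^sub>f K n P RU RE c \<longleftrightarrow>
     (AE (s, mU, mE) in source_pmf \<rho> \<rho>\<^sub>f K n RU RE. \<forall>k\<in>{1..K}.
        (1 / real n) * (\<Sum>t = 1..n. (channel_input K c s mU mE k t)\<^sup>2) \<le> P)"

definition decoding_error ::
  "(nat \<Rightarrow> nat \<Rightarrow> real) \<Rightarrow> nat \<Rightarrow> nat \<Rightarrow> nat \<Rightarrow> code
    \<Rightarrow> activity \<Rightarrow> (nat \<Rightarrow> nat) \<Rightarrow> (nat \<Rightarrow> nat) \<Rightarrow> (nat \<times> nat \<Rightarrow> real) \<Rightarrow> bool" where
  "decoding_error h D K n c s mU mE z \<longleftrightarrow>
     (let y = channel_output h K n (channel_input K c s mU mE) z in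
        (\<exists>k\<in>urllc_set K s. dec_urllc c s k (y k) \<noteq> mU k) \<or>
        (\<exists>k\<in>active_set K s. dec_embb c s k (y k) (rx_history K c s y D k) \<noteq> mE k))"

text \<open>
  The noise is independent of activity and messages, so the error probability is the average of
  the noise probabilities. The product of the two measures is avoided on purpose: the source
  lives on an uncountable type with all sets measurable, and the error event need not lie in the
  product \<open>\<sigma>\<close>-algebra.
\<close>

definition error_prob ::
  "real \<Rightarrow> real \<Rightarrow> (nat \<Rightarrow> nat \<Rightarrow> real) \<Rightarrow> nat \<Rightarrow> nat \<Rightarrow> nat \<Rightarrow> real
    \<Rightarrow> (activity \<Rightarrow> nat \<Rightarrow> real) \<Rightarrow> code \<Rightarrow> real" where
  "error_prob \<rho> \<rho>\<^sub>f h D K n RU RE c =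
     measure_pmf.expectation (source_pmf \<rho> \<rho>\<^sub>f K n RU RE)
       (\<lambda>(s, mU, mE). measure (noise_measure K n)
          {z \<in> space (noise_measure K n). decoding_error h D K n c s mU mE z})"

definition achievable_rates ::
  "real \<Rightarrow> real \<Rightarrow> (nat \<Rightarrow> nat \<Rightarrow> real) \<Rightarrow> nat \<Rightarrow> nat \<Rightarrow> real \<Rightarrow> real \<Rightarrow> real \<Rightarrow> bool" where
  "achievable_rates \<rho> \<rho>\<^sub>f h D K P RU RE_avg \<longleftrightarrow>
     0 \<le> RU \<and>
     (\<exists>RE :: activity \<Rightarrow> nat \<Rightarrow> real.
        (\<forall>s k. 0 \<le> RE s k) \<and>
        RE_avg \<le> measure_pmf.expectation (activity_pmf \<rho> \<rho>\<^sub>f K)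
                   (\<lambda>s. (1 / real K) * (\<Sum>k\<in>active_set K s. RE s k)) \<and>
        (\<exists>c :: nat \<Rightarrow> code.
           (\<forall>n\<ge>1. measurable_code D K n (c n) \<and> power_constraint \<rho> \<rho>\<^sub>f K n P RU RE (c n)) \<and>
           (\<lambda>n. error_prob \<rho> \<rho>\<^sub>f h D K n RU RE (c n)) \<longlonglongrightarrow> 0))"

text \<open>
  Rates are in bits, hence the binary logarithm. The last clause says that the two upper limits
  are approached simultaneously, along common values of \<open>K\<close> and \<open>P\<close>. It holds automatically
  when the limits exist. Without it a scheme could alternate, as \<open>P\<close> grows, between one operating
  point that is good for URLLC and another one that is good for eMBB, and the two separate upper
  limits would form a pair that no operating point supports.
\<close>

definition achievable_MG ::
  "real \<Rightarrow> real \<Rightarrow> (nat \<Rightarrow> nat \<Rightarrow> real) \<Rightarrow> nat \<Rightarrow> real \<Rightarrow> real \<Rightarrow> bool" where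
  "achievable_MG \<rho> \<rho>\<^sub>f h D SU SE \<longleftrightarrow>
     (\<exists>(RU :: nat \<Rightarrow> real \<Rightarrow> real) (RE_avg :: nat \<Rightarrow> real \<Rightarrow> real).
        (\<forall>K\<ge>1. \<forall>P>0. achievable_rates \<rho> \<rho>\<^sub>f h D K P (RU K P) (RE_avg K P)) \<and>
        ereal SU = ereal (\<rho> * \<rho>\<^sub>f) *
          Limsup sequentially (\<lambda>K. Limsup at_top (\<lambda>P. ereal (RU K P / (1 / 2 * log 2 P)))) \<and>
        ereal SE =
          Limsup sequentially (\<lambda>K. Limsup at_top (\<lambda>P. ereal (RE_avg K P / (1 / 2 * log 2 P)))) \<and>
        (\<forall>\<epsilon>>0. \<exists>\<^sub>F K in sequentially. \<exists>\<^sub>F P in at_top.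
           SU - \<epsilon> < \<rho> * \<rho>\<^sub>f * (RU K P / (1 / 2 * log 2 P)) \<and>
           SE - \<epsilon> < RE_avg K P / (1 / 2 * log 2 P)))"

end

theory Submission
  imports Defs
begin

text \<open>
  Fix an activity pattern. The noiseless outputs, rounded to integers, are functions of the uniformly
  distributed message tuple. A rounded output block takes at most \<open>(c P)^(n/2)\<close> values, so it
  contributes at most \<open>n/2 log P + O(n)\<close> to the entropy, and rounding costs the decoders only \<open>O(n)\<close>
  because Gaussian densities with bounded shifts differ by a factor \<open>exp (O(n))\<close>. This reduces the
  converse to entropy inequalities for finite sets.

  In a run of active transmitters that starts at \<open>a\<close>, receiver \<open>a\<close> decodes from the outputs
  \<open>a..a+D\<close>; these outputs then determine the inputs \<open>a+1..a+D+1\<close> one after the other. So \<open>D + 2\<close>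
  users share \<open>D + 1\<close> outputs. Away from the start of the run this fails, because the window of the
  receiver extends to the left. There one takes \<open>2(D + 2)\<close> users with the two middle receivers \<open>p\<close>
  and \<open>q = p + 1\<close>. Their windows share a set \<open>C\<close> of \<open>2D\<close> outputs, and each sees one further
  output, at an end, whose cost is partly used up by the outermost message there. Writing \<open>R\<^sub>k\<close> for
  the rate of user \<open>k\<close>, \<open>f\<close> and \<open>l\<close> for the first and the last user and \<open>g\<close> for
  \<open>1/2 log P + O(1)\<close>, this gives \<open>R\<^sub>p + R\<^sub>f \<le> g + I(W\<^sub>p; Y\<^sub>C)\<close> and
  \<open>R\<^sub>q + R\<^sub>l \<le> g + I(W\<^sub>q; Y\<^sub>C)\<close>. As \<open>W\<^sub>p\<close> and \<open>W\<^sub>q\<close> are independent, the two informations add up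
  to at most \<open>I(W\<^sub>p, W\<^sub>q; Y\<^sub>C)\<close>, hence to at most \<open>2D g\<close> minus the remaining rates.

  For the weighted bound, receiver \<open>k\<close> decodes its URLLC message from \<open>Y\<^sub>k\<close> alone, after which
  \<open>Y\<^sub>k\<close> reveals the input of user \<open>k + 1\<close>.
\<close>

section \<open>Entropy of functions on a finite set\<close>

text \<open>The constants come from how these inequalities are spent. Cut every run of active users
  into blocks of D + 2 users from its start; each full block gives up one unit \<open>g\<close>.
  Away from the left border, user k completes the j-th block of its run with probability (1 -
  \<rho>) \<rho>^(j (D + 2)), and the geometric series over j is the loss in the sum bound. A block
  alone is bounded only at the start of a run, whereas two consecutive blocks are bounded together
  anywhere; this suffices to cover runs of every length.

  The additive constants depend on K and on the gains, but not on n or P, and they may grow with K.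
  So n has to tend to infinity first, then P, then K. The direct gains may vanish, so an input is
  always recovered from the output of a neighbour through a positive cross gain.\<close>

definition fiber :: "'a set \<Rightarrow> ('a \<Rightarrow> 'b) \<Rightarrow> 'a \<Rightarrow> 'a set" where
  "fiber M f m = {m' \<in> M. f m' = f m}"

text \<open>The Shannon entropy, in nats, of \<open>f\<close> at a uniformly chosen point of
  \<open>M\<close>. The average runs over points instead of values, so entropies of functions with
  different ranges can be compared summand by summand.\<close>

definition entropy_of :: "'a set \<Rightarrow> ('a \<Rightarrow> 'b) \<Rightarrow> real" where
  "entropy_of M f = (\<Sum>m\<in>M. ln (real (card M) / real (card (fiber M f m)))) / real (card M)"

lemma fiber_self: "m \<in> M \<Longrightarrow> m \<in> fiber M f m"
  by (simp add: fiber_def)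

lemma finite_fiber: "finite M \<Longrightarrow> finite (fiber M f m)"
  by (simp add: fiber_def)

lemma fiber_card_pos: "finite M \<Longrightarrow> m \<in> M \<Longrightarrow> 0 < card (fiber M f m)"
  using fiber_self[of m M f] by (metis card_gt_0_iff empty_iff finite_fiber)

lemma fiber_eq: "f m = f m' \<Longrightarrow> fiber M f m = fiber M f m'"
  by (simp add: fiber_def)

text \<open>Each fibre carries total weight 1, so a sum over points becomes a sum over
  values.\<close>

lemma sum_inverse_card_fiber:
  assumes "finite M"
  shows "(\<Sum>m\<in>M. w (f m) / real (card (fiber M f m))) = (\<Sum>v\<in>f ` M. w v)"
proof -
  have "(\<Sum>m\<in>M. w (f m) / real (card (fiber M f m)))
      = (\<Sum>v\<in>f ` M. \<Sum>m\<in>{m \<in> M. f m = v}. w (f m) / real (card (fiber M f m)))"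
    by (rule sum.image_gen[OF assms])
  also have "\<dots> = (\<Sum>v\<in>f ` M. w v)"
  proof (rule sum.cong[OF refl])
    fix v assume "v \<in> f ` M"
    then obtain m0 where m0: "m0 \<in> M" "f m0 = v" by auto
    have C: "{m \<in> M. f m = v} = fiber M f m0" using m0 by (auto simp: fiber_def)
    have "(\<Sum>m\<in>fiber M f m0. w (f m) / real (card (fiber M f m)))
        = (\<Sum>m\<in>fiber M f m0. w v / real (card (fiber M f m0)))"
    proof (rule sum.cong[OF refl])
      fix m assume "m \<in> fiber M f m0"
      then have "f m = f m0" by (simp add: fiber_def)
      then show "w (f m) / real (card (fiber M f m)) = w v / real (card (fiber M f m0))"
        using m0 fiber_eq[of f m m0 M] by simp
    qed
    also have "\<dots> = w v"
      using fiber_card_pos[OF assms m0(1), of f] by simp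
    finally show "(\<Sum>m\<in>{m \<in> M. f m = v}. w (f m) / real (card (fiber M f m))) = w v"
      by (simp only: C)
  qed
  finally show ?thesis .
qed

text \<open>Jensen's inequality for \<open>ln\<close>, from ln x \<le> x - 1. It reduces an entropy
  inequality to the claim that some ratio of probabilities has average at most 1.\<close>

lemma sum_ln_le_of_sum_le:
  assumes "finite M" "\<And>m. m \<in> M \<Longrightarrow> 0 < r m" "(\<Sum>m\<in>M. r m) \<le> real (card M)"
  shows "(\<Sum>m\<in>M. ln (r m)) \<le> 0"
proof -
  have "(\<Sum>m\<in>M. ln (r m)) \<le> (\<Sum>m\<in>M. r m - 1)"
    by (rule sum_mono) (use assms(2) ln_le_minus_one in auto)
  also have "\<dots> \<le> 0" using assms(3) by (simp add: sum_subtractf)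
  finally show ?thesis .
qed

lemma entropy_of_mono:
  assumes "finite M"
    and "\<And>m m'. m \<in> M \<Longrightarrow> m' \<in> M \<Longrightarrow> g m = g m' \<Longrightarrow> f m = f m'"
  shows "entropy_of M f \<le> entropy_of M g"
  unfolding entropy_of_def
proof (rule divide_right_mono[OF sum_mono])
  fix m assume m: "m \<in> M"
  have "card (fiber M g m) \<le> card (fiber M f m)"
  proof (rule card_mono[OF finite_fiber[OF assms(1)]], rule subsetI)
    fix m' assume "m' \<in> fiber M g m"
    then have "m' \<in> M" "g m' = g m" by (simp_all add: fiber_def)
    with assms(2)[OF _ m] show "m' \<in> fiber M f m" by (simp add: fiber_def)
  qed
  moreover have "0 < card (fiber M g m)" "0 < card (fiber M f m)" "0 < card M"
    using fiber_card_pos[OF assms(1) m] assms(1) m by (auto simp: card_gt_0_iff)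
  ultimately have "real (card M) / real (card (fiber M f m)) \<le> real (card M) / real (card (fiber M g m))"
    and "0 < real (card M) / real (card (fiber M f m))"
    by (simp_all add: frac_le)
  then show "ln (real (card M) / real (card (fiber M f m)))
      \<le> ln (real (card M) / real (card (fiber M g m)))"
    by (rule ln_mono)
qed simp

lemma entropy_of_inj:
  assumes "finite M" "M \<noteq> {}" "inj_on f M"
  shows "entropy_of M f = ln (real (card M))"
proof -
  have "fiber M f m = {m}" if "m \<in> M" for m
    using assms(3) that by (auto simp: fiber_def inj_on_def)
  then show ?thesis using assms by (simp add: entropy_of_def)
qed

lemma entropy_of_const:
  assumes "\<And>m m'. m \<in> M \<Longrightarrow> m' \<in> M \<Longrightarrow> f m = f m'"
  shows "entropy_of M f = 0"
proof -
  have "fiber M f m = M" if "m \<in> M" for m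
    unfolding fiber_def using assms that by blast
  then show ?thesis by (simp add: entropy_of_def)
qed

lemma entropy_of_le_card_image:
  assumes "finite M" "M \<noteq> {}"
  shows "entropy_of M f \<le> ln (real (card (f ` M)))"
proof -
  let ?N = "\<lambda>m. real (card (fiber M f m))" and ?R = "real (card (f ` M))"
  have R: "0 < ?R" using assms by (auto simp: card_gt_0_iff)
  have M: "0 < real (card M)" using assms by (auto simp: card_gt_0_iff)
  have N: "0 < ?N m" if "m \<in> M" for m using fiber_card_pos[OF assms(1) that, of f] by simp
  have "(\<Sum>m\<in>M. real (card M) / (?N m * ?R)) = (\<Sum>m\<in>M. (real (card M) / ?R) / ?N m)"
    by (simp add: field_simps)
  also have "\<dots> = (\<Sum>v\<in>f ` M. real (card M) / ?R)"
    by (rule sum_inverse_card_fiber[OF assms(1)])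
  also have "\<dots> = real (card M)" using R by simp
  finally have "(\<Sum>m\<in>M. ln (real (card M) / (?N m * ?R))) \<le> 0"
    using N R M by (intro sum_ln_le_of_sum_le[OF assms(1)]) auto
  moreover have "ln (real (card M) / (?N m * ?R)) = ln (real (card M) / ?N m) - ln ?R" if "m \<in> M" for m
    using N[OF that] R M by (simp add: ln_div ln_mult)
  ultimately have "(\<Sum>m\<in>M. ln (real (card M) / ?N m)) \<le> real (card M) * ln ?R"
    by (simp add: sum_subtractf)
  then show ?thesis using M by (simp add: entropy_of_def field_simps)
qed

text \<open>As \<open>f\<close> is a function of \<open>g\<close> and also of \<open>h\<close>, this
  is the nonnegativity of the mutual information of \<open>g\<close> and \<open>h\<close> given
  \<open>f\<close>. In the ratio to be averaged the numerator \<open>?G m * ?H m\<close> counts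
  pairs (m1, m2) with m1 in the \<open>g\<close>-fibre and m2 in the \<open>h\<close>-fibre of m, so
  the sum over m can be taken first.\<close>

lemma entropy_of_submodular:
  assumes fin: "finite M"
    and gf: "\<And>m m'. m \<in> M \<Longrightarrow> m' \<in> M \<Longrightarrow> g m = g m' \<Longrightarrow> f m = f m'"
    and hf: "\<And>m m'. m \<in> M \<Longrightarrow> m' \<in> M \<Longrightarrow> h m = h m' \<Longrightarrow> f m = f m'"
  shows "entropy_of M (\<lambda>m. (g m, h m)) + entropy_of M f \<le> entropy_of M g + entropy_of M h"
proof (cases "M = {}")
  case True
  then show ?thesis by (simp add: entropy_of_def)
next
  case False
  let ?gh = "\<lambda>m. (g m, h m)"
  let ?N = "\<lambda>m. real (card (fiber M f m))" and ?G = "\<lambda>m. real (card (fiber M g m))"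
    and ?H = "\<lambda>m. real (card (fiber M h m))" and ?GH = "\<lambda>m. real (card (fiber M ?gh m))"
  have M: "0 < real (card M)" using fin False by (auto simp: card_gt_0_iff)
  have pos: "0 < ?N m" "0 < ?G m" "0 < ?H m" "0 < ?GH m" if "m \<in> M" for m
    using fiber_card_pos[OF fin that] by simp_all
  \<comment> \<open>The points that match m1 in \<open>g\<close> and m2 in \<open>h\<close> form one
    fibre of the pair or none at all. In the first case their weights add up to
    \<open>1 / ?N m1\<close>, and m1 and m2 share the value of \<open>f\<close>.\<close>
  have inner: "(\<Sum>m\<in>M. if g m1 = g m \<and> h m2 = h m then 1 / (?N m * ?GH m) else 0)
      \<le> (if f m2 = f m1 then 1 / ?N m1 else 0)" if m1: "m1 \<in> M" and m2: "m2 \<in> M" for m1 m2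
  proof (cases "\<exists>m0\<in>M. g m1 = g m0 \<and> h m2 = h m0")
    case False
    then have "(\<Sum>m\<in>M. if g m1 = g m \<and> h m2 = h m then 1 / (?N m * ?GH m) else 0) = 0"
      by (intro sum.neutral) auto
    then show ?thesis by simp
  next
    case True
    then obtain m0 where m0: "m0 \<in> M" "g m1 = g m0" "h m2 = h m0" by blast
    have f0: "f m1 = f m0" "f m2 = f m0" using gf[OF m1 m0(1)] hf[OF m2 m0(1)] m0 by auto
    have "(\<Sum>m\<in>M. if g m1 = g m \<and> h m2 = h m then 1 / (?N m * ?GH m) else 0)
        = (\<Sum>m\<in>fiber M ?gh m0. 1 / (?N m * ?GH m))"
      by (rule sum.mono_neutral_cong_right[OF fin]) (use m0 in \<open>auto simp: fiber_def\<close>)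
    also have "\<dots> = (\<Sum>m\<in>fiber M ?gh m0. 1 / (?N m0 * ?GH m0))"
    proof (rule sum.cong[OF refl])
      fix m assume m: "m \<in> fiber M ?gh m0"
      then have "f m = f m0" using gf[of m m0] m0 by (auto simp: fiber_def)
      moreover have "?gh m = ?gh m0" using m by (auto simp: fiber_def)
      ultimately show "1 / (?N m * ?GH m) = 1 / (?N m0 * ?GH m0)"
        using fiber_eq[of f m m0 M] fiber_eq[of ?gh m m0 M] by simp
    qed
    also have "\<dots> = 1 / ?N m0" using pos[OF m0(1)] by simp
    also have "?N m0 = ?N m1" using fiber_eq[of f m0 m1 M] f0 by simp
    finally show ?thesis using f0 by simp
  qed
  have "(\<Sum>m\<in>M. ?G m * ?H m / (?N m * ?GH m))
      = (\<Sum>m\<in>M. \<Sum>m1\<in>M. \<Sum>m2\<in>M. if g m1 = g m \<and> h m2 = h m then 1 / (?N m * ?GH m) else 0)"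
  proof (rule sum.cong[OF refl])
    fix m
    have "?G m = (\<Sum>m1\<in>M. if g m1 = g m then 1 else 0)" "?H m = (\<Sum>m2\<in>M. if h m2 = h m then 1 else 0)"
      using fin by (simp_all add: fiber_def sum.If_cases Int_def)
    then have "?G m * ?H m = (\<Sum>m1\<in>M. \<Sum>m2\<in>M. (if g m1 = g m then 1 else 0) * (if h m2 = h m then 1 else 0))"
      by (simp only: sum_product)
    also have "\<dots> = (\<Sum>m1\<in>M. \<Sum>m2\<in>M. if g m1 = g m \<and> h m2 = h m then 1 else 0)"
      by (intro sum.cong refl) auto
    finally have "?G m * ?H m = (\<Sum>m1\<in>M. \<Sum>m2\<in>M. if g m1 = g m \<and> h m2 = h m then 1 else 0)" .
    then show "?G m * ?H m / (?N m * ?GH m)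
        = (\<Sum>m1\<in>M. \<Sum>m2\<in>M. if g m1 = g m \<and> h m2 = h m then 1 / (?N m * ?GH m) else 0)"
      by (simp only: sum_divide_distrib) (intro sum.cong refl, auto)
  qed
  also have "\<dots> = (\<Sum>m1\<in>M. \<Sum>m\<in>M. \<Sum>m2\<in>M. if g m1 = g m \<and> h m2 = h m then 1 / (?N m * ?GH m) else 0)"
    by (rule sum.swap)
  also have "\<dots> = (\<Sum>m1\<in>M. \<Sum>m2\<in>M. \<Sum>m\<in>M. if g m1 = g m \<and> h m2 = h m then 1 / (?N m * ?GH m) else 0)"
    by (rule sum.cong[OF refl], rule sum.swap)
  also have "\<dots> \<le> (\<Sum>m1\<in>M. \<Sum>m2\<in>M. if f m2 = f m1 then 1 / ?N m1 else 0)"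
    by (intro sum_mono inner)
  also have "\<dots> = (\<Sum>m1\<in>M. ?N m1 * (1 / ?N m1))"
    using fin by (intro sum.cong[OF refl]) (simp add: fiber_def sum.If_cases Int_def)
  also have "\<dots> = (\<Sum>m1\<in>M. 1)"
    by (rule sum.cong[OF refl]) (use pos in force)
  finally have "(\<Sum>m\<in>M. ?G m * ?H m / (?N m * ?GH m)) \<le> real (card M)" by simp
  then have "(\<Sum>m\<in>M. ln (?G m * ?H m / (?N m * ?GH m))) \<le> 0"
    by (intro sum_ln_le_of_sum_le[OF fin]) (use pos in auto)
  moreover have "ln (?G m * ?H m / (?N m * ?GH m))
      = ln (real (card M) / ?GH m) + ln (real (card M) / ?N m)
        - ln (real (card M) / ?G m) - ln (real (card M) / ?H m)" if "m \<in> M" for m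
    using pos[OF that] M by (simp add: ln_div ln_mult)
  ultimately have "(\<Sum>m\<in>M. ln (real (card M) / ?GH m)) + (\<Sum>m\<in>M. ln (real (card M) / ?N m))
      \<le> (\<Sum>m\<in>M. ln (real (card M) / ?G m)) + (\<Sum>m\<in>M. ln (real (card M) / ?H m))"
    by (simp add: sum.distrib sum_subtractf)
  then show ?thesis using M
    by (simp add: entropy_of_def add_divide_distrib[symmetric] divide_right_mono)
qed

text \<open>
  Fano's inequality for an unobserved channel output: \<open>P m\<close> is the probability that the label of \<open>m\<close>
  is decoded, and \<open>Q\<close> is an output law of the decoder that depends on the key only. The proof bounds
  the mean of \<open>P m\<close> times the fibre ratio by \<open>C\<close> and uses \<open>ln x \<le> x\<close>.
\<close>

lemma entropy_of_label_le:
  assumes fin: "finite M" and ne: "M \<noteq> {}" and C1: "1 \<le> C"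
    and P: "\<And>m. m \<in> M \<Longrightarrow> 0 \<le> P m" "\<And>m. m \<in> M \<Longrightarrow> P m \<le> 1"
    and PQ: "\<And>m. m \<in> M \<Longrightarrow> P m \<le> C * Q (k m) (l m)"
    and Q: "\<And>m. m \<in> M \<Longrightarrow> (\<Sum>v\<in>l ` M. Q (k m) v) \<le> 1" "\<And>a v. 0 \<le> Q a v"
    and err: "(\<Sum>m\<in>M. 1 - P m) \<le> \<epsilon> * real (card M)"
  shows "entropy_of M (\<lambda>m. (k m, l m)) \<le> entropy_of M k + ln C + 1 + \<epsilon> * ln (real (card M))"
proof -
  let ?K = "\<lambda>m. real (card (fiber M k m))" and ?KL = "\<lambda>m. real (card (fiber M (\<lambda>m. (k m, l m)) m))"
  let ?A = "\<lambda>m. ?K m / ?KL m"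
  have C: "0 < C" using C1 by simp
  have M: "1 \<le> real (card M)" using fin ne by (simp add: Suc_leI card_gt_0_iff)
  have pos: "0 < ?K m" "0 < ?KL m" if "m \<in> M" for m
    using fiber_card_pos[OF fin that] by simp_all
  have A1: "1 \<le> ?A m" "?A m \<le> real (card M)" if "m \<in> M" for m
  proof -
    have "card (fiber M (\<lambda>m. (k m, l m)) m) \<le> card (fiber M k m)"
      by (rule card_mono[OF finite_fiber[OF fin]]) (auto simp: fiber_def)
    then show "1 \<le> ?A m" using pos[OF that] by simp
    have "card (fiber M k m) \<le> card M" by (rule card_mono[OF fin]) (auto simp: fiber_def)
    then have "?K m \<le> real (card M)" by simp
    also have "\<dots> \<le> real (card M) * ?KL m"
      using pos(2)[OF that] M by (simp add: Suc_leI)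
    finally show "?A m \<le> real (card M)" using pos[OF that] by (simp add: field_simps)
  qed
  \<comment> \<open>Inside one fibre of \<open>k\<close> the joint fibres are the fibres of
    \<open>l\<close>, so every label is counted once and the law \<open>Q\<close> sums to at most
    1.\<close>
  have inner: "(\<Sum>m\<in>fiber M k m'. Q (k m') (l m) / ?KL m) \<le> 1" if m': "m' \<in> M" for m'
  proof -
    have "(\<Sum>m\<in>fiber M k m'. Q (k m') (l m) / ?KL m)
        = (\<Sum>m\<in>fiber M k m'. Q (k m') (l m) / real (card (fiber (fiber M k m') l m)))"
    proof (rule sum.cong[OF refl])
      fix m assume "m \<in> fiber M k m'"
      then have "fiber (fiber M k m') l m = fiber M (\<lambda>m. (k m, l m)) m"
        by (auto simp: fiber_def)
      then show "Q (k m') (l m) / ?KL m = Q (k m') (l m) / real (card (fiber (fiber M k m') l m))"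
        by simp
    qed
    also have "\<dots> = (\<Sum>v\<in>l ` fiber M k m'. Q (k m') v)"
      by (rule sum_inverse_card_fiber[OF finite_fiber[OF fin]])
    also have "\<dots> \<le> (\<Sum>v\<in>l ` M. Q (k m') v)"
      by (rule sum_mono2) (use fin Q(2) in \<open>auto simp: fiber_def\<close>)
    finally show ?thesis using Q(1)[OF m'] by simp
  qed
  have "(\<Sum>m\<in>M. P m * ?A m) \<le> (\<Sum>m\<in>M. C * (Q (k m) (l m) * ?A m))"
  proof (rule sum_mono)
    fix m assume m: "m \<in> M"
    have "P m * ?A m \<le> (C * Q (k m) (l m)) * ?A m"
      by (rule mult_right_mono[OF PQ[OF m]]) (use A1[OF m] in linarith)
    then show "P m * ?A m \<le> C * (Q (k m) (l m) * ?A m)" by (simp add: mult.assoc)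
  qed
  also have "\<dots> = C * (\<Sum>m\<in>M. \<Sum>m'\<in>M. if k m' = k m then Q (k m) (l m) / ?KL m else 0)"
    unfolding sum_distrib_left[symmetric]
    using fin by (intro arg_cong[where f = "(*) C"] sum.cong[OF refl])
      (simp add: fiber_def sum.If_cases Int_def)
  also have "\<dots> = C * (\<Sum>m'\<in>M. \<Sum>m\<in>M. if k m' = k m then Q (k m) (l m) / ?KL m else 0)"
    by (subst sum.swap) (rule refl)
  also have "\<dots> = C * (\<Sum>m'\<in>M. \<Sum>m\<in>fiber M k m'. Q (k m') (l m) / ?KL m)"
    by (intro arg_cong[where f = "(*) C"] sum.cong[OF refl] sum.mono_neutral_cong_right[OF fin])
      (auto simp: fiber_def)
  also have "\<dots> \<le> C * (\<Sum>m'\<in>M. 1)"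
    using C inner by (intro mult_left_mono sum_mono) auto
  finally have PA: "(\<Sum>m\<in>M. P m * ?A m) \<le> C * real (card M)" by simp
  \<comment> \<open>Split \<open>ln (?A m)\<close> with weights \<open>P m\<close> and
    \<open>1 - P m\<close>: the first part uses ln x \<le> x at \<open>?A m / C\<close>, the second
    only that \<open>?A m\<close> is at most \<open>card M\<close>.\<close>
  have pt: "ln (?A m) \<le> P m * ?A m / C + ln C + (1 - P m) * ln (real (card M))" if m: "m \<in> M" for m
  proof -
    have A0: "0 < ?A m" using A1[OF m] by linarith
    have "ln (?A m / C) \<le> ?A m / C"
      using ln_le_minus_one[OF divide_pos_pos[OF A0 C]] by linarith
    moreover have "ln (?A m / C) = ln (?A m) - ln C" using A0 C by (rule ln_divide_pos)
    ultimately have "ln (?A m) - ln C \<le> ?A m / C" by linarith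
    then have "P m * (ln (?A m) - ln C) \<le> P m * (?A m / C)"
      using P(1)[OF m] by (rule mult_left_mono)
    moreover have "(1 - P m) * ln (?A m) \<le> (1 - P m) * ln (real (card M))"
      using A0 A1[OF m] P(2)[OF m] by (intro mult_left_mono) auto
    moreover have "P m * ln C \<le> ln C"
      using P(2)[OF m] P(1)[OF m] C1 by (simp add: mult_left_le_one_le)
    ultimately show ?thesis by (simp add: algebra_simps)
  qed
  have "(\<Sum>m\<in>M. ln (?A m)) \<le> (\<Sum>m\<in>M. P m * ?A m / C + ln C + (1 - P m) * ln (real (card M)))"
    by (rule sum_mono[OF pt])
  also have "\<dots> = (\<Sum>m\<in>M. P m * ?A m) / C + real (card M) * ln C
      + (\<Sum>m\<in>M. 1 - P m) * ln (real (card M))"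
    by (simp only: sum.distrib sum_divide_distrib sum_distrib_right) simp
  also have "\<dots> \<le> real (card M) + real (card M) * ln C + \<epsilon> * real (card M) * ln (real (card M))"
  proof (rule add_mono[OF add_mono[OF _ order_refl] mult_right_mono[OF err]])
    show "(\<Sum>m\<in>M. P m * ?A m) / C \<le> real (card M)"
      using PA C by (simp only: pos_divide_le_eq mult.commute)
    show "0 \<le> ln (real (card M))" using M by (rule ln_ge_zero)
  qed
  finally have *: "(\<Sum>m\<in>M. ln (?A m)) \<le> real (card M) * (1 + ln C + \<epsilon> * ln (real (card M)))"
    by (simp add: algebra_simps)
  have "ln (?A m) = ln (real (card M) / ?KL m) - ln (real (card M) / ?K m)" if "m \<in> M" for m
    using pos[OF that] M by (simp add: ln_div)
  then have "(\<Sum>m\<in>M. ln (real (card M) / ?KL m)) - (\<Sum>m\<in>M. ln (real (card M) / ?K m))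
      \<le> real (card M) * (1 + ln C + \<epsilon> * ln (real (card M)))"
    using * by (simp add: sum_subtractf)
  then have "((\<Sum>m\<in>M. ln (real (card M) / ?KL m)) - (\<Sum>m\<in>M. ln (real (card M) / ?K m))) / real (card M)
      \<le> 1 + ln C + \<epsilon> * ln (real (card M))"
    using M by (simp add: divide_le_eq algebra_simps)
  then show ?thesis by (simp add: entropy_of_def diff_divide_distrib)
qed

section \<open>Gaussian noise and rounding\<close>

text \<open>The parallelogram identity gives (y - v)^2 \<le> 2 (y - u)^2 + 2 c^2. The reference law
  has the larger variance 2 because for u \<noteq> v the ratio of two densities of equal variance is
  unbounded in y.\<close>

lemma normal_density_dominated:
  assumes "\<bar>u - v\<bar> \<le> c"
  shows "std_normal_density (y - u) \<le> (sqrt 2 * exp (c\<^sup>2 / 2)) * normal_density v (sqrt 2) y"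
proof -
  have "(u - v)\<^sup>2 \<le> c\<^sup>2" using assms by (metis abs_ge_zero power2_abs power_mono)
  moreover have "(y - v)\<^sup>2 + (y - u - (u - v))\<^sup>2 = 2 * (y - u)\<^sup>2 + 2 * (u - v)\<^sup>2"
    by (simp add: power2_eq_square algebra_simps)
  ultimately have "(y - v)\<^sup>2 \<le> 2 * (y - u)\<^sup>2 + 2 * c\<^sup>2"
    using zero_le_power2[of "y - u - (u - v)"] by linarith
  then have "exp (- (y - u)\<^sup>2 / 2) \<le> exp (c\<^sup>2 / 2) * exp (- (y - v)\<^sup>2 / 4)"
    by (simp add: exp_add[symmetric])
  then have "(1 / sqrt (2 * pi)) * exp (- (y - u)\<^sup>2 / 2)
      \<le> (1 / sqrt (2 * pi)) * (exp (c\<^sup>2 / 2) * exp (- (y - v)\<^sup>2 / 4))"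
    by (intro mult_left_mono) auto
  also have "\<dots> = (sqrt 2 * exp (c\<^sup>2 / 2)) * normal_density v (sqrt 2) y"
    by (simp add: normal_density_def real_sqrt_mult field_simps)
  finally show ?thesis by (simp add: std_normal_density_def)
qed

lemma nn_integral_std_normal_shift_le:
  fixes g :: "real \<Rightarrow> ennreal"
  assumes [measurable]: "g \<in> borel_measurable borel" and uv: "\<bar>u - v\<bar> \<le> c"
  shows "(\<integral>\<^sup>+ z. g (u + z) \<partial>density lborel std_normal_density)
    \<le> ennreal (sqrt 2 * exp (c\<^sup>2 / 2)) * (\<integral>\<^sup>+ y. g y \<partial>density lborel (normal_density v (sqrt 2)))"
proof -
  have "(\<integral>\<^sup>+ z. g (u + z) \<partial>density lborel std_normal_density)
      = (\<integral>\<^sup>+ z. ennreal (std_normal_density ((u + 1 * z) - u)) * g (u + 1 * z) \<partial>lborel)"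
    by (simp add: nn_integral_density)
  also have "\<dots> = (\<integral>\<^sup>+ y. ennreal (std_normal_density (y - u)) * g y \<partial>lborel)"
    by (subst nn_integral_real_affine[where c = 1 and t = u and
          f = "\<lambda>y. ennreal (std_normal_density (y - u)) * g y"]) auto
  also have "\<dots> \<le> (\<integral>\<^sup>+ y. ennreal (sqrt 2 * exp (c\<^sup>2 / 2))
      * (ennreal (normal_density v (sqrt 2) y) * g y) \<partial>lborel)"
  proof (rule nn_integral_mono)
    fix y
    have "ennreal (std_normal_density (y - u))
        \<le> ennreal ((sqrt 2 * exp (c\<^sup>2 / 2)) * normal_density v (sqrt 2) y)"
      by (rule ennreal_leI[OF normal_density_dominated[OF uv]])
    also have "\<dots> = ennreal (sqrt 2 * exp (c\<^sup>2 / 2)) * ennreal (normal_density v (sqrt 2) y)"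
      by (rule ennreal_mult) simp_all
    finally show "ennreal (std_normal_density (y - u)) * g y
        \<le> ennreal (sqrt 2 * exp (c\<^sup>2 / 2)) * (ennreal (normal_density v (sqrt 2) y) * g y)"
      by (metis mult.assoc mult_right_mono zero_le)
  qed
  also have "\<dots> = ennreal (sqrt 2 * exp (c\<^sup>2 / 2))
      * (\<integral>\<^sup>+ y. g y \<partial>density lborel (normal_density v (sqrt 2)))"
    by (simp add: nn_integral_cmult nn_integral_density)
  finally show ?thesis .
qed

text \<open>One coordinate at a time, by Fubini. Each coordinate contributes one factor, so on the
  entropy scale the loss is linear in \<open>card I\<close>.\<close>

lemma nn_integral_gaussian_shift_le:
  fixes f :: "('i \<Rightarrow> real) \<Rightarrow> ennreal" and u v :: "'i \<Rightarrow> real"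
  assumes "finite I" and "f \<in> borel_measurable (PiM I (\<lambda>_. borel))"
    and "\<And>i. i \<in> I \<Longrightarrow> \<bar>u i - v i\<bar> \<le> c"
  shows "(\<integral>\<^sup>+ z. f (\<lambda>i\<in>I. u i + z i) \<partial>PiM I (\<lambda>_. density lborel std_normal_density))
    \<le> ennreal (sqrt 2 * exp (c\<^sup>2 / 2)) ^ card I
       * (\<integral>\<^sup>+ y. f y \<partial>PiM I (\<lambda>i. density lborel (normal_density (v i) (sqrt 2))))"
  using assms
proof (induction I arbitrary: f)
  case empty
  then show ?case by (simp add: PiM_empty nn_integral_count_space_finite)
next
  case (insert i I)
  let ?S = "\<lambda>_::'i. density lborel (\<lambda>x. ennreal (std_normal_density x))"
  let ?N = "\<lambda>i. density lborel (\<lambda>x. ennreal (normal_density (v i) (sqrt 2) x))"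
  let ?C = "ennreal (sqrt 2 * exp (c\<^sup>2 / 2))"
  interpret S: product_sigma_finite ?S
    by (rule product_sigma_finite.intro, rule prob_space_imp_sigma_finite, rule prob_space_normal_density) simp
  interpret N: product_sigma_finite ?N
    by (rule product_sigma_finite.intro, rule prob_space_imp_sigma_finite, rule prob_space_normal_density) simp
  have sS: "sets (PiM J ?S) = sets (PiM J (\<lambda>_. borel))" for J
    by (intro sets_PiM_cong) simp_all
  have sN: "sets (PiM J ?N) = sets (PiM J (\<lambda>_. borel))" for J
    by (intro sets_PiM_cong) simp_all
  note [measurable] = insert.prems(1)
  have ms: "(\<lambda>z. f (\<lambda>j\<in>insert i I. u j + z j)) \<in> borel_measurable (PiM (insert i I) ?S)"
    unfolding measurable_cong_sets[OF sS refl] by measurable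
  have mN: "f \<in> borel_measurable (PiM (insert i I) ?N)"
    unfolding measurable_cong_sets[OF sN refl] by measurable
  define F where "F w = (\<integral>\<^sup>+ y. f (w(i := y)) \<partial>?N i)" for w
  have mf: "(\<lambda>(w, y). f (w(i := y))) \<in> borel_measurable (PiM I (\<lambda>_. borel) \<Otimes>\<^sub>M borel)"
    by measurable
  have mF: "F \<in> borel_measurable (PiM I (\<lambda>_. borel))"
  proof -
    have "(\<lambda>(w, y). f (w(i := y))) \<in> borel_measurable (PiM I (\<lambda>_. borel) \<Otimes>\<^sub>M ?N i)"
      using mf by (simp cong: measurable_cong_sets sets_pair_measure_cong)
    then show ?thesis unfolding F_def
      by (rule sigma_finite_measure.borel_measurable_nn_integral[OF N.sigma_finite_measures])
  qed
  have "(\<integral>\<^sup>+ z. f (\<lambda>j\<in>insert i I. u j + z j) \<partial>PiM (insert i I) ?S)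
      = (\<integral>\<^sup>+ x. \<integral>\<^sup>+ y. f (\<lambda>j\<in>insert i I. u j + (x(i := y)) j) \<partial>?S i \<partial>PiM I ?S)"
    by (rule S.product_nn_integral_insert[OF insert.hyps ms])
  also have "\<dots> = (\<integral>\<^sup>+ x. \<integral>\<^sup>+ y. f ((\<lambda>j\<in>I. u j + x j)(i := u i + y)) \<partial>?S i \<partial>PiM I ?S)"
  proof (intro nn_integral_cong arg_cong[where f = f])
    fix x y show "(\<lambda>j\<in>insert i I. u j + (x(i := y)) j) = (\<lambda>j\<in>I. u j + x j)(i := u i + y)"
      using insert.hyps by (auto simp: fun_eq_iff restrict_def)
  qed
  also have "\<dots> \<le> (\<integral>\<^sup>+ x. ?C * F (\<lambda>j\<in>I. u j + x j) \<partial>PiM I ?S)"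
  proof (rule nn_integral_mono)
    fix x
    have [measurable]: "(\<lambda>j\<in>I. u j + x j) \<in> space (PiM I (\<lambda>_. borel))" by (simp add: space_PiM)
    have "(\<lambda>y. f ((\<lambda>j\<in>I. u j + x j)(i := y))) \<in> borel_measurable borel"
      using measurable_Pair2[OF mf, of "\<lambda>j\<in>I. u j + x j"] by (simp add: space_PiM)
    then show "(\<integral>\<^sup>+ y. f ((\<lambda>j\<in>I. u j + x j)(i := u i + y)) \<partial>?S i) \<le> ?C * F (\<lambda>j\<in>I. u j + x j)"
      unfolding F_def by (rule nn_integral_std_normal_shift_le) (use insert.prems in auto)
  qed
  also have "\<dots> = ?C * (\<integral>\<^sup>+ x. F (\<lambda>j\<in>I. u j + x j) \<partial>PiM I ?S)"
  proof (rule nn_integral_cmult)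
    note [measurable] = mF
    show "(\<lambda>x. F (\<lambda>j\<in>I. u j + x j)) \<in> borel_measurable (PiM I ?S)"
      unfolding measurable_cong_sets[OF sS refl] by measurable
  qed
  also have "\<dots> \<le> ?C * (?C ^ card I * (\<integral>\<^sup>+ y. F y \<partial>PiM I ?N))"
    by (intro mult_left_mono insert.IH mF) (use insert.prems in auto)
  also have "(\<integral>\<^sup>+ y. F y \<partial>PiM I ?N) = (\<integral>\<^sup>+ y. f y \<partial>PiM (insert i I) ?N)"
    unfolding F_def by (rule N.product_nn_integral_insert[OF insert.hyps mN, symmetric])
  finally show ?case using insert.hyps by (simp add: mult.assoc)
qed

lemma measure_gaussian_shift_le:
  fixes u v :: "'i \<Rightarrow> real"
  assumes I: "finite I" and A: "A \<in> sets (PiM I (\<lambda>_. borel))"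
    and uv: "\<And>i. i \<in> I \<Longrightarrow> \<bar>u i - v i\<bar> \<le> c"
  shows "measure (PiM I (\<lambda>_. density lborel std_normal_density))
      {z \<in> space (PiM I (\<lambda>_. density lborel std_normal_density)). (\<lambda>i\<in>I. u i + z i) \<in> A}
    \<le> (sqrt 2 * exp (c\<^sup>2 / 2)) ^ card I
       * measure (PiM I (\<lambda>i. density lborel (normal_density (v i) (sqrt 2)))) A"
proof -
  let ?S = "PiM I (\<lambda>_::'i. density lborel (\<lambda>x. ennreal (std_normal_density x)))"
  let ?N = "PiM I (\<lambda>i. density lborel (\<lambda>x. ennreal (normal_density (v i) (sqrt 2) x)))"
  interpret S: prob_space ?S by (intro prob_space_PiM prob_space_normal_density) simp
  interpret N: prob_space ?N by (intro prob_space_PiM prob_space_normal_density) simp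
  have sS: "sets ?S = sets (PiM I (\<lambda>_. borel))" by (intro sets_PiM_cong) simp_all
  have sN: "sets ?N = sets (PiM I (\<lambda>_. borel))" by (intro sets_PiM_cong) simp_all
  note [measurable] = A
  have B: "{z \<in> space ?S. (\<lambda>i\<in>I. u i + z i) \<in> A} \<in> sets ?S"
    unfolding pred_def[symmetric] measurable_cong_sets[OF sS refl] by measurable
  have "ennreal (measure ?S {z \<in> space ?S. (\<lambda>i\<in>I. u i + z i) \<in> A})
      = (\<integral>\<^sup>+ z. indicator A (\<lambda>i\<in>I. u i + z i) \<partial>?S)"
    unfolding S.emeasure_eq_measure[symmetric] nn_integral_indicator[OF B, symmetric]
    by (intro nn_integral_cong) (simp split: split_indicator)
  also have "\<dots> \<le> ennreal (sqrt 2 * exp (c\<^sup>2 / 2)) ^ card I * (\<integral>\<^sup>+ y. indicator A y \<partial>?N)"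
    by (rule nn_integral_gaussian_shift_le[OF I _ uv]) (use A in auto)
  also have "(\<integral>\<^sup>+ y. indicator A y \<partial>?N) = ennreal (measure ?N A)"
    using A by (simp add: sN N.emeasure_eq_measure)
  also have "ennreal (sqrt 2 * exp (c\<^sup>2 / 2)) ^ card I * ennreal (measure ?N A)
      = ennreal ((sqrt 2 * exp (c\<^sup>2 / 2)) ^ card I * measure ?N A)"
    by (subst ennreal_power, simp, rule ennreal_mult[symmetric]) simp_all
  finally show ?thesis
    by (subst (asm) ennreal_le_iff) auto
qed

text \<open>Gaussian weights of width R on the integers sum to the order of R, uniformly in
  \<open>b\<close>. Expanding (|k| / R - 1)^2 \<ge> 0 replaces them by geometric weights with ratio
  exp (-2 / R).\<close>

lemma sum_gaussian_int_le:
  assumes R: "1 \<le> (R::real)"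
  shows "(\<Sum>k\<in>{- int b..int b}. exp (1 - (real_of_int k)\<^sup>2 / R\<^sup>2)) \<le> 2 * exp 2 * (1 + R)"
proof -
  define q where "q = exp (- 2 / R)"
  have q: "0 < q" "q < 1" using R by (auto simp: q_def)
  have "1 + 2 / R \<le> exp (2 / R)" by (rule exp_ge_add_one_self)
  then have "q \<le> 1 / (1 + 2 / R)"
    using R by (simp add: q_def exp_minus field_simps)
  then have "1 / (1 - q) \<le> 1 + R"
    using q R by (simp add: field_simps)
  have pt: "exp (1 - (real_of_int k)\<^sup>2 / R\<^sup>2) \<le> exp 2 * q ^ nat \<bar>k\<bar>" for k
  proof -
    have "0 \<le> (\<bar>real_of_int k\<bar> / R - 1)\<^sup>2" by simp
    also have "\<dots> = (real_of_int k)\<^sup>2 / R\<^sup>2 - 2 * (\<bar>real_of_int k\<bar> / R) + 1"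
      by (simp add: power2_diff power_divide)
    finally have "1 - (real_of_int k)\<^sup>2 / R\<^sup>2 \<le> 2 + real (nat \<bar>k\<bar>) * (- 2 / R)"
      by (simp add: field_simps)
    then have "exp (1 - (real_of_int k)\<^sup>2 / R\<^sup>2) \<le> exp (2 + real (nat \<bar>k\<bar>) * (- 2 / R))" by simp
    also have "\<dots> = exp 2 * q ^ nat \<bar>k\<bar>"
      by (simp only: exp_add q_def exp_of_nat_mult)
    finally show ?thesis .
  qed
  have "(\<Sum>k\<in>{- int b..int b}. exp (1 - (real_of_int k)\<^sup>2 / R\<^sup>2))
      \<le> (\<Sum>k\<in>{- int b..int b}. exp 2 * q ^ nat \<bar>k\<bar>)"
    by (rule sum_mono[OF pt])
  also have "\<dots> \<le> (\<Sum>k\<in>int ` {..b} \<union> (\<lambda>j. - int j) ` {..b}. exp 2 * q ^ nat \<bar>k\<bar>)"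
  proof (rule sum_mono2)
    show "{- int b..int b} \<subseteq> int ` {..b} \<union> (\<lambda>j. - int j) ` {..b}"
    proof
      fix k assume k: "k \<in> {- int b..int b}"
      show "k \<in> int ` {..b} \<union> (\<lambda>j. - int j) ` {..b}"
      proof (cases "0 \<le> k")
        case True
        with k show ?thesis by (intro UnI1 image_eqI[of _ _ "nat k"]) auto
      next
        case False
        with k show ?thesis by (intro UnI2 image_eqI[of _ _ "nat (- k)"]) auto
      qed
    qed
  qed (use q in auto)
  also have "\<dots> \<le> (\<Sum>k\<in>int ` {..b}. exp 2 * q ^ nat \<bar>k\<bar>) + (\<Sum>k\<in>(\<lambda>j. - int j) ` {..b}. exp 2 * q ^ nat \<bar>k\<bar>)"
    using q by (subst sum_Un) (auto intro!: sum_nonneg)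
  also have "\<dots> = 2 * exp 2 * (\<Sum>j\<le>b. q ^ j)"
    by (simp add: sum.reindex inj_on_def sum_distrib_left mult.assoc)
  also have "\<dots> \<le> 2 * exp 2 * (1 / (1 - q))"
  proof (rule mult_left_mono)
    have "(\<Sum>j\<le>b. q ^ j) = (1 - q ^ Suc b) / (1 - q)"
      using q by (simp add: sum_gp0)
    also have "\<dots> \<le> 1 / (1 - q)" using q by (intro divide_right_mono) auto
    finally show "(\<Sum>j\<le>b. q ^ j) \<le> 1 / (1 - q)" .
  qed simp
  also have "\<dots> \<le> 2 * exp 2 * (1 + R)"
    using \<open>1 / (1 - q) \<le> 1 + R\<close> by (intro mult_left_mono) auto
  finally show ?thesis .
qed

text \<open>Counting by an exponential weight instead of a volume: the product of the factors exp (1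
  - v(t)^2 / R^2) is at least 1 on the ball and splits over the coordinates. So the count is at most
  a power of a one-dimensional sum of order R.\<close>

lemma card_lattice_points_le:
  fixes V :: "('t \<Rightarrow> int) set"
  assumes T: "finite T" and R: "1 \<le> (R::real)" and V: "V \<subseteq> T \<rightarrow>\<^sub>E UNIV"
    and le: "\<And>v. v \<in> V \<Longrightarrow> (\<Sum>t\<in>T. (real_of_int (v t))\<^sup>2) \<le> real (card T) * R\<^sup>2"
  shows "finite V" and "real (card V) \<le> (2 * exp 2 * (1 + R)) ^ card T"
proof -
  \<comment> \<open>Any box around the ball would do: it only keeps the sums finite, and the bound
    on them does not involve \<open>b\<close>.\<close>
  define b where "b = nat \<lceil>real (card T) * R\<^sup>2\<rceil>"
  have sub: "V \<subseteq> T \<rightarrow>\<^sub>E {- int b..int b}"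
  proof (rule subsetI, rule PiE_I)
    fix v t assume v: "v \<in> V" and t: "t \<in> T"
    have "(real_of_int (v t))\<^sup>2 \<le> (\<Sum>t\<in>T. (real_of_int (v t))\<^sup>2)"
      using T t by (intro member_le_sum) auto
    then have "(real_of_int (v t))\<^sup>2 \<le> real (card T) * R\<^sup>2" using le[OF v] by linarith
    moreover have "\<bar>v t\<bar> \<le> (v t)\<^sup>2"
    proof (cases "v t = 0")
      case False
      then have "\<bar>v t\<bar> * 1 \<le> \<bar>v t\<bar> * \<bar>v t\<bar>" by (intro mult_left_mono) auto
      then show ?thesis by (simp add: power2_eq_square)
    qed simp
    then have "\<bar>real_of_int (v t)\<bar> \<le> (real_of_int (v t))\<^sup>2"
      by (metis of_int_abs of_int_le_iff of_int_power)
    ultimately have "\<bar>real_of_int (v t)\<bar> \<le> real (card T) * R\<^sup>2" by linarith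
    also have "\<dots> \<le> real b" unfolding b_def by (rule real_nat_ceiling_ge)
    finally show "v t \<in> {- int b..int b}" by auto
  next
    fix v t assume "v \<in> V" "t \<notin> T"
    then show "v t = undefined" using V by (auto simp: PiE_def extensional_def)
  qed
  have finB: "finite (T \<rightarrow>\<^sub>E {- int b..int b})" using T by (intro finite_PiE) auto
  show "finite V" by (rule finite_subset[OF sub finB])
  have ge1: "1 \<le> (\<Prod>t\<in>T. exp (1 - (real_of_int (v t))\<^sup>2 / R\<^sup>2))" if v: "v \<in> V" for v
  proof -
    have "(\<Sum>t\<in>T. (real_of_int (v t))\<^sup>2 / R\<^sup>2) \<le> real (card T)"
      using le[OF v] R by (simp add: sum_divide_distrib[symmetric] field_simps)
    then have "0 \<le> (\<Sum>t\<in>T. 1 - (real_of_int (v t))\<^sup>2 / R\<^sup>2)" by (simp add: sum_subtractf)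
    then show ?thesis using T by (simp add: exp_sum[symmetric])
  qed
  have "real (card V) = (\<Sum>v\<in>V. 1)" by simp
  also have "\<dots> \<le> (\<Sum>v\<in>V. \<Prod>t\<in>T. exp (1 - (real_of_int (v t))\<^sup>2 / R\<^sup>2))"
    by (rule sum_mono[OF ge1])
  also have "\<dots> \<le> (\<Sum>v\<in>T \<rightarrow>\<^sub>E {- int b..int b}. \<Prod>t\<in>T. exp (1 - (real_of_int (v t))\<^sup>2 / R\<^sup>2))"
    by (rule sum_mono2[OF finB sub]) (auto intro!: prod_nonneg)
  also have "\<dots> = (\<Prod>t\<in>T. \<Sum>k\<in>{- int b..int b}. exp (1 - (real_of_int k)\<^sup>2 / R\<^sup>2))"
    by (rule prod_sum_PiE[symmetric, OF T]) auto
  also have "\<dots> \<le> (\<Prod>t\<in>T. 2 * exp 2 * (1 + R))"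
    by (intro prod_mono conjI sum_nonneg sum_gaussian_int_le[OF R]) auto
  also have "\<dots> = (2 * exp 2 * (1 + R)) ^ card T" by simp
  finally show "real (card V) \<le> (2 * exp 2 * (1 + R)) ^ card T" .
qed

section \<open>Receivers and their windows\<close>

text \<open>Information moves by one receiver per round, so after j rounds only outputs at distance
  at most j matter. On the left, an inactive receiver just outside the window also stops it, since
  inactive receivers forward nothing. With \<open>lo = 0\<close> this is automatic:
  \<open>lo - 1\<close> is then 0, which is never active.\<close>

lemma rx_history_cong:
  assumes "k \<in> {lo..hi}" "k + j \<le> hi" "lo + j \<le> k \<or> lo - 1 \<notin> active_set K s"
    and y: "\<And>i. i \<in> {lo..hi} \<Longrightarrow> i \<in> active_set K s \<Longrightarrow> y i = y' i"
  shows "rx_history K c s y j k = rx_history K c s y' j k"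
  using assms(1-3)
proof (induction j arbitrary: k)
  case 0
  then show ?case by simp
next
  case (Suc j)
  have own: "rx_history K c s y j k = rx_history K c s y' j k"
    by (rule Suc.IH) (use Suc.prems in auto)
  have nb: "y m = y' m \<and> rx_history K c s y j m = rx_history K c s y' j m" if m: "m \<in> active_nbrs K s k" for m
  proof -
    have act: "m \<in> active_set K s" and mk: "m = k - 1 \<or> m = k + 1" and m1: "1 \<le> m"
      using m by (auto simp: active_nbrs_def nbrs_def active_set_def)
    have in_lo: "lo \<le> m"
    proof (cases "m = k + 1")
      case False
      then have mk': "m = k - 1" using mk by simp
      show ?thesis
      proof (rule ccontr)
        assume "\<not> lo \<le> m"
        then have "m = lo - 1" "\<not> lo + Suc j \<le> k" using mk' Suc.prems m1 by auto
        then show False using Suc.prems act by auto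
      qed
    qed (use Suc.prems in auto)
    have mem: "m \<in> {lo..hi}" using in_lo mk Suc.prems by auto
    have "rx_history K c s y j m = rx_history K c s y' j m"
      by (rule Suc.IH[OF mem]) (use mk Suc.prems m1 in auto)
    then show ?thesis using y[OF mem act] by simp
  qed
  show ?case
  proof (rule ext)
    fix p :: "nat \<times> nat"
    obtain i m where [simp]: "p = (i, m)" by (cases p)
    show "rx_history K c s y (Suc j) k p = rx_history K c s y' (Suc j) k p"
      using own nb[of m] by simp
  qed
qed

definition output_of :: "nat \<Rightarrow> (nat \<times> nat \<Rightarrow> real) \<Rightarrow> nat \<Rightarrow> nat \<Rightarrow> real" where
  "output_of n y k = (\<lambda>t\<in>{1..n}. y (k, t))"

text \<open>Both kinds of decoder become functions of the whole output array, so any set of messages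
  can be decoded jointly in one step. Which outputs a decision really uses is the content of the
  congruence lemmas.\<close>

definition decision :: "nat \<Rightarrow> nat \<Rightarrow> nat \<Rightarrow> code \<Rightarrow> activity \<Rightarrow> bool \<times> nat \<Rightarrow> (nat \<times> nat \<Rightarrow> real) \<Rightarrow> nat" where
  "decision D K n c s i y =
     (let k = snd i; Y = output_of n y in
      if fst i then dec_urllc c s k (Y k) else dec_embb c s k (Y k) (rx_history K c s Y D k))"

lemma output_of_measurable:
  assumes "k \<in> {1..K}"
  shows "(\<lambda>y. output_of n y k) \<in> PiM ({1..K} \<times> {1..n}) (\<lambda>_. borel) \<rightarrow>\<^sub>M output_space n"
  unfolding output_of_def output_space_def
  by (rule measurable_restrict, rule measurable_component_singleton) (use assms in auto)

lemma rx_history_measurable: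
  assumes mc: "measurable_code D K n c" and "j \<le> D" and "k \<in> active_set K s"
  shows "(\<lambda>y. rx_history K c s (output_of n y) j k)
    \<in> PiM ({1..K} \<times> {1..n}) (\<lambda>_. borel) \<rightarrow>\<^sub>M history_space K s j k"
  using assms(2,3)
proof (induction j arbitrary: k)
  case 0
  then show ?case by (simp add: history_space_def PiM_empty)
next
  case (Suc j)
  let ?M = "PiM ({1..K} \<times> {1..n}) (\<lambda>_. borel :: real measure)"
  show ?case
    unfolding history_space_def
  proof (rule measurable_PiM_single')
    show "(\<lambda>y. rx_history K c s (output_of n y) (Suc j) k) \<in>
      space ?M \<rightarrow> ({1..Suc j} \<times> active_nbrs K s k \<rightarrow>\<^sub>E space coop_msg_space)"
    proof (rule funcsetI, rule PiE_I)
      fix y p assume "p \<in> {1..Suc j} \<times> active_nbrs K s k"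
      then show "rx_history K c s (output_of n y) (Suc j) k p \<in> space coop_msg_space"
        by (simp add: coop_msg_space_def space_PiM)
    next
      \<comment> \<open>Off the index set the history still has the value \<open>undefined\<close>
        of round 0, as extensionality in \<open>history_space\<close> demands.\<close>
      fix y p assume y: "y \<in> space ?M" and p: "p \<notin> {1..Suc j} \<times> active_nbrs K s k"
      obtain i m where [simp]: "p = (i, m)" by (cases p)
      have "rx_history K c s (output_of n y) j k \<in> space (history_space K s j k)"
        using measurable_space[OF Suc.IH[of k] y] Suc.prems by simp
      then have "rx_history K c s (output_of n y) j k (i, m) = undefined"
        using p by (auto simp: history_space_def space_PiM PiE_def extensional_def)
      then show "rx_history K c s (output_of n y) (Suc j) k p = undefined"
        using p by auto
    qed
  next
    fix p assume p: "p \<in> {1..Suc j} \<times> active_nbrs K s k"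
    obtain i m where [simp]: "p = (i, m)" by (cases p)
    have m: "m \<in> active_nbrs K s k" "m \<in> active_set K s" "m \<in> {1..K}"
      using p by (auto simp: active_nbrs_def active_set_def)
    show "(\<lambda>y. rx_history K c s (output_of n y) (Suc j) k p) \<in> ?M \<rightarrow>\<^sub>M coop_msg_space"
    proof (cases "i = Suc j")
      case True
      have km: "k \<in> active_nbrs K s m"
        using m Suc.prems by (auto simp: active_nbrs_def nbrs_def active_set_def)
      have "Suc j \<in> {1..D}" using Suc.prems by simp
      with mc m(2) km have "(\<lambda>(y, r). coop c s (Suc j) m k y r)
          \<in> output_space n \<Otimes>\<^sub>M history_space K s (Suc j - 1) m \<rightarrow>\<^sub>M coop_msg_space"
        unfolding measurable_code_def by blast
      then have "(\<lambda>(y, r). coop c s (Suc j) m k y r)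
          \<in> output_space n \<Otimes>\<^sub>M history_space K s j m \<rightarrow>\<^sub>M coop_msg_space" by simp
      from measurable_compose[OF measurable_Pair[OF output_of_measurable[OF m(3)] Suc.IH[of m]] this]
      have "(\<lambda>y. coop c s (Suc j) m k (output_of n y m) (rx_history K c s (output_of n y) j m))
          \<in> ?M \<rightarrow>\<^sub>M coop_msg_space"
        using m Suc.prems by simp
      then show ?thesis using True m by simp
    next
      case False
      then have ij: "(i, m) \<in> {1..j} \<times> active_nbrs K s k" using p by auto
      have "(\<lambda>y. rx_history K c s (output_of n y) j k (i, m)) \<in> ?M \<rightarrow>\<^sub>M coop_msg_space"
        using measurable_compose[OF Suc.IH[of k, unfolded history_space_def] measurable_component_singleton[OF ij]]
          Suc.prems by simp
      then show ?thesis using False by simp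
    qed
  qed
qed

lemma decision_measurable:
  assumes mc: "measurable_code D K n c"
    and i: "i \<in> {True} \<times> urllc_set K s \<union> {False} \<times> active_set K s"
  shows "decision D K n c s i \<in> PiM ({1..K} \<times> {1..n}) (\<lambda>_. borel) \<rightarrow>\<^sub>M count_space UNIV"
proof (cases "fst i")
  case True
  then have k: "snd i \<in> urllc_set K s" "snd i \<in> {1..K}" using i by (auto simp: urllc_set_def)
  have "dec_urllc c s (snd i) \<in> output_space n \<rightarrow>\<^sub>M count_space UNIV"
    using mc k unfolding measurable_code_def by simp
  from measurable_compose[OF output_of_measurable[OF k(2)] this] True
  show ?thesis by (simp add: decision_def[abs_def] Let_def)
next
  case False
  then have k: "snd i \<in> active_set K s" "snd i \<in> {1..K}" using i by (auto simp: active_set_def)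
  have "(\<lambda>(y, r). dec_embb c s (snd i) y r)
      \<in> output_space n \<Otimes>\<^sub>M history_space K s D (snd i) \<rightarrow>\<^sub>M count_space UNIV"
    using mc k unfolding measurable_code_def by simp
  from measurable_compose[OF measurable_Pair[OF output_of_measurable[OF k(2)]
        rx_history_measurable[OF mc order_refl k(1)]] this] False
  show ?thesis by (simp add: decision_def[abs_def] Let_def)
qed

lemma decision_cong_urllc:
  assumes "\<And>t. t \<in> {1..n} \<Longrightarrow> y (k, t) = y' (k, t)"
  shows "decision D K n c s (True, k) y = decision D K n c s (True, k) y'"
  using assms by (simp add: decision_def Let_def output_of_def cong: restrict_cong)

lemma decision_cong_embb:
  assumes k: "k \<in> active_set K s" "k \<in> {lo..hi}" "k + D \<le> hi" "lo + D \<le> k \<or> lo - 1 \<notin> active_set K s"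
    and y: "\<And>i t. i \<in> {lo..hi} \<Longrightarrow> i \<in> active_set K s \<Longrightarrow> t \<in> {1..n} \<Longrightarrow> y (i, t) = y' (i, t)"
  shows "decision D K n c s (False, k) y = decision D K n c s (False, k) y'"
proof -
  have out: "output_of n y i = output_of n y' i" if "i \<in> {lo..hi}" "i \<in> active_set K s" for i
    using y[OF that] by (simp add: output_of_def cong: restrict_cong)
  have "rx_history K c s (output_of n y) D k = rx_history K c s (output_of n y') D k"
    by (rule rx_history_cong[OF k(2-4) out])
  then show ?thesis using out[OF k(2,1)] by (simp add: decision_def Let_def)
qed

section \<open>Entropy bounds for a fixed code and activity pattern\<close>

lemma floor_sq_le: "(real_of_int \<lfloor>x::real\<rfloor>)\<^sup>2 \<le> 2 * x\<^sup>2 + 2"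
proof -
  have "\<bar>real_of_int \<lfloor>x\<rfloor>\<bar> \<le> \<bar>x\<bar> + 1" by linarith
  then have "(real_of_int \<lfloor>x\<rfloor>)\<^sup>2 \<le> (\<bar>x\<bar> + 1)\<^sup>2" by (metis abs_ge_zero power2_abs power_mono)
  also have "\<dots> \<le> 2 * x\<^sup>2 + 2"
    using zero_le_power2[of "\<bar>x\<bar> - 1"] by (simp add: power2_eq_square algebra_simps)
  finally show ?thesis .
qed

lemma sq_sum3_le: "((a::real) + b + d)\<^sup>2 \<le> 3 * (a\<^sup>2 + b\<^sup>2 + d\<^sup>2)"
  using zero_le_power2[of "a - b"] zero_le_power2[of "a - d"] zero_le_power2[of "b - d"]
  by (simp add: power2_eq_square algebra_simps)

text \<open>One blocklength and one activity pattern are fixed; rates enter only through the message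
  counts, and \<open>\<epsilon>\<close> bounds the error probability averaged over the message
  tuples. The gain bound includes the indices 0 and K + 1 because border outputs, too, are written
  with three inputs, the one outside the network being 0.\<close>

locale wyner_block =
  fixes h :: "nat \<Rightarrow> nat \<Rightarrow> real" and D K n :: nat and c :: code and s :: activity
    and NU :: nat and NE :: "nat \<Rightarrow> nat" and H g P \<epsilon> :: real
  assumes K2: "2 \<le> K"
    and NU: "1 \<le> NU" and NE: "\<And>k. 1 \<le> NE k"
    and h_nonneg: "\<And>i k. 0 \<le> h i k"
    and h_le: "\<And>i k. i \<le> K + 1 \<Longrightarrow> k \<le> K + 1 \<Longrightarrow> h i k \<le> H"
    and g_pos: "0 < g" and g_le: "\<And>k. 1 \<le> k \<Longrightarrow> k \<le> K \<Longrightarrow> g \<le> h k (k + 1) \<and> g \<le> h (k + 1) k"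
    and measurable: "measurable_code D K n c"
    and eps: "0 \<le> \<epsilon>" and P0: "0 \<le> P"
    and power: "\<And>mU mE k. mU \<in> PiE_dflt (urllc_set K s) 0 (\<lambda>_. {1..NU}) \<Longrightarrow>
      mE \<in> PiE_dflt (active_set K s) 0 (\<lambda>k. {1..NE k}) \<Longrightarrow> k \<in> {1..K} \<Longrightarrow>
      (\<Sum>t = 1..n. (channel_input K c s mU mE k t)\<^sup>2) \<le> real n * P"
    and error: "(\<Sum>(mU, mE)\<in>PiE_dflt (urllc_set K s) 0 (\<lambda>_. {1..NU}) \<times> PiE_dflt (active_set K s) 0 (\<lambda>k. {1..NE k}).
        measure (noise_measure K n) {z \<in> space (noise_measure K n). decoding_error h D K n c s mU mE z})
      \<le> \<epsilon> * real (card (PiE_dflt (urllc_set K s) 0 (\<lambda>_. {1..NU}) \<times> PiE_dflt (active_set K s) 0 (\<lambda>k. {1..NE k})))"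
begin

section \<open>Message tuples, partial observations and their joint entropies\<close>

definition "Msgs = PiE_dflt (urllc_set K s) 0 (\<lambda>_. {1..NU}) \<times> PiE_dflt (active_set K s) 0 (\<lambda>k. {1..NE k})"

text \<open>Index \<open>(True, k)\<close> stands for the URLLC message of user \<open>k\<close>, \<open>(False, k)\<close> for its eMBB message.\<close>

definition Idx :: "(bool \<times> nat) set" where
  "Idx = {True} \<times> urllc_set K s \<union> {False} \<times> active_set K s"

definition size_of :: "bool \<times> nat \<Rightarrow> nat" where
  "size_of i = (if fst i then NU else NE (snd i))"

definition entry :: "(nat \<Rightarrow> nat) \<times> (nat \<Rightarrow> nat) \<Rightarrow> bool \<times> nat \<Rightarrow> nat" where
  "entry m i = (if fst i then fst m (snd i) else snd m (snd i))"

definition input :: "(nat \<Rightarrow> nat) \<times> (nat \<Rightarrow> nat) \<Rightarrow> nat \<Rightarrow> nat \<Rightarrow> real" where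
  "input m = channel_input K c s (fst m) (snd m)"

definition clean :: "(nat \<Rightarrow> nat) \<times> (nat \<Rightarrow> nat) \<Rightarrow> nat \<times> nat \<Rightarrow> real" where
  "clean m i = h (fst i) (fst i) * input m (fst i) (snd i) + (\<Sum>j\<in>nbrs K (fst i). h j (fst i) * input m j (snd i))"

text \<open>Restricting to the index sets puts all partial observations into one type. Thus
  \<open>ent\<close> becomes a set function of \<open>S\<close> and \<open>C\<close>, and
  submodularity can be stated with unions and intersections.\<close>

definition key :: "(bool \<times> nat) set \<Rightarrow> nat set \<Rightarrow> (nat \<Rightarrow> nat) \<times> (nat \<Rightarrow> nat)
    \<Rightarrow> (bool \<times> nat \<Rightarrow> nat) \<times> (nat \<times> nat \<Rightarrow> int)" where
  "key S C m = (restrict (entry m) S, restrict (\<lambda>i. \<lfloor>clean m i\<rfloor>) (C \<times> {1..n}))"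

definition ent :: "(bool \<times> nat) set \<Rightarrow> nat set \<Rightarrow> real" where
  "ent S C = entropy_of Msgs (key S C)"

definition lsize :: "(bool \<times> nat) set \<Rightarrow> real" where
  "lsize J = (\<Sum>i\<in>J. ln (real (size_of i)))"

abbreviation "Noise \<equiv> noise_measure K n"
abbreviation "Grid \<equiv> {1..K} \<times> {1..n}"

lemma finite_active: "finite (active_set K s)" and finite_urllc: "finite (urllc_set K s)"
  by (simp_all add: active_set_def urllc_set_def)

lemma urllc_subset: "urllc_set K s \<subseteq> active_set K s"
  by (auto simp: active_set_def urllc_set_def)

lemma active_subset: "active_set K s \<subseteq> {1..K}"
  by (auto simp: active_set_def)

lemma finite_Idx: "finite Idx"
  by (simp add: Idx_def finite_active finite_urllc)

lemma finite_Msgs: "finite Msgs"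
  unfolding Msgs_def by (intro finite_cartesian_product finite_PiE_dflt finite_active finite_urllc) auto

lemma Msgs_nonempty: "Msgs \<noteq> {}"
  using NU NE by (auto simp: Msgs_def)

lemma entry_range: "m \<in> Msgs \<Longrightarrow> i \<in> Idx \<Longrightarrow> entry m i \<in> {1..size_of i}"
  by (auto simp: Msgs_def Idx_def size_of_def entry_def PiE_dflt_def)

lemma entry_inj:
  assumes "m \<in> Msgs" "m' \<in> Msgs" "\<And>i. i \<in> Idx \<Longrightarrow> entry m i = entry m' i"
  shows "m = m'"
proof (rule prod_eqI; rule ext)
  fix k
  show "fst m k = fst m' k"
    using assms(1,2) assms(3)[of "(True, k)"]
    by (cases "k \<in> urllc_set K s") (auto simp: Msgs_def Idx_def entry_def PiE_dflt_def)
  show "snd m k = snd m' k"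
    using assms(1,2) assms(3)[of "(False, k)"]
    by (cases "k \<in> active_set K s") (auto simp: Msgs_def Idx_def entry_def PiE_dflt_def)
qed

lemma ln_card_Msgs: "ln (real (card Msgs)) = lsize Idx"
proof -
  have "card Msgs = NU ^ card (urllc_set K s) * (\<Prod>k\<in>active_set K s. NE k)"
    unfolding Msgs_def card_cartesian_product
    by (subst (1 2) card_PiE_dflt) (auto simp: finite_active finite_urllc)
  moreover have "lsize Idx = (\<Sum>i\<in>{True} \<times> urllc_set K s. ln (real (size_of i)))
      + (\<Sum>i\<in>{False} \<times> active_set K s. ln (real (size_of i)))"
    unfolding lsize_def Idx_def
    by (rule sum.union_disjoint) (auto simp: finite_active finite_urllc)
  moreover have "(\<Sum>i\<in>{True} \<times> urllc_set K s. ln (real (size_of i))) = real (card (urllc_set K s)) * ln (real NU)"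
    by (simp add: sum.cartesian_product' size_of_def)
  moreover have "(\<Sum>i\<in>{False} \<times> active_set K s. ln (real (size_of i))) = (\<Sum>k\<in>active_set K s. ln (real (NE k)))"
    by (simp add: sum.cartesian_product' size_of_def)
  moreover have "ln (\<Prod>k\<in>active_set K s. real (NE k)) = (\<Sum>k\<in>active_set K s. ln (real (NE k)))"
    using NE by (intro ln_prod finite_active) (simp add: Suc_le_eq)
  moreover have "0 < (\<Prod>k\<in>active_set K s. real (NE k))"
    using NE by (intro prod_pos) (simp add: Suc_le_eq)
  ultimately show ?thesis using NU by (simp add: ln_mult ln_realpow)
qed

lemma ent_submod:
  "ent (S \<union> S') (C \<union> C') + ent (S \<inter> S') (C \<inter> C') \<le> ent S C + ent S' C'"
proof -
  have restr: "restrict f A = restrict f' A \<longleftrightarrow> (\<forall>x\<in>A. f x = f' x)" for f f' :: "'x \<Rightarrow> 'y" and A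
    by (auto simp: fun_eq_iff restrict_def)
  have "ent (S \<union> S') (C \<union> C') \<le> entropy_of Msgs (\<lambda>m. (key S C m, key S' C' m))"
    unfolding ent_def by (rule entropy_of_mono[OF finite_Msgs]) (auto simp: key_def restr)
  moreover have "entropy_of Msgs (\<lambda>m. (key S C m, key S' C' m)) + entropy_of Msgs (key (S \<inter> S') (C \<inter> C'))
      \<le> entropy_of Msgs (key S C) + entropy_of Msgs (key S' C')"
    by (rule entropy_of_submodular[OF finite_Msgs]) (auto simp: key_def restr)
  ultimately show ?thesis by (simp add: ent_def)
qed

lemma ent_empty: "ent {} {} = 0"
  unfolding ent_def by (rule entropy_of_const) (simp add: key_def fun_eq_iff restrict_def)

lemma ent_disjoint_le:
  assumes "S \<inter> S' = {}" "C \<inter> C' = {}"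
  shows "ent (S \<union> S') (C \<union> C') \<le> ent S C + ent S' C'"
  using ent_submod[of S S' C C'] assms by (simp add: ent_empty)

lemma ent_determined:
  assumes "\<And>m m'. m \<in> Msgs \<Longrightarrow> m' \<in> Msgs \<Longrightarrow> key S C m = key S C m' \<Longrightarrow> key S' C' m = key S' C' m'"
  shows "ent S' C' \<le> ent S C"
  unfolding ent_def using assms by (intro entropy_of_mono[OF finite_Msgs])

lemma key_eqD:
  assumes "key S C m = key S C m'"
  shows "i \<in> S \<Longrightarrow> entry m i = entry m' i"
    and "k \<in> C \<Longrightarrow> t \<in> {1..n} \<Longrightarrow> \<lfloor>clean m (k, t)\<rfloor> = \<lfloor>clean m' (k, t)\<rfloor>"
proof -
  have e: "restrict (entry m) S = restrict (entry m') S"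
    and f: "restrict (\<lambda>i. \<lfloor>clean m i\<rfloor>) (C \<times> {1..n}) = restrict (\<lambda>i. \<lfloor>clean m' i\<rfloor>) (C \<times> {1..n})"
    using assms by (simp_all add: key_def)
  show "entry m i = entry m' i" if "i \<in> S" using fun_cong[OF e, of i] that by simp
  show "\<lfloor>clean m (k, t)\<rfloor> = \<lfloor>clean m' (k, t)\<rfloor>" if "k \<in> C" "t \<in> {1..n}"
    using fun_cong[OF f, of "(k, t)"] that by simp
qed

lemma key_eqI:
  assumes "\<And>i. i \<in> S \<Longrightarrow> entry m i = entry m' i"
    and "\<And>k t. k \<in> C \<Longrightarrow> t \<in> {1..n} \<Longrightarrow> \<lfloor>clean m (k, t)\<rfloor> = \<lfloor>clean m' (k, t)\<rfloor>"
  shows "key S C m = key S C m'"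
  using assms by (auto simp: key_def fun_eq_iff restrict_def)

lemma lsize_Un: "finite J \<Longrightarrow> finite J' \<Longrightarrow> J \<inter> J' = {} \<Longrightarrow> lsize (J \<union> J') = lsize J + lsize J'"
  by (simp add: lsize_def sum.union_disjoint)

lemma ent_msgs_le:
  assumes "J \<subseteq> Idx"
  shows "ent J {} \<le> lsize J"
proof -
  have "finite J" using assms finite_Idx finite_subset by blast
  then show ?thesis using assms
  proof (induction J)
    case empty
    then show ?case by (simp add: ent_empty lsize_def)
  next
    case (insert i J)
    have "ent {i} {} \<le> ln (real (card (key {i} {} ` Msgs)))"
      unfolding ent_def by (rule entropy_of_le_card_image[OF finite_Msgs Msgs_nonempty])
    also have "\<dots> \<le> ln (real (size_of i))"
    proof (rule ln_mono)
      have "key {i} {} ` Msgs \<subseteq> (\<lambda>v. (\<lambda>j\<in>{i}. v, \<lambda>_. undefined)) ` {1..size_of i}"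
      proof
        fix x assume "x \<in> key {i} {} ` Msgs"
        then obtain m where m: "m \<in> Msgs" "x = key {i} {} m" by auto
        then have "x = (\<lambda>j\<in>{i}. entry m i, \<lambda>_. undefined)"
          by (auto simp: key_def fun_eq_iff restrict_def)
        then show "x \<in> (\<lambda>v. (\<lambda>j\<in>{i}. v, \<lambda>_. undefined)) ` {1..size_of i}"
          using entry_range[OF m(1), of i] insert.prems by auto
      qed
      then have "card (key {i} {} ` Msgs) \<le> card {1..size_of i}"
        by (meson card_image_le card_mono finite_atLeastAtMost finite_imageI le_trans)
      then show "real (card (key {i} {} ` Msgs)) \<le> real (size_of i)" by simp
      show "0 < real (card (key {i} {} ` Msgs))"
        using finite_Msgs Msgs_nonempty by (simp add: card_gt_0_iff)
    qed
    finally have "ent {i} {} \<le> ln (real (size_of i))" .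
    moreover have "ent (J \<union> {i}) ({} \<union> {}) \<le> ent J {} + ent {i} {}"
      by (rule ent_disjoint_le) (use insert.hyps in auto)
    moreover have "ent J {} \<le> lsize J" using insert by auto
    ultimately show ?case using insert.hyps by (simp add: lsize_def)
  qed
qed

section \<open>Rounded outputs under the power constraint\<close>

lemma input_outside: "k \<notin> {1..K} \<Longrightarrow> input m k t = 0"
  using active_subset by (auto simp: input_def channel_input_def)

lemma clean_three:
  assumes "1 \<le> k"
  shows "clean m (k, t) = h k k * input m k t + h (k - 1) k * input m (k - 1) t + h (k + 1) k * input m (k + 1) t"
proof -
  have "(\<Sum>j\<in>nbrs K k. h j k * input m j t) = (\<Sum>j\<in>{k - 1, k + 1}. h j k * input m j t)"
    unfolding nbrs_def
  proof (rule sum.mono_neutral_left)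
    show "\<forall>j\<in>{k - 1, k + 1} - {k - 1, k + 1} \<inter> {1..K}. h j k * input m j t = 0"
      using input_outside by (metis Diff_iff IntI mult_zero_right)
  qed auto
  then show ?thesis using assms by (simp add: clean_def)
qed

lemma input_power:
  assumes "m \<in> Msgs"
  shows "(\<Sum>t = 1..n. (input m k t)\<^sup>2) \<le> real n * P"
proof (cases "k \<in> {1..K}")
  case True
  then show ?thesis using power[of "fst m" "snd m" k] assms by (auto simp: input_def Msgs_def)
qed (simp add: input_outside P0)

text \<open>The logarithm of the lattice bound for one rounded output block. In 18 = 2 * 3 * 3 the
  factors come from rounding, from squaring a sum of three terms and from three inputs of power
  \<open>P\<close>; the summand 2 is the rounding error.\<close>

definition "Gcell = real n * ln (2 * exp 2 * (1 + sqrt (18 * H\<^sup>2 * P + 2)))"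

lemma sq_mul_le: "0 \<le> a \<Longrightarrow> a \<le> H \<Longrightarrow> (a * x)\<^sup>2 \<le> H\<^sup>2 * (x::real)\<^sup>2"
  by (simp add: power_mult_distrib mult_right_mono power_mono)

lemma cell_power:
  assumes m: "m \<in> Msgs" and k: "k \<in> {1..K}"
  shows "(\<Sum>t = 1..n. (real_of_int \<lfloor>clean m (k, t)\<rfloor>)\<^sup>2) \<le> real n * (18 * H\<^sup>2 * P + 2)"
proof -
  let ?x = "\<lambda>j t. (input m j t)\<^sup>2"
  have pt: "(real_of_int \<lfloor>clean m (k, t)\<rfloor>)\<^sup>2
      \<le> 6 * H\<^sup>2 * (?x k t + ?x (k - 1) t + ?x (k + 1) t) + 2" for t
  proof -
    have "(clean m (k, t))\<^sup>2 \<le> 3 * ((h k k * input m k t)\<^sup>2 + (h (k - 1) k * input m (k - 1) t)\<^sup>2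
        + (h (k + 1) k * input m (k + 1) t)\<^sup>2)"
      using k by (subst clean_three) (simp, rule sq_sum3_le)
    also have "\<dots> \<le> 3 * (H\<^sup>2 * ?x k t + H\<^sup>2 * ?x (k - 1) t + H\<^sup>2 * ?x (k + 1) t)"
      using k by (intro mult_left_mono add_mono sq_mul_le h_nonneg h_le) auto
    finally show ?thesis using floor_sq_le[of "clean m (k, t)"] by (simp add: algebra_simps)
  qed
  have "(\<Sum>t = 1..n. (real_of_int \<lfloor>clean m (k, t)\<rfloor>)\<^sup>2)
      \<le> (\<Sum>t = 1..n. 6 * H\<^sup>2 * (?x k t + ?x (k - 1) t + ?x (k + 1) t) + 2)"
    by (rule sum_mono[OF pt])
  also have "\<dots> = 6 * H\<^sup>2 * ((\<Sum>t = 1..n. ?x k t) + (\<Sum>t = 1..n. ?x (k - 1) t) + (\<Sum>t = 1..n. ?x (k + 1) t))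
      + 2 * real n"
    by (simp add: sum.distrib sum_distrib_left[symmetric])
  also have "\<dots> \<le> 6 * H\<^sup>2 * (real n * P + real n * P + real n * P) + 2 * real n"
    by (intro add_mono mult_left_mono input_power m) auto
  finally show ?thesis by (simp add: algebra_simps)
qed

lemma ent_outputs_le:
  assumes "finite C" "C \<subseteq> {1..K}"
  shows "ent {} C \<le> real (card C) * Gcell"
  using assms
proof (induction C)
  case empty
  then show ?case by (simp add: ent_empty)
next
  case (insert k C)
  let ?R = "sqrt (18 * H\<^sup>2 * P + 2)"
  let ?V = "(\<lambda>m. \<lambda>t\<in>{1..n}. \<lfloor>clean m (k, t)\<rfloor>) ` Msgs"
  have pos: "0 \<le> 18 * H\<^sup>2 * P + 2" using P0 by simp
  have "sqrt 1 \<le> ?R" using P0 by (intro real_sqrt_le_mono) simp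
  then have R: "1 \<le> ?R" by simp
  have "ent {} {k} \<le> entropy_of Msgs (\<lambda>m. \<lambda>t\<in>{1..n}. \<lfloor>clean m (k, t)\<rfloor>)"
    unfolding ent_def
  proof (rule entropy_of_mono[OF finite_Msgs])
    fix m m' assume eq: "(\<lambda>t\<in>{1..n}. \<lfloor>clean m (k, t)\<rfloor>) = (\<lambda>t\<in>{1..n}. \<lfloor>clean m' (k, t)\<rfloor>)"
    show "key {} {k} m = key {} {k} m'"
    proof (rule key_eqI)
      fix k' t assume "k' \<in> {k}" "t \<in> {1..n}"
      then show "\<lfloor>clean m (k', t)\<rfloor> = \<lfloor>clean m' (k', t)\<rfloor>"
        using fun_cong[OF eq, of t] by simp
    qed simp
  qed
  also have "\<dots> \<le> ln (real (card ?V))"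
    by (rule entropy_of_le_card_image[OF finite_Msgs Msgs_nonempty])
  also have "\<dots> \<le> ln ((2 * exp 2 * (1 + ?R)) ^ n)"
  proof (rule ln_mono)
    have "real (card ?V) \<le> (2 * exp 2 * (1 + ?R)) ^ card {1..n}"
    proof (rule card_lattice_points_le(2)[OF _ R])
      fix v assume "v \<in> ?V"
      then obtain m where m: "m \<in> Msgs" and v: "v = (\<lambda>t\<in>{1..n}. \<lfloor>clean m (k, t)\<rfloor>)" by auto
      have "(\<Sum>t = 1..n. (real_of_int (v t))\<^sup>2) = (\<Sum>t = 1..n. (real_of_int \<lfloor>clean m (k, t)\<rfloor>)\<^sup>2)"
        by (rule sum.cong) (simp_all add: v)
      then show "(\<Sum>t\<in>{1..n}. (real_of_int (v t))\<^sup>2) \<le> real (card {1..n}) * ?R\<^sup>2"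
        using cell_power[OF m, of k] insert.prems pos by simp
    qed auto
    then show "real (card ?V) \<le> (2 * exp 2 * (1 + ?R)) ^ n" by simp
    show "0 < real (card ?V)" using finite_Msgs Msgs_nonempty by (simp add: card_gt_0_iff)
  qed
  also have "\<dots> = Gcell" using R by (simp add: Gcell_def ln_realpow)
  finally have "ent {} {k} \<le> Gcell" .
  moreover have "ent ({} \<union> {}) (C \<union> {k}) \<le> ent {} C + ent {} {k}"
    by (rule ent_disjoint_le) (use insert.hyps in auto)
  ultimately show ?case using insert by (simp add: algebra_simps)
qed

lemma ent_le:
  assumes "J \<subseteq> Idx" "C \<subseteq> {1..K}" "C' \<subseteq> {1..K}" "C \<inter> C' = {}" "S \<inter> J = {}"
  shows "ent (S \<union> J) (C \<union> C') \<le> ent S C + lsize J + real (card C') * Gcell"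
proof -
  have fin: "finite C'" using assms(3) finite_subset by blast
  have "ent (S \<union> J) (C \<union> C') \<le> ent S C + ent J C'"
    by (rule ent_disjoint_le) (use assms in auto)
  moreover have "ent (J \<union> {}) ({} \<union> C') \<le> ent J {} + ent {} C'"
    by (rule ent_disjoint_le) auto
  ultimately show ?thesis using ent_msgs_le[OF assms(1)] ent_outputs_le[OF fin assms(3)] by simp
qed

text \<open>
  If two inputs are known up to \<open>x\<close>, the rounded output between them determines the third one up to
  \<open>(1 + 2 H x) / g\<close>. Hence \<open>kappa j\<close> bounds the error after \<open>j\<close> such steps.
\<close>

definition kappa :: "nat \<Rightarrow> real" where
  "kappa j = ((\<lambda>x. x + (1 + 2 * H * x) / g) ^^ j) 0"

text \<open>The distance up to which noiseless outputs may differ in a decoding step: either three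
  inputs are each off by at most \<open>kappa K\<close>, or the rounded outputs agree, which costs
  1. It involves neither n nor \<open>P\<close>.\<close>

definition "slack = 1 + 3 * H * kappa K"

text \<open>The price of one decoding step: the domination factor of all K n noise coordinates,
  followed by the two error terms of \<open>entropy_of_label_le\<close>.\<close>

definition "fano = real (K * n) * ln (sqrt 2 * exp (slack\<^sup>2 / 2)) + 1 + \<epsilon> * lsize Idx"

lemma H_nonneg: "0 \<le> H"
  using h_nonneg[of 0 0] h_le[of 0 0] by simp

lemma kappa_0 [simp]: "kappa 0 = 0"
  and kappa_Suc: "kappa (Suc j) = kappa j + (1 + 2 * H * kappa j) / g"
  by (simp_all add: kappa_def)

lemma kappa_nonneg: "0 \<le> kappa j"
  by (induction j) (use H_nonneg g_pos in \<open>auto simp: kappa_Suc\<close>)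

lemma kappa_mono: "i \<le> j \<Longrightarrow> kappa i \<le> kappa j"
proof (erule lift_Suc_mono_le[of kappa, rotated])
  show "kappa j \<le> kappa (Suc j)" for j
    using kappa_nonneg[of j] H_nonneg g_pos by (simp add: kappa_Suc)
qed

lemma slack_ge_1: "1 \<le> slack"
  using H_nonneg kappa_nonneg[of K] by (simp add: slack_def)

lemma lsize_Idx_nonneg: "0 \<le> lsize Idx"
  unfolding lsize_def using NU NE by (intro sum_nonneg) (auto simp: size_of_def)

lemma fano_nonneg: "0 \<le> fano"
proof -
  have "1 * 1 \<le> sqrt 2 * exp (slack\<^sup>2 / 2)" by (intro mult_mono) auto
  then have "0 \<le> ln (sqrt 2 * exp (slack\<^sup>2 / 2))" by simp
  then show ?thesis using eps lsize_Idx_nonneg by (simp add: fano_def)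
qed

section \<open>Noise, decoding errors and the price of a decoding step\<close>

definition received :: "((nat \<Rightarrow> nat) \<times> (nat \<Rightarrow> nat)) \<Rightarrow> (nat \<times> nat \<Rightarrow> real) \<Rightarrow> nat \<times> nat \<Rightarrow> real" where
  "received m z = (\<lambda>i\<in>Grid. clean m i + z i)"

lemma decoding_error_iff:
  "decoding_error h D K n c s (fst m) (snd m) z
    \<longleftrightarrow> (\<exists>i\<in>Idx. decision D K n c s i (received m z) \<noteq> entry m i)"
proof -
  let ?y = "channel_output h K n (input m) z" and ?y' = "output_of n (received m z)"
  have out: "?y k = ?y' k" if "k \<in> {1..K}" for k
    using that by (auto simp: channel_output_def output_of_def received_def clean_def fun_eq_iff restrict_def)
  have hist: "rx_history K c s ?y D k = rx_history K c s ?y' D k" if "k \<in> {1..K}" for k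
    \<comment> \<open>The lower end 0 removes the condition on the left. The upper end may exceed K,
      but only active receivers are compared.\<close>
    by (rule rx_history_cong[where lo = 0 and hi = "k + D"]) (use out active_subset in auto)
  have "decoding_error h D K n c s (fst m) (snd m) z \<longleftrightarrow>
      (\<exists>k\<in>urllc_set K s. dec_urllc c s k (?y' k) \<noteq> fst m k) \<or>
      (\<exists>k\<in>active_set K s. dec_embb c s k (?y' k) (rx_history K c s ?y' D k) \<noteq> snd m k)"
    unfolding decoding_error_def Let_def input_def[symmetric]
  proof (intro arg_cong2[where f = "(\<or>)"] bex_cong refl)
    fix k assume "k \<in> urllc_set K s"
    then have k: "k \<in> {1..K}" using active_subset urllc_subset by blast
    show "(dec_urllc c s k (?y k) \<noteq> fst m k) = (dec_urllc c s k (?y' k) \<noteq> fst m k)"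
      by (simp only: out[OF k])
  next
    fix k assume "k \<in> active_set K s"
    then have k: "k \<in> {1..K}" using active_subset by blast
    show "(dec_embb c s k (?y k) (rx_history K c s ?y D k) \<noteq> snd m k)
        = (dec_embb c s k (?y' k) (rx_history K c s ?y' D k) \<noteq> snd m k)"
      by (simp only: out[OF k] hist[OF k])
  qed
  also have "\<dots> \<longleftrightarrow> (\<exists>i\<in>Idx. decision D K n c s i (received m z) \<noteq> entry m i)"
    unfolding Idx_def bex_Un by (auto simp: decision_def entry_def Let_def)
  finally show ?thesis .
qed

lemma sets_Noise: "sets Noise = sets (PiM Grid (\<lambda>_. borel))"
  unfolding noise_measure_def by (intro sets_PiM_cong) simp_all

lemma prob_space_Noise: "prob_space Noise"
  unfolding noise_measure_def by (intro prob_space_PiM prob_space_normal_density) simp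

lemma shift_measurable: "(\<lambda>z. \<lambda>i\<in>Grid. u i + z i) \<in> Noise \<rightarrow>\<^sub>M PiM Grid (\<lambda>_. borel)"
  unfolding measurable_cong_sets[OF sets_Noise refl] by measurable

definition decisions :: "(bool \<times> nat) set \<Rightarrow> (nat \<times> nat \<Rightarrow> real) \<Rightarrow> bool \<times> nat \<Rightarrow> nat" where
  "decisions J y = (\<lambda>i\<in>J. decision D K n c s i y)"

lemma decisions_sets:
  assumes "J \<subseteq> Idx"
  shows "{y \<in> space (PiM Grid (\<lambda>_. borel)). decisions J y = v} \<in> sets (PiM Grid (\<lambda>_. borel))"
proof (cases "v \<in> extensional J")
  case True
  have "{y \<in> space (PiM Grid (\<lambda>_. borel)). decisions J y = v}
      = {y \<in> space (PiM Grid (\<lambda>_. borel)). \<forall>i\<in>J. decision D K n c s i y = v i}"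
    using True by (auto simp: decisions_def fun_eq_iff restrict_def extensional_def)
  also have "\<dots> \<in> sets (PiM Grid (\<lambda>_. borel))"
  proof (rule sets.sets_Collect_finite_All)
    show "finite J" using assms finite_Idx finite_subset by blast
    fix i assume "i \<in> J"
    then have [measurable]: "decision D K n c s i \<in> PiM Grid (\<lambda>_. borel) \<rightarrow>\<^sub>M count_space UNIV"
      using assms by (intro decision_measurable measurable) (auto simp: Idx_def)
    show "{y \<in> space (PiM Grid (\<lambda>_. borel)). decision D K n c s i y = v i} \<in> sets (PiM Grid (\<lambda>_. borel))"
      by measurable
  qed
  finally show ?thesis .
next
  case False
  have "decisions J y \<in> extensional J" for y by (simp add: decisions_def)
  then have "{y \<in> space (PiM Grid (\<lambda>_. borel)). decisions J y = v} = {}"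
    using False by auto
  then show ?thesis by (simp only: sets.empty_sets)
qed

lemma error_sets:
  "{z \<in> space Noise. decoding_error h D K n c s (fst m) (snd m) z} \<in> sets Noise"
proof -
  have "{z \<in> space Noise. decoding_error h D K n c s (fst m) (snd m) z}
      = space Noise - (received m -` {y \<in> space (PiM Grid (\<lambda>_. borel)). decisions Idx y = restrict (entry m) Idx}
          \<inter> space Noise)"
  proof -
    have "received m z \<in> space (PiM Grid (\<lambda>_. borel))" for z
      by (simp add: received_def space_PiM)
    moreover have "decisions Idx y = restrict (entry m) Idx \<longleftrightarrow> (\<forall>i\<in>Idx. decision D K n c s i y = entry m i)" for y
      by (auto simp: decisions_def fun_eq_iff restrict_def)
    ultimately show ?thesis by (auto simp: decoding_error_iff)
  qed
  also have "\<dots> \<in> sets Noise"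
    unfolding received_def[abs_def]
    by (intro sets.compl_sets measurable_sets[OF shift_measurable] decisions_sets order_refl)
  finally show ?thesis .
qed

text \<open>The decoders of \<open>J\<close> look only at \<open>W\<close>, where message tuples
  with the same key have nearly the same outputs. So one Gaussian law of variance 2, centred at a
  representative of the key, dominates all output laws that belong to this key. This is the law
  \<open>Q\<close> required by \<open>entropy_of_label_le\<close>.\<close>

lemma ent_decode_le:
  assumes J: "J \<subseteq> Idx" and W: "W \<subseteq> {1..K}"
    and loc: "\<And>i y y'. i \<in> J \<Longrightarrow> (\<And>k t. k \<in> W \<Longrightarrow> t \<in> {1..n} \<Longrightarrow> y (k, t) = y' (k, t))
      \<Longrightarrow> decision D K n c s i y = decision D K n c s i y'"
    and near: "\<And>m m' k t. m \<in> Msgs \<Longrightarrow> m' \<in> Msgs \<Longrightarrow> key S C m = key S C m' \<Longrightarrow> k \<in> W \<Longrightarrow> t \<in> {1..n}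
      \<Longrightarrow> \<bar>clean m (k, t) - clean m' (k, t)\<bar> \<le> slack"
  shows "ent (S \<union> J) C \<le> ent S C + fano"
proof -
  let ?B = "PiM Grid (\<lambda>_. borel :: real measure)"
  let ?N = "\<lambda>v. PiM Grid (\<lambda>i. density lborel (normal_density (v i) (sqrt 2)))"
  \<comment> \<open>Outside \<open>W\<close> the outputs may be far apart, but the decisions do not
    see them, so they are set to 0.\<close>
  define u where "u m i = (if fst i \<in> W then clean m i else 0)" for m i
  define rep where "rep a = (SOME m. m \<in> Msgs \<and> key S C m = a)" for a
  define A where "A v = {y \<in> space ?B. decisions J y = v}" for v
  define p where "p m = measure Noise {z \<in> space Noise. (\<lambda>i\<in>Grid. u m i + z i) \<in> A (restrict (entry m) J)}" for m
  define Q where "Q a v = measure (?N (u (rep a))) (A v)" for a v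
  let ?C = "(sqrt 2 * exp (slack\<^sup>2 / 2)) ^ card Grid"
  interpret Noise: prob_space Noise by (rule prob_space_Noise)
  have A: "A v \<in> sets ?B" for v unfolding A_def by (rule decisions_sets[OF J])
  have rep: "rep (key S C m) \<in> Msgs \<and> key S C (rep (key S C m)) = key S C m" if "m \<in> Msgs" for m
    unfolding rep_def by (rule someI[of _ m]) (use that in simp)
  have "ent (S \<union> J) C \<le> entropy_of Msgs (\<lambda>m. (key S C m, restrict (entry m) J))"
    unfolding ent_def
  proof (rule entropy_of_mono[OF finite_Msgs])
    fix m m' assume eq: "(key S C m, restrict (entry m) J) = (key S C m', restrict (entry m') J)"
    then have e1: "key S C m = key S C m'" and e2: "restrict (entry m) J = restrict (entry m') J" by simp_all
    show "key (S \<union> J) C m = key (S \<union> J) C m'"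
    proof (rule key_eqI)
      fix i assume "i \<in> S \<union> J"
      then show "entry m i = entry m' i"
        using key_eqD(1)[OF e1] fun_cong[OF e2, of i] by (cases "i \<in> J") auto
    qed (use key_eqD(2)[OF e1] in auto)
  qed
  also have "\<dots> \<le> entropy_of Msgs (key S C) + ln ?C + 1 + \<epsilon> * ln (real (card Msgs))"
  proof (rule entropy_of_label_le[OF finite_Msgs Msgs_nonempty, where P = p and Q = Q])
    have "1 * 1 \<le> sqrt 2 * exp (slack\<^sup>2 / 2)" by (intro mult_mono) auto
    then show "1 \<le> ?C" by (intro one_le_power) simp
    show "0 \<le> p m" "p m \<le> 1" for m by (simp_all add: p_def)
    show "0 \<le> Q a v" for a v by (simp add: Q_def)
    show "p m \<le> ?C * Q (key S C m) (restrict (entry m) J)" if m: "m \<in> Msgs" for m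
      unfolding p_def Q_def noise_measure_def
    proof (rule measure_gaussian_shift_le[OF _ A])
      fix i assume "i \<in> Grid"
      then show "\<bar>u m i - u (rep (key S C m)) i\<bar> \<le> slack"
        using near[OF m, of "rep (key S C m)" "fst i" "snd i"] rep[OF m] slack_ge_1 by (auto simp: u_def)
    qed simp
    show "(\<Sum>v\<in>(\<lambda>m. restrict (entry m) J) ` Msgs. Q (key S C m) v) \<le> 1" if m: "m \<in> Msgs" for m
    proof -
      interpret N: prob_space "?N (u (rep (key S C m)))"
        by (intro prob_space_PiM prob_space_normal_density) simp
      have sN: "sets (?N (u (rep (key S C m)))) = sets ?B" by (intro sets_PiM_cong) simp_all
      have "(\<Sum>v\<in>(\<lambda>m. restrict (entry m) J) ` Msgs. Q (key S C m) v)
          = measure (?N (u (rep (key S C m)))) (\<Union>v\<in>(\<lambda>m. restrict (entry m) J) ` Msgs. A v)"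
        unfolding Q_def
        by (rule N.finite_measure_finite_Union[symmetric])
          (use finite_Msgs A sN in \<open>auto simp: disjoint_family_on_def A_def\<close>)
      also have "\<dots> \<le> 1" by (rule N.prob_le_1)
      finally show ?thesis .
    qed
    show "(\<Sum>m\<in>Msgs. 1 - p m) \<le> \<epsilon> * real (card Msgs)"
    proof -
      have "1 - p m \<le> measure Noise {z \<in> space Noise. decoding_error h D K n c s (fst m) (snd m) z}" for m
      proof -
        let ?G = "{z \<in> space Noise. (\<lambda>i\<in>Grid. u m i + z i) \<in> A (restrict (entry m) J)}"
        have G: "?G \<in> sets Noise"
        proof -
          have "?G = (\<lambda>z. \<lambda>i\<in>Grid. u m i + z i) -` A (restrict (entry m) J) \<inter> space Noise" by auto
          then show ?thesis using measurable_sets[OF shift_measurable A] by simp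
        qed
        \<comment> \<open>Correct decisions stay correct when the outputs outside \<open>W\<close>
          are changed, so outside \<open>?G\<close> there must be a decoding error.\<close>
        have "space Noise - ?G \<subseteq> {z \<in> space Noise. decoding_error h D K n c s (fst m) (snd m) z}"
        proof (rule subsetI, rule CollectI, rule conjI)
          fix z assume z: "z \<in> space Noise - ?G"
          then show "z \<in> space Noise" by simp
          show "decoding_error h D K n c s (fst m) (snd m) z"
          proof (rule ccontr)
            assume "\<not> ?thesis"
            then have ok: "decision D K n c s i (received m z) = entry m i" if "i \<in> J" for i
              using J that by (auto simp: decoding_error_iff)
            have "decision D K n c s i (\<lambda>i\<in>Grid. u m i + z i) = entry m i" if i: "i \<in> J" for i
              unfolding ok[OF i, symmetric]
              by (rule loc[OF i]) (use W in \<open>auto simp: received_def u_def\<close>)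
            then have "decisions J (\<lambda>i\<in>Grid. u m i + z i) = restrict (entry m) J"
              by (auto simp: decisions_def fun_eq_iff restrict_def)
            then have "z \<in> ?G" using z by (simp add: A_def space_PiM)
            then show False using z by simp
          qed
        qed
        then have "measure Noise (space Noise - ?G)
            \<le> measure Noise {z \<in> space Noise. decoding_error h D K n c s (fst m) (snd m) z}"
          by (rule Noise.finite_measure_mono[OF _ error_sets])
        then show ?thesis using Noise.prob_compl[OF G] by (simp add: p_def)
      qed
      then have "(\<Sum>m\<in>Msgs. 1 - p m)
          \<le> (\<Sum>m\<in>Msgs. measure Noise {z \<in> space Noise. decoding_error h D K n c s (fst m) (snd m) z})"
        by (rule sum_mono)
      also have "\<dots> \<le> \<epsilon> * real (card Msgs)"
        using error by (simp add: Msgs_def case_prod_unfold)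
      finally show ?thesis .
    qed
  qed
  also have "ln ?C = real (K * n) * ln (sqrt 2 * exp (slack\<^sup>2 / 2))"
    by (simp add: ln_realpow)
  finally show ?thesis by (simp add: fano_def ent_def ln_card_Msgs)
qed

section \<open>Recovering inputs from rounded outputs\<close>

definition close :: "real \<Rightarrow> (nat \<Rightarrow> nat) \<times> (nat \<Rightarrow> nat) \<Rightarrow> (nat \<Rightarrow> nat) \<times> (nat \<Rightarrow> nat) \<Rightarrow> nat \<Rightarrow> bool" where
  "close b m m' k \<longleftrightarrow> (\<forall>t\<in>{1..n}. \<bar>input m k t - input m' k t\<bar> \<le> b)"

lemma close_mono: "close b m m' k \<Longrightarrow> b \<le> b' \<Longrightarrow> close b' m m' k"
  unfolding close_def by (meson order_trans)

lemma floor_eq_near: "\<lfloor>x::real\<rfloor> = \<lfloor>y\<rfloor> \<Longrightarrow> \<bar>x - y\<bar> \<le> 1"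
  by linarith

text \<open>Solve the output equation at k for the input of q: equal cells bound the difference of
  the outputs by 1, the other two inputs are off by at most b, and the cross gain from q is at least
  \<open>g\<close>. Both orientations are covered, so the step serves chains in either
  direction.\<close>

lemma close_step:
  fixes p q :: nat
  assumes k: "k \<in> {1..K}" and pq: "p = k - 1 \<and> q = k + 1 \<or> p = k + 1 \<and> q = k - 1"
    and cell: "\<And>t. t \<in> {1..n} \<Longrightarrow> \<lfloor>clean m (k, t)\<rfloor> = \<lfloor>clean m' (k, t)\<rfloor>"
    and b: "close b m m' k" "close b m m' p" and gq: "1 \<le> q" "0 \<le> b"
  shows "close ((1 + 2 * H * b) / g) m m' q"
  unfolding close_def
proof
  fix t assume t: "t \<in> {1..n}"
  let ?d = "\<lambda>j. input m j t - input m' j t"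
  have "\<bar>clean m (k, t) - clean m' (k, t)\<bar> \<le> 1" by (rule floor_eq_near[OF cell[OF t]])
  moreover have "clean m (k, t) - clean m' (k, t) = h k k * ?d k + h p k * ?d p + h q k * ?d q"
    using pq k by (auto simp: clean_three algebra_simps)
  moreover have "\<bar>h k k * ?d k\<bar> \<le> H * b" "\<bar>h p k * ?d p\<bar> \<le> H * b"
    unfolding abs_mult using b t k pq H_nonneg h_nonneg
    by (auto intro!: mult_mono h_le simp: close_def)
  ultimately have "\<bar>h q k * ?d q\<bar> \<le> 1 + 2 * H * b" by linarith
  moreover have "g * \<bar>?d q\<bar> \<le> \<bar>h q k * ?d q\<bar>"
  proof -
    have "g \<le> h q k" using pq k gq g_le[of k] g_le[of "k - 1"] by auto
    then show ?thesis unfolding abs_mult using h_nonneg[of q k] by (intro mult_right_mono) auto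
  qed
  ultimately show "\<bar>?d q\<bar> \<le> (1 + 2 * H * b) / g" using g_pos by (simp add: field_simps)
qed

text \<open>Three consecutive inputs are linked by each output, so the recursion needs two initial
  values and the induction carries a pair of adjacent inputs.\<close>

lemma close_chain_up:
  assumes "close 0 m m' p" "close 0 m m' (p + 1)" "p + r \<le> K"
    and cell: "\<And>k t. k \<in> {p + 1..p + r} \<Longrightarrow> t \<in> {1..n} \<Longrightarrow> \<lfloor>clean m (k, t)\<rfloor> = \<lfloor>clean m' (k, t)\<rfloor>"
  shows "j \<le> r \<Longrightarrow> close (kappa j) m m' (p + j) \<and> close (kappa j) m m' (p + 1 + j)"
proof (induction j)
  case 0
  then show ?case using assms by simp
next
  case (Suc j)
  then have IH: "close (kappa j) m m' (p + j)" "close (kappa j) m m' (p + 1 + j)" by auto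
  have "close ((1 + 2 * H * kappa j) / g) m m' (p + 2 + j)"
    by (rule close_step[of "p + 1 + j" "p + j"])
      (use IH Suc.prems assms(3) cell[of "p + 1 + j"] kappa_nonneg in auto)
  then have "close (kappa (Suc j)) m m' (p + 2 + j)"
    by (rule close_mono) (simp add: kappa_Suc kappa_nonneg)
  moreover have "close (kappa (Suc j)) m m' (p + 1 + j)"
    by (rule close_mono[OF IH(2)]) (simp add: kappa_mono)
  ultimately show ?case by simp
qed

lemma close_chain_down:
  assumes "close 0 m m' p" "close 0 m m' (p + 1)" "p \<le> K" "r < p"
    and cell: "\<And>k t. k \<le> p \<Longrightarrow> p < k + r \<Longrightarrow> t \<in> {1..n} \<Longrightarrow> \<lfloor>clean m (k, t)\<rfloor> = \<lfloor>clean m' (k, t)\<rfloor>"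
  shows "j \<le> r \<Longrightarrow> close (kappa j) m m' (p - j) \<and> close (kappa j) m m' (p + 1 - j)"
proof (induction j)
  case 0
  then show ?case using assms by simp
next
  case (Suc j)
  then have IH: "close (kappa j) m m' (p - j)" "close (kappa j) m m' (p + 1 - j)" by auto
  have "close ((1 + 2 * H * kappa j) / g) m m' (p - Suc j)"
    by (rule close_step[of "p - j" "p + 1 - j"])
      (use IH Suc.prems assms(3,4) cell[of "p - j"] kappa_nonneg in auto)
  then have "close (kappa (Suc j)) m m' (p - Suc j)"
    by (rule close_mono) (simp add: kappa_Suc kappa_nonneg)
  moreover have "close (kappa (Suc j)) m m' (p - j)"
    by (rule close_mono[OF IH(1)]) (simp add: kappa_mono)
  ultimately show ?case using Suc.prems assms(4) by (simp add: Suc_diff_Suc)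
qed

lemma clean_near:
  assumes "\<And>k. k \<in> {1..K} \<Longrightarrow> close (kappa K) m m' k" and k: "k \<in> {1..K}" and t: "t \<in> {1..n}"
  shows "\<bar>clean m (k, t) - clean m' (k, t)\<bar> \<le> slack"
proof -
  let ?d = "\<lambda>j. input m j t - input m' j t"
  have d: "\<bar>?d j\<bar> \<le> kappa K" for j
    using assms(1)[of j] t kappa_nonneg by (cases "j \<in> {1..K}") (auto simp: close_def input_outside)
  have "\<bar>h j k * ?d j\<bar> \<le> H * kappa K" if "j \<le> K + 1" for j
    unfolding abs_mult using d[of j] that k H_nonneg h_nonneg by (auto intro!: mult_mono h_le)
  from this[of k] this[of "k - 1"] this[of "k + 1"]
  have "\<bar>h k k * ?d k\<bar> \<le> H * kappa K" "\<bar>h (k - 1) k * ?d (k - 1)\<bar> \<le> H * kappa K"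
    "\<bar>h (k + 1) k * ?d (k + 1)\<bar> \<le> H * kappa K" using k by auto
  moreover have "clean m (k, t) - clean m' (k, t) = h k k * ?d k + h (k - 1) k * ?d (k - 1) + h (k + 1) k * ?d (k + 1)"
    using k by (simp add: clean_three algebra_simps)
  ultimately show ?thesis unfolding slack_def by linarith
qed

text \<open>Once every input is known up to a bounded error, so is every output, and the whole
  message tuple can be decoded at the price of one \<open>fano\<close>. Every rate inequality below
  uses this.\<close>

lemma lsize_le_ent:
  assumes "\<And>m m' k. m \<in> Msgs \<Longrightarrow> m' \<in> Msgs \<Longrightarrow> key S C m = key S C m' \<Longrightarrow> k \<in> {1..K} \<Longrightarrow> close (kappa K) m m' k"
  shows "lsize Idx \<le> ent S C + fano"
proof -
  have "lsize Idx = ent Idx {}"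
    unfolding ln_card_Msgs[symmetric] ent_def
    by (rule entropy_of_inj[OF finite_Msgs Msgs_nonempty, symmetric])
      (rule inj_onI, rule entry_inj, auto dest: key_eqD(1))
  also have "\<dots> \<le> ent (S \<union> Idx) C"
    by (rule ent_determined) (auto intro!: key_eqI dest: key_eqD(1))
  also have "\<dots> \<le> ent S C + fano"
  proof (rule ent_decode_le[OF order_refl order_refl])
    fix i and y y' :: "nat \<times> nat \<Rightarrow> real"
    assume i: "i \<in> Idx" and eq: "\<And>k t. k \<in> {1..K} \<Longrightarrow> t \<in> {1..n} \<Longrightarrow> y (k, t) = y' (k, t)"
    obtain b k where bk: "i = (b, k)" by (cases i)
    have k: "k \<in> active_set K s" using i bk urllc_subset by (auto simp: Idx_def)
    show "decision D K n c s i y = decision D K n c s i y'"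
    proof (cases b)
      case True
      then show ?thesis unfolding bk using k active_subset eq by (auto intro!: decision_cong_urllc)
    next
      case False
      show ?thesis unfolding bk using False k active_subset eq
        by (auto intro!: decision_cong_embb[where lo = 0 and hi = "k + D"])
    qed
  qed (rule clean_near, rule assms)
  finally show ?thesis .
qed

lemma input_cong:
  assumes "m \<in> Msgs" "m' \<in> Msgs" and "\<And>b. (b, k) \<in> Idx \<Longrightarrow> entry m (b, k) = entry m' (b, k)"
  shows "input m k t = input m' k t"
proof (cases "k \<in> active_set K s")
  case True
  have "snd m k = snd m' k" using assms(3)[of False] True by (simp add: Idx_def entry_def)
  moreover have "fst m k = fst m' k"
  proof (cases "k \<in> urllc_set K s")
    case True
    then show ?thesis using assms(3)[of True] by (simp add: Idx_def entry_def)
  next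
    \<comment> \<open>Without a URLLC message both tuples carry the dummy value 0.\<close>
    case False
    then show ?thesis using assms(1,2) by (auto simp: Msgs_def PiE_dflt_def)
  qed
  ultimately show ?thesis by (simp add: input_def channel_input_def)
qed (simp add: input_def channel_input_def)

definition msgs :: "nat \<Rightarrow> (bool \<times> nat) set" where
  "msgs k = Idx \<inter> UNIV \<times> {k}"

lemma msgs_subset: "msgs k \<subseteq> Idx" and finite_msgs: "finite (msgs k)"
  using finite_Idx by (auto simp: msgs_def)

lemma msgs_disjoint: "j \<noteq> k \<Longrightarrow> msgs j \<inter> msgs k = {}"
  by (auto simp: msgs_def)

lemma lsize_diff: "J \<subseteq> Idx \<Longrightarrow> lsize (Idx - J) = lsize Idx - lsize J"
  by (simp add: lsize_def sum_diff finite_Idx)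

lemma lsize_UN: "finite A \<Longrightarrow> lsize (\<Union>k\<in>A. msgs k) = (\<Sum>k\<in>A. lsize (msgs k))"
  unfolding lsize_def by (rule sum.UNION_disjoint) (auto simp: finite_msgs msgs_def)

lemma close_0_known:
  assumes "m \<in> Msgs" "m' \<in> Msgs" "key S C m = key S C m'" "msgs k \<subseteq> S"
  shows "close 0 m m' k"
  unfolding close_def
  using input_cong[OF assms(1,2), of k] key_eqD(1)[OF assms(3)] assms(4)
  by (auto simp: msgs_def subset_iff)

lemma close_known:
  assumes "m \<in> Msgs" "m' \<in> Msgs" "key S C m = key S C m'" "msgs k \<subseteq> S"
  shows "close (kappa K) m m' k"
  by (rule close_mono[OF close_0_known[OF assms] kappa_nonneg])

lemma cell_known:
  "key S C m = key S C m' \<Longrightarrow> k \<in> C \<Longrightarrow> t \<in> {1..n}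
    \<Longrightarrow> \<bar>clean m (k, t) - clean m' (k, t)\<bar> \<le> slack"
  using floor_eq_near[OF key_eqD(2)] slack_ge_1 by (metis order_trans)

text \<open>
  Once the inputs of two adjacent transmitters are known, the cells of successive outputs
  determine the next inputs up to a bounded error, on either side.
\<close>

lemma chain_up_known:
  assumes m: "m \<in> Msgs" "m' \<in> Msgs" and eq: "key S C m = key S C m'"
    and S: "msgs p \<subseteq> S" "msgs (p + 1) \<subseteq> S" and C: "{p + 1..p + r} \<subseteq> C" and K: "p + r \<le> K"
    and k: "p + 1 \<le> k" "k \<le> p + 1 + r"
  shows "close (kappa K) m m' k"
proof -
  have "k - (p + 1) \<le> r" using k by simp
  from close_chain_up[OF close_0_known[OF m eq S(1)] close_0_known[OF m eq S(2)] K _ this]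
  have "close (kappa (k - (p + 1))) m m' (p + 1 + (k - (p + 1)))"
    using key_eqD(2)[OF eq] C by blast
  then have "close (kappa (k - (p + 1))) m m' k" using k by simp
  then show ?thesis by (rule close_mono) (use k K in \<open>auto intro: kappa_mono\<close>)
qed

lemma chain_down_known:
  assumes m: "m \<in> Msgs" "m' \<in> Msgs" and eq: "key S C m = key S C m'"
    and S: "msgs p \<subseteq> S" "msgs (p + 1) \<subseteq> S" and C: "{p + 1 - r..p} \<subseteq> C" and K: "p \<le> K" "r < p"
    and k: "p - r \<le> k" "k \<le> p"
  shows "close (kappa K) m m' k"
proof -
  have "p - k \<le> r" using k K by simp
  moreover have "\<lfloor>clean m (j, t)\<rfloor> = \<lfloor>clean m' (j, t)\<rfloor>" if "j \<le> p" "p < j + r" "t \<in> {1..n}" for j t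
    by (rule key_eqD(2)[OF eq _ that(3)]) (use C that in auto)
  ultimately have "close (kappa (p - k)) m m' (p - (p - k))"
    using close_chain_down[OF close_0_known[OF m eq S(1)] close_0_known[OF m eq S(2)] K, of "p - k"] by blast
  then have "close (kappa (p - k)) m m' k" using k by simp
  then show ?thesis by (rule close_mono) (use k K in \<open>auto intro: kappa_mono\<close>)
qed

section \<open>The local rate inequalities\<close>

lemma ent_known_le:
  assumes "J \<subseteq> Idx" "C \<subseteq> {1..K}" "S = Idx - J"
  shows "ent S C \<le> lsize Idx - lsize J + real (card C) * Gcell"
  using ent_le[of S "{}" C "{}"] assms lsize_diff[OF assms(1)] by (simp add: ent_empty)

text \<open>The direct gain \<open>h k k\<close> may vanish, so with all other messages given, the
  input of user k is read from a neighbouring output: output k - 1, or output 2 when k = 1. The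
  assumption \<open>2 \<le> K\<close> supplies that neighbour.\<close>

lemma single_user:
  assumes k: "k \<in> active_set K s"
  shows "lsize (msgs k) \<le> Gcell + fano"
proof -
  have k1: "1 \<le> k" "k \<le> K" using k active_subset by auto
  let ?S = "Idx - msgs k"
  have other: "msgs j \<subseteq> ?S" if "j \<noteq> k" for j using msgs_disjoint[OF that] msgs_subset[of j] by auto
  obtain q where q: "q \<in> {1..K}" and qk: "\<And>m m'. m \<in> Msgs \<Longrightarrow> m' \<in> Msgs \<Longrightarrow>
      key ?S {q} m = key ?S {q} m' \<Longrightarrow> close (kappa K) m m' k"
  proof (cases "k = 1")
    case True
    show ?thesis
    proof (rule that[of 2])
      show "close (kappa K) m m' k" if "m \<in> Msgs" "m' \<in> Msgs" "key ?S {2} m = key ?S {2} m'" for m m'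
        by (rule chain_down_known[OF that other other, where p = 2 and r = 1]) (use True K2 in auto)
    qed (use K2 in auto)
  next
    case False
    show ?thesis
    proof (rule that[of "k - 1"])
      show "close (kappa K) m m' k" if "m \<in> Msgs" "m' \<in> Msgs" "key ?S {k - 1} m = key ?S {k - 1} m'" for m m'
        by (rule chain_up_known[OF that other other, where p = "k - 2" and r = 1]) (use False k1 in auto)
    qed (use False k1 in auto)
  qed
  have "lsize Idx \<le> ent ?S {q} + fano"
  proof (rule lsize_le_ent)
    fix m m' j assume m: "m \<in> Msgs" "m' \<in> Msgs" "key ?S {q} m = key ?S {q} m'"
    show "close (kappa K) m m' j"
      using qk[OF m] close_known[OF m other] by (cases "j = k") auto
  qed
  also have "ent ?S {q} \<le> lsize Idx - lsize (msgs k) + Gcell"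
    using ent_known_le[OF msgs_subset, of "{q}" ?S k] q by simp
  finally show ?thesis by simp
qed

text \<open>All other messages are given away, including the eMBB message of k, so that output k
  alone pays for both terms. The two \<open>fano\<close> are the URLLC decision at k and the final
  decoding of everything.\<close>

lemma urllc_neighbour:
  assumes k: "k \<in> urllc_set K s" and k': "k + 1 \<in> active_set K s"
  shows "lsize {(True, k)} + lsize (msgs (k + 1)) \<le> Gcell + 2 * fano"
proof -
  let ?J = "{(True, k)} \<union> msgs (k + 1)"
  let ?S = "Idx - ?J"
  have k1: "1 \<le> k" "k + 1 \<le> K" using k k' active_subset urllc_subset by auto
  have i: "(True, k) \<in> Idx" using k by (simp add: Idx_def)
  have other: "msgs j \<subseteq> ?S \<union> {(True, k)}" if "j \<noteq> k + 1" for j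
    using msgs_disjoint[OF that] msgs_subset[of j] by auto
  have "lsize Idx \<le> ent (?S \<union> {(True, k)}) {k} + fano"
  proof (rule lsize_le_ent)
    fix m m' j
    assume m: "m \<in> Msgs" "m' \<in> Msgs" "key (?S \<union> {(True, k)}) {k} m = key (?S \<union> {(True, k)}) {k} m'"
    show "close (kappa K) m m' j"
    proof (cases "j = k + 1")
      case True
      show ?thesis
        by (rule chain_up_known[OF m other other, where p = "k - 1" and r = 1]) (use True k1 in auto)
    qed (rule close_known[OF m other])
  qed
  also have "ent (?S \<union> {(True, k)}) {k} \<le> ent ?S {k} + fano"
    by (rule ent_decode_le[where W = "{k}"])
      (use i k1 cell_known in \<open>auto intro!: decision_cong_urllc\<close>)
  also have "ent ?S {k} \<le> lsize Idx - lsize ?J + Gcell"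
    using ent_known_le[of ?J "{k}" ?S] i k1 msgs_subset by simp
  also have "lsize ?J = lsize {(True, k)} + lsize (msgs (k + 1))"
    by (rule lsize_Un) (auto simp: finite_msgs msgs_def)
  finally show ?thesis by simp
qed

lemma decision_window:
  assumes i: "i \<in> msgs k" and k: "k \<in> {lo..hi}" "k + D \<le> hi" "lo + D \<le> k \<or> lo - 1 \<notin> active_set K s"
    and y: "\<And>j t. j \<in> {lo..hi} \<Longrightarrow> t \<in> {1..n} \<Longrightarrow> y (j, t) = y' (j, t)"
  shows "decision D K n c s i y = decision D K n c s i y'"
proof -
  obtain b where b: "i = (b, k)" using i by (auto simp: msgs_def)
  have act: "k \<in> active_set K s" using i b urllc_subset by (auto simp: msgs_def Idx_def)
  show ?thesis
  proof (cases b)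
    case True
    then show ?thesis unfolding b using y k(1) by (auto intro!: decision_cong_urllc)
  next
    case False
    then show ?thesis unfolding b using y by (auto intro!: decision_cong_embb[OF act k])
  qed
qed

text \<open>As a - 1 is inactive, the messages of user a can be decoded from the outputs a to a + D.
  Exactly these outputs also drive the upward chain from the inputs a - 1 and a, so nothing further
  has to be paid for.\<close>

lemma run_start_block:
  assumes a: "1 \<le> a" "a - 1 \<notin> active_set K s" and K: "a + D + 1 \<le> K"
  shows "(\<Sum>k = a..a + D + 1. lsize (msgs k)) \<le> real (D + 1) * Gcell + 2 * fano"
proof -
  let ?J = "\<Union>k\<in>{a..a + D + 1}. msgs k" and ?C = "{a..a + D}"
  let ?S = "Idx - ?J"
  have J: "?J \<subseteq> Idx" using msgs_subset by auto
  have other: "msgs j \<subseteq> ?S \<union> msgs a" if "j \<notin> {a + 1..a + D + 1}" for j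
  proof (cases "j = a")
    case False
    then have "msgs j \<inter> ?J = {}" using that by (auto simp: msgs_def)
    then show ?thesis using msgs_subset[of j] by auto
  qed simp
  have "lsize Idx \<le> ent (?S \<union> msgs a) ?C + fano"
  proof (rule lsize_le_ent)
    fix m m' j
    assume m: "m \<in> Msgs" "m' \<in> Msgs" "key (?S \<union> msgs a) ?C m = key (?S \<union> msgs a) ?C m'"
    show "close (kappa K) m m' j"
    proof (cases "j \<in> {a + 1..a + D + 1}")
      case True
      show ?thesis
        by (rule chain_up_known[OF m other other, where p = "a - 1" and r = "D + 1"]) (use True a K in auto)
    qed (rule close_known[OF m other])
  qed
  also have "ent (?S \<union> msgs a) ?C \<le> ent ?S ?C + fano"
  proof (rule ent_decode_le[OF msgs_subset, where W = ?C])
    fix i and y y' :: "nat \<times> nat \<Rightarrow> real"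
    assume "i \<in> msgs a" "\<And>k t. k \<in> ?C \<Longrightarrow> t \<in> {1..n} \<Longrightarrow> y (k, t) = y' (k, t)"
    then show "decision D K n c s i y = decision D K n c s i y'"
      using a by (intro decision_window[of i a a "a + D"]) auto
  qed (use a K cell_known in auto)
  also have "ent ?S ?C \<le> lsize Idx - lsize ?J + real (card ?C) * Gcell"
    by (rule ent_known_le[OF J]) (use a K in auto)
  finally show ?thesis by (simp add: lsize_UN)
qed

text \<open>The difference \<open>ent (S \<union> T) C - ent S C\<close> is the uncertainty about
  \<open>T\<close> left by the outputs \<open>C\<close>, given \<open>S\<close>. The extra output
  \<open>q\<close> pays for it and for the messages of \<open>e\<close>: \<open>q\<close> allows
  \<open>T\<close> to be decoded, and by submodularity what \<open>q\<close> tells beyond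
  \<open>S\<close>, \<open>T\<close> and \<open>C\<close> is at least what it tells when only the
  messages of \<open>e\<close> are missing, namely those messages.\<close>

lemma ent_outer_le:
  assumes S: "S \<subseteq> Idx - msgs e" and C: "C \<subseteq> {1..K}" and q: "q \<in> {1..K}" "q \<notin> C"
    and T: "T \<subseteq> Idx - msgs e"
    and dec: "ent (S \<union> T) (C \<union> {q}) \<le> ent S (C \<union> {q}) + fano"
    and C_known: "\<And>k. k \<in> C \<Longrightarrow> e \<notin> {k - 1, k, k + 1}"
    and e_known: "\<And>m m'. m \<in> Msgs \<Longrightarrow> m' \<in> Msgs \<Longrightarrow>
      key (Idx - msgs e) (C \<union> {q}) m = key (Idx - msgs e) (C \<union> {q}) m' \<Longrightarrow> close (kappa K) m m' e"
  shows "lsize (msgs e) + ent (S \<union> T) C \<le> ent S C + Gcell + 2 * fano"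
proof -
  let ?A = "Idx - msgs e"
  have other: "msgs j \<subseteq> ?A" if "j \<noteq> e" for j
    using msgs_disjoint[OF that] msgs_subset[of j] by auto
  have "ent (S \<union> T \<union> ?A) (C \<union> {q} \<union> C) + ent ((S \<union> T) \<inter> ?A) ((C \<union> {q}) \<inter> C)
      \<le> ent (S \<union> T) (C \<union> {q}) + ent ?A C"
    by (rule ent_submod)
  moreover have "S \<union> T \<union> ?A = ?A" "(S \<union> T) \<inter> ?A = S \<union> T" "C \<union> {q} \<union> C = C \<union> {q}" "(C \<union> {q}) \<inter> C = C"
    using S T by auto
  ultimately have sub: "ent ?A (C \<union> {q}) + ent (S \<union> T) C \<le> ent (S \<union> T) (C \<union> {q}) + ent ?A C" by simp
  \<comment> \<open>User \<open>e\<close> reaches no output in \<open>C\<close>, so these outputs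
    are functions of the given messages.\<close>
  have "ent ?A C \<le> ent ?A {}"
  proof (rule ent_determined)
    fix m m' assume m: "m \<in> Msgs" "m' \<in> Msgs" "key ?A {} m = key ?A {} m'"
    show "key ?A C m = key ?A C m'"
    proof (rule key_eqI)
      fix k t assume k: "k \<in> C" and t: "t \<in> {1..n}"
      have "input m j t = input m' j t" if "j \<noteq> e" for j
        using close_0_known[OF m other[OF that]] t by (auto simp: close_def)
      then have "input m k t = input m' k t" "input m (k - 1) t = input m' (k - 1) t"
        "input m (k + 1) t = input m' (k + 1) t" using C_known[OF k] by auto
      then show "\<lfloor>clean m (k, t)\<rfloor> = \<lfloor>clean m' (k, t)\<rfloor>"
        using k C by (subst (1 2) clean_three) auto
    qed (rule key_eqD(1)[OF m(3)])
  qed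
  also have "\<dots> \<le> lsize Idx - lsize (msgs e)"
    using ent_msgs_le[of ?A] lsize_diff[OF msgs_subset] by auto
  finally have A0: "ent ?A C \<le> lsize Idx - lsize (msgs e)" .
  have A1: "lsize Idx \<le> ent ?A (C \<union> {q}) + fano"
  proof (rule lsize_le_ent)
    fix m m' j
    assume m: "m \<in> Msgs" "m' \<in> Msgs" "key ?A (C \<union> {q}) m = key ?A (C \<union> {q}) m'"
    show "close (kappa K) m m' j"
      using e_known[OF m] close_known[OF m other] by (cases "j = e") auto
  qed
  have "ent S (C \<union> {q}) \<le> ent S C + Gcell"
    using ent_le[of "{}" C "{q}" S] C q by (simp add: lsize_def)
  with sub A0 A1 dec show ?thesis by linarith
qed

text \<open>
  The two middle receivers of a double block share the outputs \<open>C\<close> of their windows; each of them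
  sees one output more, which costs one unit but also resolves an outermost message. Submodularity
  of the entropy lets the two decoding steps be combined over \<open>C\<close>.
\<close>

lemma double_block:
  assumes a: "1 \<le> a" and K: "a + 2 * D + 3 \<le> K"
  shows "(\<Sum>k = a..a + 2 * D + 3. lsize (msgs k)) \<le> real (2 * D + 2) * Gcell + 5 * fano"
proof -
  let ?J = "\<Union>k\<in>{a..a + 2 * D + 3}. msgs k" and ?C = "{a + 2..a + 2 * D + 1}"
  let ?S = "Idx - ?J" and ?p = "a + D + 1" and ?q = "a + D + 2" and ?e = "a + 2 * D + 3"
  let ?T = "?S \<union> msgs ?p \<union> msgs ?q"
  have J: "?J \<subseteq> Idx" using msgs_subset by auto
  have C: "?C \<subseteq> {1..K}" using K by auto
  have all_but: "msgs j \<subseteq> Idx - msgs e" if "j \<noteq> e" for j e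
    using msgs_disjoint[OF that] msgs_subset[of j] by auto
  \<comment> \<open>The window of \<open>?p\<close> is \<open>?C\<close> with the output a + 1
    added, and this output also contains the input of the outermost user a.\<close>
  have left: "lsize (msgs a) + ent (?S \<union> msgs ?p) ?C \<le> ent ?S ?C + Gcell + 2 * fano"
  proof (rule ent_outer_le[where q = "a + 1"])
    show "ent (?S \<union> msgs ?p) (?C \<union> {a + 1}) \<le> ent ?S (?C \<union> {a + 1}) + fano"
    proof (rule ent_decode_le[OF msgs_subset, where W = "{a + 1..a + 2 * D + 1}"])
      fix i and y y' :: "nat \<times> nat \<Rightarrow> real"
      assume "i \<in> msgs ?p" "\<And>k t. k \<in> {a + 1..a + 2 * D + 1} \<Longrightarrow> t \<in> {1..n} \<Longrightarrow> y (k, t) = y' (k, t)"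
      then show "decision D K n c s i y = decision D K n c s i y'"
        by (intro decision_window[of i ?p "a + 1" "a + 2 * D + 1"]) auto
    next
      fix m m' k t
      assume eq: "key ?S (?C \<union> {a + 1}) m = key ?S (?C \<union> {a + 1}) m'"
        and k: "k \<in> {a + 1..a + 2 * D + 1}" and t: "t \<in> {1..n}"
      have "k \<in> ?C \<union> {a + 1}" using k by auto
      then show "\<bar>clean m (k, t) - clean m' (k, t)\<bar> \<le> slack"
        by (rule cell_known[OF eq _ t])
    qed (use K in auto)
    show "close (kappa K) m m' a" if "m \<in> Msgs" "m' \<in> Msgs"
      "key (Idx - msgs a) (?C \<union> {a + 1}) m = key (Idx - msgs a) (?C \<union> {a + 1}) m'" for m m'
      by (rule chain_down_known[OF that all_but all_but, where p = "a + 1" and r = 1]) (use a K in auto)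
    show "msgs ?p \<subseteq> Idx - msgs a" by (rule all_but) simp
  qed (use C K a in auto)
  have right: "lsize (msgs ?e) + ent (?S \<union> msgs ?q) ?C \<le> ent ?S ?C + Gcell + 2 * fano"
  proof (rule ent_outer_le[where q = "a + 2 * D + 2"])
    show "ent (?S \<union> msgs ?q) (?C \<union> {a + 2 * D + 2}) \<le> ent ?S (?C \<union> {a + 2 * D + 2}) + fano"
    proof (rule ent_decode_le[OF msgs_subset, where W = "{a + 2..a + 2 * D + 2}"])
      fix i and y y' :: "nat \<times> nat \<Rightarrow> real"
      assume "i \<in> msgs ?q" "\<And>k t. k \<in> {a + 2..a + 2 * D + 2} \<Longrightarrow> t \<in> {1..n} \<Longrightarrow> y (k, t) = y' (k, t)"
      then show "decision D K n c s i y = decision D K n c s i y'"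
        by (intro decision_window[of i ?q "a + 2" "a + 2 * D + 2"]) auto
    next
      fix m m' k t
      assume eq: "key ?S (?C \<union> {a + 2 * D + 2}) m = key ?S (?C \<union> {a + 2 * D + 2}) m'"
        and k: "k \<in> {a + 2..a + 2 * D + 2}" and t: "t \<in> {1..n}"
      have "k \<in> ?C \<union> {a + 2 * D + 2}" using k by auto
      then show "\<bar>clean m (k, t) - clean m' (k, t)\<bar> \<le> slack"
        by (rule cell_known[OF eq _ t])
    qed (use K in auto)
    show "close (kappa K) m m' ?e" if "m \<in> Msgs" "m' \<in> Msgs"
      "key (Idx - msgs ?e) (?C \<union> {a + 2 * D + 2}) m = key (Idx - msgs ?e) (?C \<union> {a + 2 * D + 2}) m'" for m m'
      by (rule chain_up_known[OF that all_but all_but, where p = "a + 2 * D + 1" and r = 1]) (use a K in auto)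
    show "msgs ?q \<subseteq> Idx - msgs ?e" by (rule all_but) simp
  qed (use C K a in auto)
  have "ent (?S \<union> msgs ?p \<union> (?S \<union> msgs ?q)) (?C \<union> ?C) + ent ((?S \<union> msgs ?p) \<inter> (?S \<union> msgs ?q)) (?C \<inter> ?C)
      \<le> ent (?S \<union> msgs ?p) ?C + ent (?S \<union> msgs ?q) ?C"
    by (rule ent_submod)
  moreover have "(?S \<union> msgs ?p) \<inter> (?S \<union> msgs ?q) = ?S"
    using msgs_disjoint[of ?p ?q] by auto
  moreover have "?S \<union> msgs ?p \<union> (?S \<union> msgs ?q) = ?T" by auto
  ultimately have middle: "ent ?T ?C + ent ?S ?C \<le> ent (?S \<union> msgs ?p) ?C + ent (?S \<union> msgs ?q) ?C" by simp
  let ?E = "msgs a \<union> msgs ?e"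
  have other: "msgs j \<subseteq> ?T \<union> ?E" if "j \<notin> {a + 1..a + D} \<union> {a + D + 3..a + 2 * D + 2}" for j
  proof (cases "j \<in> {a, ?p, ?q, ?e}")
    case False
    then have "j \<notin> {a..a + 2 * D + 3}" using that by auto
    then have "msgs j \<inter> ?J = {}" by (auto simp: msgs_def)
    then show ?thesis using msgs_subset[of j] by auto
  qed auto
  \<comment> \<open>The middle pair is adjacent, so \<open>?C\<close> yields D further inputs on
    each side. The two outermost users are not reached and have to be given.\<close>
  have "lsize Idx \<le> ent (?T \<union> ?E) ?C + fano"
  proof (rule lsize_le_ent)
    fix m m' j
    assume m: "m \<in> Msgs" "m' \<in> Msgs" "key (?T \<union> ?E) ?C m = key (?T \<union> ?E) ?C m'"
    consider "j \<in> {a + 1..a + D}" | "j \<in> {a + D + 3..a + 2 * D + 2}"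
      | "j \<notin> {a + 1..a + D} \<union> {a + D + 3..a + 2 * D + 2}" by auto
    then show "close (kappa K) m m' j"
    proof cases
      case 1
      show ?thesis
        by (rule chain_down_known[OF m other other, where p = ?p and r = D]) (use 1 a K in auto)
    next
      case 2
      show ?thesis
        by (rule chain_up_known[OF m other other, where p = ?p and r = D]) (use 2 a K in auto)
    next
      case 3
      show ?thesis by (rule close_known[OF m other[OF 3]])
    qed
  qed
  also have "ent (?T \<union> ?E) ?C \<le> ent ?T ?C + lsize ?E"
  proof -
    have "ent (?T \<union> ?E) (?C \<union> {}) \<le> ent ?T ?C + lsize ?E + real (card ({} :: nat set)) * Gcell"
      using msgs_subset C by (intro ent_le) (auto simp: msgs_def)
    then show ?thesis by simp
  qed
  also have "lsize ?E = lsize (msgs a) + lsize (msgs ?e)"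
    by (rule lsize_Un) (auto simp: finite_msgs msgs_def)
  finally have "lsize Idx \<le> ent ?T ?C + lsize (msgs a) + lsize (msgs ?e) + fano" by simp
  moreover have "ent ?S ?C \<le> lsize Idx - lsize ?J + real (card ?C) * Gcell"
    by (rule ent_known_le[OF J C refl])
  \<comment> \<open>Of the five \<open>fano\<close>, two come from each side and one from the last
    decoding. The entropy \<open>ent ?S ?C\<close> occurs twice on the right of the side bounds and
    is cancelled once by \<open>middle\<close>.\<close>
  ultimately have "lsize ?J \<le> real (card ?C) * Gcell + 2 * Gcell + 5 * fano"
    using left right middle by linarith
  then show ?thesis by (simp add: lsize_UN algebra_simps)
qed

end

section \<open>Rates for a fixed activity pattern\<close>

lemma (in wyner_block) lsize_msgs:
  "lsize (msgs k) = (if k \<in> urllc_set K s then ln (real NU) else 0)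
     + (if k \<in> active_set K s then ln (real (NE k)) else 0)"
proof -
  have "msgs k = (if k \<in> urllc_set K s then {(True, k)} else {}) \<union> (if k \<in> active_set K s then {(False, k)} else {})"
    by (auto simp: msgs_def Idx_def)
  then show ?thesis by (auto simp: lsize_def size_of_def)
qed

text \<open>The constant that accompanies (ln P) / 2, per channel use and in nats. The factor 5 is
  the number of decoding steps in the most expensive local inequality. Only \<open>K\<close>,
  \<open>H\<close> and \<open>g\<close> enter, so the constant is negligible for large P.\<close>

definition (in wyner_block) "offset = ln (2 * exp 2 * (1 + sqrt (18 * H\<^sup>2 + 2)))
  + 5 * (real K * ln (sqrt 2 * exp (slack\<^sup>2 / 2)))"

text \<open>For \<open>1 \<le> P\<close> a factor \<open>sqrt P\<close> splits off from the lattice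
  bound and becomes \<open>ln P / 2\<close>. Because \<open>1 \<le> q\<close>, the shift costs of
  all decoding steps fit into \<open>q * offset\<close>.\<close>

lemma (in wyner_block) entropy_budget_le:
  assumes P1: "1 \<le> P" and T: "lsize Idx \<le> real n * T" and q: "1 \<le> q" and r: "r \<le> 5"
  shows "q * Gcell + r * fano \<le> q * (real n * (ln P / 2 + offset)) + 5 + real n * (5 * \<epsilon> * T)"
proof -
  let ?c1 = "ln (2 * exp 2 * (1 + sqrt (18 * H\<^sup>2 + 2)))"
    and ?c2 = "real K * ln (sqrt 2 * exp (slack\<^sup>2 / 2))"
  have pos: "0 < 1 + sqrt (18 * H\<^sup>2 + 2)" "0 < 1 + sqrt (18 * H\<^sup>2 * P + 2)"
    using P0 by (auto intro!: add_pos_nonneg)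
  have "sqrt (18 * H\<^sup>2 * P + 2) \<le> sqrt ((18 * H\<^sup>2 + 2) * P)"
    using P1 by (intro real_sqrt_le_mono) (simp add: algebra_simps)
  also have "\<dots> = sqrt (18 * H\<^sup>2 + 2) * sqrt P" by (rule real_sqrt_mult)
  finally have "1 + sqrt (18 * H\<^sup>2 * P + 2) \<le> (1 + sqrt (18 * H\<^sup>2 + 2)) * sqrt P"
    using P1 by (simp add: algebra_simps add_mono)
  then have "2 * exp 2 * (1 + sqrt (18 * H\<^sup>2 * P + 2)) \<le> 2 * exp 2 * (1 + sqrt (18 * H\<^sup>2 + 2)) * sqrt P"
    by simp
  then have "ln (2 * exp 2 * (1 + sqrt (18 * H\<^sup>2 * P + 2)))
      \<le> ln (2 * exp 2 * (1 + sqrt (18 * H\<^sup>2 + 2)) * sqrt P)"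
    by (rule ln_mono) (use pos in auto)
  also have "\<dots> = ?c1 + ln P / 2"
    using pos P1 by (subst ln_mult) (auto simp: ln_sqrt)
  finally have G: "Gcell \<le> real n * (?c1 + ln P / 2)"
    unfolding Gcell_def by (rule mult_left_mono) simp
  have "1 * 1 \<le> sqrt 2 * exp (slack\<^sup>2 / 2)" by (intro mult_mono) auto
  then have c2: "0 \<le> ?c2" by simp
  have "\<epsilon> * lsize Idx \<le> \<epsilon> * (real n * T)" by (rule mult_left_mono[OF T eps])
  then have F: "fano \<le> real n * ?c2 + 1 + real n * (\<epsilon> * T)"
    by (simp add: fano_def algebra_simps)
  have "q * Gcell \<le> q * (real n * (?c1 + ln P / 2))" using G q by (intro mult_left_mono) auto
  moreover have "r * fano \<le> 5 * fano" using r fano_nonneg by (rule mult_right_mono)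
  moreover have "1 * (real n * (5 * ?c2)) \<le> q * (real n * (5 * ?c2))"
    using q c2 by (intro mult_right_mono) auto
  ultimately show ?thesis using F by (simp add: offset_def algebra_simps)
qed

lemma rate_limit:
  assumes "\<And>n. 1 \<le> n \<Longrightarrow> real n * x - B \<le> real n * y + b + real n * (\<epsilon> n * t)"
    and "\<epsilon> \<longlonglongrightarrow> 0"
  shows "x \<le> y"
proof (rule LIMSEQ_le_const)
  have "(\<lambda>n. y + (B + b) * inverse (real n) + \<epsilon> n * t) \<longlonglongrightarrow> y + (B + b) * 0 + 0 * t"
    using assms(2) by (intro tendsto_intros lim_inverse_n)
  then show "(\<lambda>n. y + (B + b) * inverse (real n) + \<epsilon> n * t) \<longlonglongrightarrow> y" by simp
  show "\<exists>N. \<forall>n\<ge>N. x \<le> y + (B + b) * inverse (real n) + \<epsilon> n * t"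
  proof (intro exI allI impI)
    fix n :: nat assume n: "1 \<le> n"
    have "real n * x \<le> real n * (y + (B + b) * inverse (real n) + \<epsilon> n * t)"
      using assms(1)[OF n] n by (simp add: algebra_simps)
    then show "x \<le> y + (B + b) * inverse (real n) + \<epsilon> n * t" using n by simp
  qed
qed

lemma finite_set_activity_pmf: "finite (set_pmf (activity_pmf \<rho> \<rho>\<^sub>f K))"
proof (rule finite_subset)
  show "set_pmf (activity_pmf \<rho> \<rho>\<^sub>f K) \<subseteq> PiE_dflt {1..K} (False, False) (\<lambda>_. UNIV)"
    unfolding activity_pmf_def using set_Pi_pmf_subset'[of "{1..K}"] by (fastforce simp: PiE_dflt_def)
qed (intro finite_PiE_dflt, auto)

definition message_count :: "nat \<Rightarrow> real \<Rightarrow> nat" where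
  "message_count n R = nat \<lfloor>2 powr (real n * R)\<rfloor>"

lemma message_count_ge_1: "0 \<le> R \<Longrightarrow> 1 \<le> message_count n R"
  using powr_mono[of 0 "real n * R" 2] by (simp add: message_count_def le_nat_iff le_floor_iff)

lemma ln_message_count_bounds:
  assumes "0 \<le> R"
  shows "real n * R * ln 2 - ln 2 \<le> ln (real (message_count n R))"
    and "ln (real (message_count n R)) \<le> real n * R * ln 2"
proof -
  let ?x = "2 powr (real n * R)"
  have c: "1 \<le> real (message_count n R)" using message_count_ge_1[OF assms, of n] by simp
  have fl: "real (message_count n R) = real_of_int \<lfloor>?x\<rfloor>" by (simp add: message_count_def)
  then have "?x < 2 * real (message_count n R)" using c by linarith
  then have "ln ?x \<le> ln (2 * real (message_count n R))" by (intro ln_mono) auto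
  then show "real n * R * ln 2 - ln 2 \<le> ln (real (message_count n R))"
    using c by (simp add: ln_mult ln_powr)
  have "real (message_count n R) \<le> ?x" using fl by linarith
  then have "ln (real (message_count n R)) \<le> ln ?x" using c by (intro ln_mono) auto
  then show "ln (real (message_count n R)) \<le> real n * R * ln 2" by (simp add: ln_powr)
qed

abbreviation message_tuples where
  "message_tuples K s n RU R \<equiv> PiE_dflt (urllc_set K s) 0 (\<lambda>_. {1..message_count n RU})
     \<times> PiE_dflt (active_set K s) 0 (\<lambda>k. {1..message_count n (R k)})"

lemma message_law:
  assumes "0 \<le> RU" "\<And>k. 0 \<le> R k"
  shows "do { mU \<leftarrow> Pi_pmf (urllc_set K s) 0 (\<lambda>_. message_pmf n RU);
          mE \<leftarrow> Pi_pmf (active_set K s) 0 (\<lambda>k. message_pmf n (R k));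
          return_pmf (s, mU, mE) } = map_pmf (Pair s) (pmf_of_set (message_tuples K s n RU R))"
proof -
  let ?A = "PiE_dflt (urllc_set K s) 0 (\<lambda>_. {1..message_count n RU})"
    and ?B = "PiE_dflt (active_set K s) 0 (\<lambda>k. {1..message_count n (R k)})"
  have fin: "finite (urllc_set K s)" "finite (active_set K s)"
    by (simp_all add: urllc_set_def active_set_def)
  have ne: "{1..message_count n RU} \<noteq> {}" "{1..message_count n (R k)} \<noteq> {}" for k
    using message_count_ge_1[of RU n] message_count_ge_1[of "R k" n] assms by auto
  have A: "Pi_pmf (urllc_set K s) 0 (\<lambda>_. message_pmf n RU) = pmf_of_set ?A"
    unfolding message_pmf_def message_count_def[symmetric] by (rule Pi_pmf_of_set) (use fin ne in auto)
  have B: "Pi_pmf (active_set K s) 0 (\<lambda>k. message_pmf n (R k)) = pmf_of_set ?B"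
    unfolding message_pmf_def message_count_def[symmetric] by (rule Pi_pmf_of_set) (use fin ne in auto)
  have AB: "finite ?A" "?A \<noteq> {}" "finite ?B" "?B \<noteq> {}"
    using fin ne by (auto intro!: finite_PiE_dflt)
  have "pmf_of_set (?A \<times> ?B) = pair_pmf (pmf_of_set ?A) (pmf_of_set ?B)"
  proof (rule pmf_eqI)
    fix x :: "(nat \<Rightarrow> nat) \<times> (nat \<Rightarrow> nat)"
    obtain a b where [simp]: "x = (a, b)" by (cases x)
    have "finite (?A \<times> ?B)" "?A \<times> ?B \<noteq> {}" using AB by auto
    then show "pmf (pmf_of_set (?A \<times> ?B)) x = pmf (pair_pmf (pmf_of_set ?A) (pmf_of_set ?B)) x"
      using AB by (simp add: pmf_pair indicator_def card_cartesian_product)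
  qed
  then show ?thesis
    unfolding A B pair_pmf_def by (simp add: map_bind_pmf)
qed

lemma source_pmf_conv:
  assumes "0 \<le> RU" "\<And>s k. 0 \<le> RE s k"
  shows "source_pmf \<rho> \<rho>\<^sub>f K n RU RE = do { s \<leftarrow> activity_pmf \<rho> \<rho>\<^sub>f K;
    map_pmf (Pair s) (pmf_of_set (message_tuples K s n RU (RE s))) }"
  unfolding source_pmf_def using assms by (subst message_law) auto

lemma message_tuples_finite: "finite (message_tuples K s n RU R)"
  by (intro finite_cartesian_product finite_PiE_dflt) (auto simp: urllc_set_def active_set_def)

lemma message_tuples_nonempty:
  assumes "0 \<le> RU" "\<And>k. 0 \<le> R k"
  shows "message_tuples K s n RU R \<noteq> {}"
  using message_count_ge_1[of RU n] message_count_ge_1[of "R _" n] assms by auto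

text \<open>The error probability is a weighted mean over finitely many patterns, so fixing one
  pattern enlarges it at most by the inverse of its probability, a factor that does not depend on
  n.\<close>

lemma error_given_activity:
  assumes R: "0 \<le> RU" "\<And>s k. 0 \<le> RE s k" and s: "s \<in> set_pmf (activity_pmf \<rho> \<rho>\<^sub>f K)"
  shows "(\<Sum>(mU, mE)\<in>message_tuples K s n RU (RE s).
      measure (noise_measure K n) {z \<in> space (noise_measure K n). decoding_error h D K n c s mU mE z})
    \<le> (error_prob \<rho> \<rho>\<^sub>f h D K n RU RE c / pmf (activity_pmf \<rho> \<rho>\<^sub>f K) s)
       * real (card (message_tuples K s n RU (RE s)))"
proof -
  let ?p = "activity_pmf \<rho> \<rho>\<^sub>f K" and ?M = "\<lambda>s. message_tuples K s n RU (RE s)"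
  let ?F = "\<lambda>(s, mU, mE). measure (noise_measure K n)
    {z \<in> space (noise_measure K n). decoding_error h D K n c s mU mE z}"
  have ne: "?M s \<noteq> {}" for s by (rule message_tuples_nonempty[OF R])
  have finS: "finite (set_pmf (map_pmf (Pair s) (pmf_of_set (?M s))))" for s
    unfolding set_map_pmf set_pmf_of_set[OF ne message_tuples_finite]
    by (rule finite_imageI[OF message_tuples_finite])
  have E: "measure_pmf.expectation (map_pmf (Pair s) (pmf_of_set (?M s))) ?F
      = (\<Sum>m\<in>?M s. ?F (s, m)) / real (card (?M s))" for s
    using integral_pmf_of_set[OF ne message_tuples_finite, where f = "\<lambda>m. ?F (s, m)"] by simp
  have "error_prob \<rho> \<rho>\<^sub>f h D K n RU RE c
      = (\<Sum>s\<in>set_pmf ?p. pmf ?p s *\<^sub>R measure_pmf.expectation (map_pmf (Pair s) (pmf_of_set (?M s))) ?F)"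
    unfolding error_prob_def source_pmf_conv[OF R]
    by (rule pmf_expectation_bind[OF finite_set_activity_pmf finS order_refl])
  also have "\<dots> \<ge> pmf ?p s *\<^sub>R measure_pmf.expectation (map_pmf (Pair s) (pmf_of_set (?M s))) ?F"
    by (rule member_le_sum[OF s _ finite_set_activity_pmf])
      (auto intro!: mult_nonneg_nonneg Bochner_Integration.integral_nonneg)
  finally have le: "pmf ?p s * ((\<Sum>m\<in>?M s. ?F (s, m)) / real (card (?M s))) \<le> error_prob \<rho> \<rho>\<^sub>f h D K n RU RE c"
    by (simp only: E real_scaleR_def)
  have pos: "0 < pmf ?p s" "0 < real (card (?M s))"
    using s ne[of s] message_tuples_finite by (auto simp: pmf_positive_iff card_gt_0_iff simp del: card_cartesian_product)
  have "(\<Sum>m\<in>?M s. ?F (s, m)) \<le> error_prob \<rho> \<rho>\<^sub>f h D K n RU RE c / pmf ?p s * real (card (?M s))"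
    using le pos by (simp add: field_simps)
  then show ?thesis by (simp add: case_prod_unfold)
qed

lemma power_given_activity:
  assumes R: "0 \<le> RU" "\<And>s k. 0 \<le> RE s k" and s: "s \<in> set_pmf (activity_pmf \<rho> \<rho>\<^sub>f K)"
    and pc: "power_constraint \<rho> \<rho>\<^sub>f K n P RU RE c" and n: "1 \<le> n"
    and m: "(mU, mE) \<in> message_tuples K s n RU (RE s)" and k: "k \<in> {1..K}"
  shows "(\<Sum>t = 1..n. (channel_input K c s mU mE k t)\<^sup>2) \<le> real n * P"
proof -
  have "(s, mU, mE) \<in> set_pmf (source_pmf \<rho> \<rho>\<^sub>f K n RU RE)"
    unfolding source_pmf_conv[OF R] set_bind_pmf set_map_pmf
      set_pmf_of_set[OF message_tuples_nonempty[OF R] message_tuples_finite]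
    using s m by blast
  then have "(1 / real n) * (\<Sum>t = 1..n. (channel_input K c s mU mE k t)\<^sup>2) \<le> P"
    using pc k unfolding power_constraint_def AE_measure_pmf_iff by fastforce
  then show ?thesis using n by (simp add: field_simps)
qed

definition user_rate :: "nat \<Rightarrow> activity \<Rightarrow> real \<Rightarrow> (nat \<Rightarrow> real) \<Rightarrow> nat \<Rightarrow> real" where
  "user_rate K s RU R k = (if k \<in> urllc_set K s then RU else 0) + (if k \<in> active_set K s then R k else 0)"

text \<open>All that is kept of the information theory: \<open>L k\<close> is the total rate of user
  k and \<open>g\<close> the capacity of one output. The rest is combinatorics of runs and
  averaging.\<close>

definition local_bounds :: "nat \<Rightarrow> nat \<Rightarrow> activity \<Rightarrow> real \<Rightarrow> (nat \<Rightarrow> real) \<Rightarrow> real \<Rightarrow> bool" where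
  "local_bounds D K s RU L g \<longleftrightarrow>
     (\<forall>k\<in>active_set K s. L k \<le> g) \<and>
     (\<forall>k\<in>urllc_set K s. k + 1 \<in> active_set K s \<longrightarrow> RU + L (k + 1) \<le> g) \<and>
     (\<forall>a\<ge>1. a - 1 \<notin> active_set K s \<longrightarrow> a + D + 1 \<le> K \<longrightarrow> (\<Sum>k = a..a + D + 1. L k) \<le> real (D + 1) * g) \<and>
     (\<forall>a\<ge>1. a + 2 * D + 3 \<le> K \<longrightarrow> (\<Sum>k = a..a + 2 * D + 3. L k) \<le> real (2 * D + 2) * g)"

lemma local_bounds_of_code:
  assumes K: "2 \<le> K" and h: "\<And>i k. 0 \<le> h i k"
    and H: "\<And>i k. i \<le> K + 1 \<Longrightarrow> k \<le> K + 1 \<Longrightarrow> h i k \<le> H"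
    and g: "0 < g" "\<And>k. 1 \<le> k \<Longrightarrow> k \<le> K \<Longrightarrow> g \<le> h k (k + 1) \<and> g \<le> h (k + 1) k"
    and P: "1 \<le> P" and R: "0 \<le> RU" "\<And>s k. 0 \<le> RE s k"
    and c: "\<And>n. 1 \<le> n \<Longrightarrow> measurable_code D K n (c n) \<and> power_constraint \<rho> \<rho>\<^sub>f K n P RU RE (c n)"
    and err: "(\<lambda>n. error_prob \<rho> \<rho>\<^sub>f h D K n RU RE (c n)) \<longlonglongrightarrow> 0"
    and s: "s \<in> set_pmf (activity_pmf \<rho> \<rho>\<^sub>f K)"
  shows "local_bounds D K s RU (user_rate K s RU (RE s)) (log 2 P / 2 + wyner_block.offset K H g / ln 2)"
proof -
  let ?L = "user_rate K s RU (RE s)" and ?g = "log 2 P / 2 + wyner_block.offset K H g / ln 2"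
    and ?C = "wyner_block.offset K H g"
  define \<epsilon> where "\<epsilon> n = error_prob \<rho> \<rho>\<^sub>f h D K n RU RE (c n) / pmf (activity_pmf \<rho> \<rho>\<^sub>f K) s" for n
  have eps: "0 \<le> \<epsilon> n" for n
    unfolding \<epsilon>_def error_prob_def by (auto intro!: divide_nonneg_nonneg Bochner_Integration.integral_nonneg)
  have eps0: "\<epsilon> \<longlonglongrightarrow> 0"
    unfolding \<epsilon>_def[abs_def] by (rule tendsto_divide_zero[OF err])
  have block: "wyner_block h D K n (c n) s (message_count n RU) (\<lambda>k. message_count n (RE s k)) H g P (\<epsilon> n)"
    if n: "1 \<le> n" for n
  proof
    show "(\<Sum>t = 1..n. (channel_input K (c n) s mU mE k t)\<^sup>2) \<le> real n * P"
      if "mU \<in> PiE_dflt (urllc_set K s) 0 (\<lambda>_. {1..message_count n RU})"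
        "mE \<in> PiE_dflt (active_set K s) 0 (\<lambda>k. {1..message_count n (RE s k)})" "k \<in> {1..K}" for mU mE k
      using power_given_activity[where RE = RE and P = P and c = "c n", OF R s _ n] c[OF n] that by blast
    show "1 \<le> message_count n RU" by (rule message_count_ge_1[OF R(1)])
    show "1 \<le> message_count n (RE s k)" for k by (rule message_count_ge_1[OF R(2)])
  qed (use K h H g P eps c[OF n] error_given_activity[where RE = RE, OF R s] in \<open>auto simp: \<epsilon>_def\<close>)
  \<comment> \<open>From entropies to rates: divide by n, let n grow, and pass from nats to bits.
    The number \<open>b\<close> absorbs the rounding of the message counts.\<close>
  have up: "x \<le> q * ?g" if q: "1 \<le> q" and r: "r \<le> 5" and
    le: "\<And>n. 1 \<le> n \<Longrightarrow> real n * (x * ln 2) - b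
      \<le> q * wyner_block.Gcell n H P + r * wyner_block.fano K n s (message_count n RU) (\<lambda>k. message_count n (RE s k)) H g (\<epsilon> n)"
    for x q r b
  proof -
    define T where "T = (\<Sum>i\<in>{True} \<times> urllc_set K s \<union> {False} \<times> active_set K s. (if fst i then RU else RE s (snd i)) * ln 2)"
    have "real n * (x * ln 2) - b \<le> real n * (q * (ln P / 2 + ?C)) + 5 + real n * (\<epsilon> n * (5 * T))"
      if n: "1 \<le> n" for n
    proof -
      interpret wyner_block h D K n "c n" s "message_count n RU" "\<lambda>k. message_count n (RE s k)" H g P "\<epsilon> n"
        by (rule block[OF n])
      have "lsize Idx \<le> (\<Sum>i\<in>Idx. real n * ((if fst i then RU else RE s (snd i)) * ln 2))"
        unfolding lsize_def
        by (rule sum_mono) (use ln_message_count_bounds(2) R in \<open>auto simp: size_of_def mult.assoc\<close>)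
      also have "\<dots> = real n * T" by (simp add: T_def Idx_def sum_distrib_left)
      finally have "lsize Idx \<le> real n * T" .
      from entropy_budget_le[OF P this q r] le[OF n] show ?thesis by (simp add: algebra_simps)
    qed
    then have "x * ln 2 \<le> q * (ln P / 2 + ?C)"
      by (rule rate_limit[OF _ eps0])
    then show ?thesis by (simp add: log_def field_simps)
  qed
  \<comment> \<open>Rounding a message count down costs at most \<open>ln 2\<close> per message, and
    a user has at most two messages.\<close>
  have low: "real n * (?L k * ln 2) - 2 * ln 2 \<le> wyner_block.lsize (message_count n RU) (\<lambda>k. message_count n (RE s k))
      (wyner_block.msgs K s k)" if n: "1 \<le> n" for n k
  proof -
    interpret wyner_block h D K n "c n" s "message_count n RU" "\<lambda>k. message_count n (RE s k)" H g P "\<epsilon> n"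
      by (rule block[OF n])
    define l where "l = ln (2::real)"
    have "0 < l" by (simp add: l_def)
    then show ?thesis
      using ln_message_count_bounds(1)[OF R(1), of n] ln_message_count_bounds(1)[OF R(2), of n s k]
      unfolding lsize_msgs user_rate_def l_def[symmetric] by (auto simp: algebra_simps)
  qed
  have low_sum: "real n * ((\<Sum>k\<in>A. ?L k) * ln 2) - real (card A) * (2 * ln 2)
      \<le> (\<Sum>k\<in>A. wyner_block.lsize (message_count n RU) (\<lambda>k. message_count n (RE s k)) (wyner_block.msgs K s k))"
    if n: "1 \<le> n" for n and A :: "nat set"
  proof -
    have "(\<Sum>k\<in>A. real n * (?L k * ln 2) - 2 * ln 2)
      \<le> (\<Sum>k\<in>A. wyner_block.lsize (message_count n RU) (\<lambda>k. message_count n (RE s k)) (wyner_block.msgs K s k))"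
      by (rule sum_mono) (rule low[OF n])
    then show ?thesis by (simp add: sum_subtractf sum_distrib_left sum_distrib_right)
  qed
  show ?thesis
    unfolding local_bounds_def
  proof (intro conjI ballI allI impI)
    fix k assume k: "k \<in> active_set K s"
    have "?L k \<le> 1 * ?g"
    proof (rule up[where r = 1])
      fix n :: nat assume n: "1 \<le> n"
      show "real n * (?L k * ln 2) - 2 * ln 2 \<le> 1 * wyner_block.Gcell n H P
        + 1 * wyner_block.fano K n s (message_count n RU) (\<lambda>k. message_count n (RE s k)) H g (\<epsilon> n)"
        using wyner_block.single_user[OF block[OF n] k] low[OF n, of k] by simp
    qed auto
    then show "?L k \<le> ?g" by simp
  next
    fix k assume k: "k \<in> urllc_set K s" and k': "k + 1 \<in> active_set K s"
    have "RU + ?L (k + 1) \<le> 1 * ?g"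
    proof (rule up[where r = 2])
      fix n :: nat assume n: "1 \<le> n"
      interpret wyner_block h D K n "c n" s "message_count n RU" "\<lambda>k. message_count n (RE s k)" H g P "\<epsilon> n"
        by (rule block[OF n])
      have "lsize {(True, k)} = ln (real (message_count n RU))" by (simp add: lsize_def size_of_def)
      then show "real n * ((RU + ?L (k + 1)) * ln 2) - 3 * ln 2 \<le> 1 * Gcell + 2 * fano"
        using urllc_neighbour[OF k k'] low[OF n, of "k + 1"] ln_message_count_bounds(1)[OF R(1), of n]
        by (simp add: algebra_simps)
    qed auto
    then show "RU + ?L (k + 1) \<le> ?g" by simp
  next
    fix a :: nat assume a: "1 \<le> a" "a - 1 \<notin> active_set K s" "a + D + 1 \<le> K"
    show "(\<Sum>k = a..a + D + 1. ?L k) \<le> real (D + 1) * ?g"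
    proof (rule up[where r = 2])
      fix n :: nat assume n: "1 \<le> n"
      show "real n * ((\<Sum>k = a..a + D + 1. ?L k) * ln 2) - real (card {a..a + D + 1}) * (2 * ln 2)
        \<le> real (D + 1) * wyner_block.Gcell n H P
          + 2 * wyner_block.fano K n s (message_count n RU) (\<lambda>k. message_count n (RE s k)) H g (\<epsilon> n)"
        using wyner_block.run_start_block[OF block[OF n] a] low_sum[OF n, of "{a..a + D + 1}"] by linarith
    qed auto
  next
    fix a :: nat assume a: "1 \<le> a" "a + 2 * D + 3 \<le> K"
    show "(\<Sum>k = a..a + 2 * D + 3. ?L k) \<le> real (2 * D + 2) * ?g"
    proof (rule up[where r = 5])
      fix n :: nat assume n: "1 \<le> n"
      show "real n * ((\<Sum>k = a..a + 2 * D + 3. ?L k) * ln 2) - real (card {a..a + 2 * D + 3}) * (2 * ln 2)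
        \<le> real (2 * D + 2) * wyner_block.Gcell n H P
          + 5 * wyner_block.fano K n s (message_count n RU) (\<lambda>k. message_count n (RE s k)) H g (\<epsilon> n)"
        using wyner_block.double_block[OF block[OF n] a] low_sum[OF n, of "{a..a + 2 * D + 3}"] by linarith
    qed auto
  qed
qed

lemma local_bounds_mono:
  assumes "local_bounds D K s RU L g" "g \<le> g'"
  shows "local_bounds D K s RU L g'"
proof -
  have "real (D + 1) * g \<le> real (D + 1) * g'" "real (2 * D + 2) * g \<le> real (2 * D + 2) * g'"
    using assms(2) by (auto intro!: mult_left_mono)
  with assms show ?thesis unfolding local_bounds_def by (meson order_trans)
qed

text \<open>The order of quantifiers is the point: \<open>C\<close> is chosen before P and the
  rates. For fixed \<open>K\<close> only finitely many gains occur, so they are bounded above and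
  the cross gains are bounded away from 0.\<close>

lemma local_bounds_of_achievable:
  assumes K: "2 \<le> K" and h: "\<And>i k. 0 \<le> h i k"
    and h_pos: "\<And>k. 1 \<le> k \<Longrightarrow> 0 < h k (k + 1) \<and> 0 < h (k + 1) k"
  obtains C where "0 \<le> C"
    and "\<And>\<rho> \<rho>\<^sub>f P RU RE_avg. 1 \<le> P \<Longrightarrow> achievable_rates \<rho> \<rho>\<^sub>f h D K P RU RE_avg \<Longrightarrow>
      \<exists>RE. (\<forall>s k. 0 \<le> RE s k) \<and>
        RE_avg \<le> measure_pmf.expectation (activity_pmf \<rho> \<rho>\<^sub>f K)
                   (\<lambda>s. (1 / real K) * (\<Sum>k\<in>active_set K s. RE s k)) \<and>
        (\<forall>s\<in>set_pmf (activity_pmf \<rho> \<rho>\<^sub>f K).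
          local_bounds D K s RU (user_rate K s RU (RE s)) (log 2 P / 2 + C))"
proof -
  define H where "H = Max ((\<lambda>(i, k). h i k) ` ({..K + 1} \<times> {..K + 1}))"
  define g where "g = Min ((\<lambda>k. min (h k (k + 1)) (h (k + 1) k)) ` {1..K})"
  have H: "h i k \<le> H" if "i \<le> K + 1" "k \<le> K + 1" for i k
    unfolding H_def by (rule Max_ge) (use that in auto)
  have g: "0 < g" unfolding g_def using K h_pos by (subst Min_gr_iff) auto
  have g_le: "g \<le> h k (k + 1) \<and> g \<le> h (k + 1) k" if "1 \<le> k" "k \<le> K" for k
  proof -
    have "g \<le> min (h k (k + 1)) (h (k + 1) k)" unfolding g_def by (rule Min_le) (use that in auto)
    then show ?thesis by simp
  qed
  let ?C = "max 0 (wyner_block.offset K H g / ln 2)"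
  show thesis
  proof (rule that[of ?C])
    fix \<rho> \<rho>\<^sub>f P RU RE_avg :: real
    assume P: "1 \<le> P" and ach: "achievable_rates \<rho> \<rho>\<^sub>f h D K P RU RE_avg"
    from ach obtain RE where R: "0 \<le> RU" "\<And>s k. 0 \<le> RE s k"
      and avg: "RE_avg \<le> measure_pmf.expectation (activity_pmf \<rho> \<rho>\<^sub>f K)
                   (\<lambda>s. (1 / real K) * (\<Sum>k\<in>active_set K s. RE s k))"
      and ex: "\<exists>c. (\<forall>n\<ge>1. measurable_code D K n (c n) \<and> power_constraint \<rho> \<rho>\<^sub>f K n P RU RE (c n)) \<and>
           (\<lambda>n. error_prob \<rho> \<rho>\<^sub>f h D K n RU RE (c n)) \<longlonglongrightarrow> 0"
      unfolding achievable_rates_def by blast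
    from ex obtain c where c: "\<And>n. 1 \<le> n \<Longrightarrow> measurable_code D K n (c n) \<and> power_constraint \<rho> \<rho>\<^sub>f K n P RU RE (c n)"
      and err: "(\<lambda>n. error_prob \<rho> \<rho>\<^sub>f h D K n RU RE (c n)) \<longlonglongrightarrow> 0"
      by blast
    show "\<exists>RE. (\<forall>s k. 0 \<le> RE s k) \<and>
        RE_avg \<le> measure_pmf.expectation (activity_pmf \<rho> \<rho>\<^sub>f K)
                   (\<lambda>s. (1 / real K) * (\<Sum>k\<in>active_set K s. RE s k)) \<and>
        (\<forall>s\<in>set_pmf (activity_pmf \<rho> \<rho>\<^sub>f K).
          local_bounds D K s RU (user_rate K s RU (RE s)) (log 2 P / 2 + ?C))"
    proof (intro exI[of _ RE] conjI ballI)
      fix s assume "s \<in> set_pmf (activity_pmf \<rho> \<rho>\<^sub>f K)"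
      from local_bounds_of_code[where RE = RE, OF K h H g g_le P R c err this]
      show "local_bounds D K s RU (user_rate K s RU (RE s)) (log 2 P / 2 + ?C)"
        by (rule local_bounds_mono) (simp_all only: add_left_mono max.cobounded2)
    qed (use R(2) avg in auto)
  qed simp
qed

section \<open>Runs of active transmitters\<close>

primrec runlen :: "activity \<Rightarrow> nat \<Rightarrow> nat" where
  "runlen s 0 = 0"
| "runlen s (Suc k) = (if fst (s (Suc k)) then Suc (runlen s k) else 0)"

lemma runlen_le: "runlen s k \<le> k"
  by (induction k) auto

lemma runlen_diff: "j \<le> runlen s k \<Longrightarrow> runlen s (k - j) = runlen s k - j"
proof (induction k arbitrary: j)
  case (Suc k)
  then show ?case by (cases j) (auto split: if_splits)
qed simp

lemma runlen_pos_iff: "0 < runlen s k \<longleftrightarrow> 0 < k \<and> fst (s k)"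
  by (cases k) auto

lemma runlen_active: "k < i + runlen s k \<Longrightarrow> i \<le> k \<Longrightarrow> fst (s i) \<and> 1 \<le> i"
  using runlen_diff[of "k - i" s k] runlen_pos_iff[of s i] by auto

lemma runlen_start: "k - runlen s k = 0 \<or> \<not> fst (s (k - runlen s k))"
  using runlen_diff[of "runlen s k" s k] runlen_pos_iff[of s "k - runlen s k"] by auto

lemma runlen_eqI:
  assumes "\<And>i. k < i + r \<Longrightarrow> i \<le> k \<Longrightarrow> fst (s i)" and "r \<le> k" and "\<not> fst (s (k - r))"
  shows "r < k \<Longrightarrow> runlen s k = r"
  using assms
proof (induction r arbitrary: k)
  case 0
  then show ?case by (cases k) auto
next
  case (Suc r)
  then obtain k' where k: "k = Suc k'" by (cases k) auto
  have "runlen s k' = r" by (rule Suc.IH) (use Suc.prems k in auto)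
  moreover have "fst (s k)" using Suc.prems(2)[of k] by simp
  ultimately show ?case by (simp add: k)
qed

text \<open>The users at which the sum bound gives up one unit. An incomplete block at the end of a
  run loses nothing.\<close>

definition block_end :: "nat \<Rightarrow> activity \<Rightarrow> nat \<Rightarrow> bool" where
  "block_end D s k \<longleftrightarrow> 0 < runlen s k \<and> (D + 2) dvd runlen s k"

text \<open>
  At a block end the induction jumps back over one block if the run consists of that block only, and
  over two blocks otherwise, so the parity of the number of blocks does not matter.
\<close>

lemma sum_rates_le:
  assumes lb: "local_bounds D K s RU L g" and g: "0 \<le> g"
    and L0: "\<And>k. k \<notin> active_set K s \<Longrightarrow> L k = 0"
  shows "k \<le> K \<Longrightarrow> (\<Sum>i = 1..k. L i) \<le> (\<Sum>i = 1..k. of_bool (fst (s i)) - of_bool (block_end D s i)) * g"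
proof (induction k rule: less_induct)
  case (less k)
  let ?d = "\<lambda>i. of_bool (fst (s i)) - of_bool (block_end D s i) :: real"
  \<comment> \<open>A jump back over the last l users of a run is allowed if their rates fit into l
    units minus one for each element of \<open>E\<close>, a set that contains all block ends among
    them.\<close>
  have block: "(\<Sum>i = 1..k. L i) \<le> (\<Sum>i = 1..k. ?d i) * g"
    if l: "0 < l" "l \<le> runlen s k" and le: "(\<Sum>i = k + 1 - l..k. L i) \<le> (real l - real (card E)) * g"
      and E: "\<And>i. i \<in> {k + 1 - l..k} \<Longrightarrow> block_end D s i \<Longrightarrow> i \<in> E" and finE: "finite E" for l E
  proof -
    have lk: "l \<le> k" using l runlen_le[of s k] by simp
    have split: "{1..k} = {1..k - l} \<union> {k + 1 - l..k}" using lk by auto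
    have "(\<Sum>i = k + 1 - l..k. of_bool (block_end D s i)) = real (card {i \<in> {k + 1 - l..k}. block_end D s i})"
      by (simp add: sum.If_cases of_bool_def Int_def)
    also have "\<dots> \<le> real (card E)"
      using E finE by (intro of_nat_mono card_mono) auto
    finally have be: "(\<Sum>i = k + 1 - l..k. of_bool (block_end D s i)) \<le> real (card E)" .
    have "(\<Sum>i = k + 1 - l..k. of_bool (fst (s i))) = (\<Sum>i = k + 1 - l..k. 1 :: real)"
      by (rule sum.cong) (use runlen_active[of k _ s] l in auto)
    also have "\<dots> = real l" using lk by simp
    finally have "real l - real (card E) \<le> (\<Sum>i = k + 1 - l..k. ?d i)"
      using be by (simp add: sum_subtractf)
    then have "(real l - real (card E)) * g \<le> (\<Sum>i = k + 1 - l..k. ?d i) * g"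
      by (rule mult_right_mono[OF _ g])
    moreover have "(\<Sum>i = 1..k - l. L i) \<le> (\<Sum>i = 1..k - l. ?d i) * g"
      by (rule less.IH) (use l lk less.prems in auto)
    moreover have "(\<Sum>i = 1..k. L i) = (\<Sum>i = 1..k - l. L i) + (\<Sum>i = k + 1 - l..k. L i)"
      unfolding split using l by (subst sum.union_disjoint) auto
    moreover have "(\<Sum>i = 1..k. ?d i) = (\<Sum>i = 1..k - l. ?d i) + (\<Sum>i = k + 1 - l..k. ?d i)"
      unfolding split using l by (subst sum.union_disjoint) auto
    ultimately show ?thesis using le by (simp add: distrib_right)
  qed
  \<comment> \<open>Two block ends of the same run differ by a multiple of D + 2.\<close>
  have be_cases: "i = k \<or> D + 2 \<le> k - i \<and> (D + 2) dvd (k - i)"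
    if "i \<in> {k + 1 - l..k}" "l \<le> runlen s k" "block_end D s i" "block_end D s k" for i l
  proof -
    have "(D + 2) dvd runlen s k - (k - i)"
      using that runlen_diff[of "k - i" s k] by (auto simp: block_end_def)
    moreover have "(D + 2) dvd runlen s k" using that by (simp add: block_end_def)
    moreover have "k - i \<le> runlen s k" using that by auto
    ultimately have "(D + 2) dvd (k - i)" by (metis dvd_diffD1)
    then show ?thesis using that by (auto dest: dvd_imp_le)
  qed
  show ?case
  proof (cases "k = 0")
    case False
    show ?thesis
    proof (cases "block_end D s k")
      case False
      have step: "{1..k} = insert k {1..k - 1}" using \<open>k \<noteq> 0\<close> by auto
      have "L k \<le> of_bool (fst (s k)) * g"
      proof (cases "fst (s k)")
        case True
        then have "k \<in> active_set K s" using less.prems \<open>k \<noteq> 0\<close> by (simp add: active_set_def)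
        then show ?thesis using lb True by (simp add: local_bounds_def)
      next
        case False
        then show ?thesis using L0[of k] by (simp add: active_set_def)
      qed
      moreover have "(\<Sum>i = 1..k - 1. L i) \<le> (\<Sum>i = 1..k - 1. ?d i) * g"
        by (rule less.IH) (use \<open>k \<noteq> 0\<close> less.prems in auto)
      ultimately show ?thesis
        using False \<open>k \<noteq> 0\<close> unfolding step by (simp add: algebra_simps)
    next
      case True
      then have r: "D + 2 \<le> runlen s k" by (auto simp: block_end_def dvd_imp_le)
      have rk: "runlen s k \<le> k" by (rule runlen_le)
      show ?thesis
      proof (cases "runlen s k = D + 2")
        case eq: True
        show ?thesis
        proof (rule block[where l = "D + 2" and E = "{k}"])
          define a where "a = k + 1 - (D + 2)"
          have a: "1 \<le> a" "a + D + 1 = k" "a - 1 = k - runlen s k" using r rk eq by (auto simp: a_def)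
          have "a - 1 \<notin> active_set K s"
            unfolding a(3) using runlen_start[of k s] by (auto simp: active_set_def)
          then have "(\<Sum>i = a..a + D + 1. L i) \<le> real (D + 1) * g"
            using lb less.prems a(1,2) unfolding local_bounds_def by auto
          then show "(\<Sum>i = k + 1 - (D + 2)..k. L i) \<le> (real (D + 2) - real (card {k})) * g"
            unfolding a(2) a_def[symmetric] by (simp add: algebra_simps)
          fix i assume i: "i \<in> {k + 1 - (D + 2)..k}" "block_end D s i"
          then show "i \<in> {k}" using be_cases[OF i(1) r i(2) True] by auto
        qed (use r in auto)
      next
        case False
        obtain j where j: "runlen s k = (D + 2) * j" using True by (auto simp: block_end_def)
        have "j \<noteq> 0" using j r by (intro notI) simp
        moreover have "j \<noteq> 1" using j False by (intro notI) simp
        ultimately have "(D + 2) * 2 \<le> (D + 2) * j" by (intro mult_le_mono2) auto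
        then have r2: "2 * D + 4 \<le> runlen s k" using j by simp
        \<comment> \<open>The last two blocks contain just the block ends k and k - (D + 2), and two
          units is what the double block saves.\<close>
        show ?thesis
        proof (rule block[where l = "2 * D + 4" and E = "{k, k - (D + 2)}"])
          define a where "a = k + 1 - (2 * D + 4)"
          have a: "1 \<le> a" "a + 2 * D + 3 = k" using r2 rk by (auto simp: a_def)
          have "(\<Sum>i = a..a + 2 * D + 3. L i) \<le> real (2 * D + 2) * g"
            using lb less.prems a unfolding local_bounds_def by auto
          moreover have "card {k, k - (D + 2)} = 2" using r2 rk by (subst card_2_iff) (intro exI[of _ k] exI[of _ "k - (D + 2)"], auto)
          ultimately show "(\<Sum>i = k + 1 - (2 * D + 4)..k. L i) \<le> (real (2 * D + 4) - real (card {k, k - (D + 2)})) * g"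
            unfolding a(2) a_def[symmetric] by (simp add: algebra_simps)
          fix i assume i: "i \<in> {k + 1 - (2 * D + 4)..k}" "block_end D s i"
          from be_cases[OF i(1) r2 i(2) True]
          show "i \<in> {k, k - (D + 2)}"
          proof
            assume d: "D + 2 \<le> k - i \<and> (D + 2) dvd (k - i)"
            then obtain q where q: "k - i = (D + 2) * q" by auto
            have "k - i < 2 * (D + 2)" using i by auto
            then have "q < 2" using q by (metis mult.commute mult_less_cancel2)
            moreover have "q \<noteq> 0" using q d by (intro notI) simp
            ultimately have "q = 1" by simp
            then have "k - i = D + 2" using q by simp
            then show ?thesis by auto
          qed simp
        qed (use r2 in auto)
      qed
    qed
  qed simp
qed

section \<open>Averaging over the activity pattern\<close>

lemma tx_activity_probs:
  assumes "0 \<le> \<rho>" "\<rho> \<le> 1" "0 \<le> \<rho>\<^sub>f" "\<rho>\<^sub>f \<le> 1"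
  shows "measure_pmf.prob (tx_activity_pmf \<rho> \<rho>\<^sub>f) {x. fst x} = \<rho>"
    and "measure_pmf.prob (tx_activity_pmf \<rho> \<rho>\<^sub>f) {x. \<not> fst x} = 1 - \<rho>"
    and "measure_pmf.prob (tx_activity_pmf \<rho> \<rho>\<^sub>f) {x. fst x \<and> snd x} = \<rho> * \<rho>\<^sub>f"
    and "pmf (tx_activity_pmf \<rho> \<rho>\<^sub>f) (True, True) = \<rho> * \<rho>\<^sub>f"
proof -
  have m: "map_pmf fst (tx_activity_pmf \<rho> \<rho>\<^sub>f) = bernoulli_pmf \<rho>"
    by (simp add: tx_activity_pmf_def map_bind_pmf bind_return_pmf')
  have "measure_pmf.prob (tx_activity_pmf \<rho> \<rho>\<^sub>f) {x. fst x = b} = pmf (bernoulli_pmf \<rho>) b" for b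
    unfolding m[symmetric] measure_pmf_single[symmetric] measure_map_pmf
    by (rule arg_cong[where f = "measure_pmf.prob _"]) auto
  from this[of True] this[of False] show "measure_pmf.prob (tx_activity_pmf \<rho> \<rho>\<^sub>f) {x. fst x} = \<rho>"
    "measure_pmf.prob (tx_activity_pmf \<rho> \<rho>\<^sub>f) {x. \<not> fst x} = 1 - \<rho>"
    using assms by simp_all
  show p: "pmf (tx_activity_pmf \<rho> \<rho>\<^sub>f) (True, True) = \<rho> * \<rho>\<^sub>f"
    using assms by (simp add: tx_activity_pmf_def pmf_bind)
  have "{x. fst x \<and> snd x} = {(True, True)}" by auto
  then show "measure_pmf.prob (tx_activity_pmf \<rho> \<rho>\<^sub>f) {x. fst x \<and> snd x} = \<rho> * \<rho>\<^sub>f"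
    using p by (simp add: measure_pmf_single)
qed

lemma prob_activity:
  assumes J: "J \<subseteq> {1..K}"
  shows "measure_pmf.prob (activity_pmf \<rho> \<rho>\<^sub>f K) {s. \<forall>i\<in>J. s i \<in> B i}
    = (\<Prod>i\<in>J. measure_pmf.prob (tx_activity_pmf \<rho> \<rho>\<^sub>f) (B i))"
proof -
  let ?B = "\<lambda>i. if i \<in> J then B i else UNIV"
  have "{s. \<forall>i\<in>J. s i \<in> B i} = Pi {1..K} ?B" using J by (auto simp: Pi_def)
  then have "measure_pmf.prob (activity_pmf \<rho> \<rho>\<^sub>f K) {s. \<forall>i\<in>J. s i \<in> B i}
      = (\<Prod>i\<in>{1..K}. measure_pmf.prob (tx_activity_pmf \<rho> \<rho>\<^sub>f) (?B i))"
    unfolding activity_pmf_def by (simp add: measure_Pi_pmf_Pi)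
  also have "\<dots> = (\<Prod>i\<in>J. measure_pmf.prob (tx_activity_pmf \<rho> \<rho>\<^sub>f) (B i))"
    by (rule prod.mono_neutral_cong_right) (use J in auto)
  finally show ?thesis .
qed

context
  fixes \<rho> \<rho>\<^sub>f :: real and K :: nat
  assumes \<rho>: "0 \<le> \<rho>" "\<rho> \<le> 1" and \<rho>\<^sub>f: "0 \<le> \<rho>\<^sub>f" "\<rho>\<^sub>f \<le> 1"
begin

abbreviation activity_prob :: "(activity \<Rightarrow> bool) \<Rightarrow> real" where
  "activity_prob Q \<equiv> measure_pmf.prob (activity_pmf \<rho> \<rho>\<^sub>f K) {s. Q s}"
abbreviation activity_mean :: "(activity \<Rightarrow> real) \<Rightarrow> real" where
  "activity_mean f \<equiv> measure_pmf.expectation (activity_pmf \<rho> \<rho>\<^sub>f K) f"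

lemma prob_active: "k \<in> {1..K} \<Longrightarrow> activity_prob (\<lambda>s. k \<in> active_set K s) = \<rho>"
  using prob_activity[of "{k}" K \<rho> \<rho>\<^sub>f "\<lambda>_. {x. fst x}"] tx_activity_probs[OF \<rho> \<rho>\<^sub>f]
  by (simp add: active_set_def)

lemma prob_urllc: "k \<in> {1..K} \<Longrightarrow> activity_prob (\<lambda>s. k \<in> urllc_set K s) = \<rho> * \<rho>\<^sub>f"
  using prob_activity[of "{k}" K \<rho> \<rho>\<^sub>f "\<lambda>_. {x. fst x \<and> snd x}"] tx_activity_probs[OF \<rho> \<rho>\<^sub>f]
  by (simp add: urllc_set_def)

lemma prob_urllc_active:
  assumes "1 \<le> k" "k < K"
  shows "activity_prob (\<lambda>s. k \<in> urllc_set K s \<and> k + 1 \<in> active_set K s) = \<rho> * (\<rho> * \<rho>\<^sub>f)"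
  using prob_activity[of "{k, k + 1}" K \<rho> \<rho>\<^sub>f "\<lambda>i. if i = k then {x. fst x \<and> snd x} else {x. fst x}"]
    tx_activity_probs[OF \<rho> \<rho>\<^sub>f] assms
  by (simp add: urllc_set_def active_set_def mult.commute)

text \<open>Because r < k, the inactive user in front of the run lies in the network. A lower
  estimate is enough, since block ends enter the sum bound with a negative sign.\<close>

lemma prob_runlen:
  assumes "r < k" "k \<le> K"
  shows "(1 - \<rho>) * \<rho> ^ r \<le> activity_prob (\<lambda>s. runlen s k = r)"
proof -
  let ?B = "\<lambda>i. if i = k - r then {x. \<not> fst x} else {x :: bool \<times> bool. fst x}"
  have split: "{k - r..k} = insert (k - r) {k - r + 1..k}" using assms by auto
  have "(1 - \<rho>) * \<rho> ^ r = (\<Prod>i\<in>{k - r..k}. measure_pmf.prob (tx_activity_pmf \<rho> \<rho>\<^sub>f) (?B i))"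
    unfolding split using assms tx_activity_probs[OF \<rho> \<rho>\<^sub>f] by simp
  also have "\<dots> = activity_prob (\<lambda>s. \<forall>i\<in>{k - r..k}. s i \<in> ?B i)"
    by (rule prob_activity[symmetric]) (use assms in auto)
  also have "\<dots> \<le> activity_prob (\<lambda>s. runlen s k = r)"
  proof (rule measure_pmf.finite_measure_mono)
    show "{s. \<forall>i\<in>{k - r..k}. s i \<in> ?B i} \<subseteq> {s. runlen s k = r}"
    proof (rule subsetI, rule CollectI)
      fix s assume "s \<in> {s. \<forall>i\<in>{k - r..k}. s i \<in> ?B i}"
      then have s: "s i \<in> ?B i" if "k - r \<le> i" "i \<le> k" for i using that by auto
      show "runlen s k = r"
      proof (rule runlen_eqI)
        show "fst (s i)" if "k < i + r" "i \<le> k" for i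
        proof -
          have "k - r < i" using that assms by linarith
          then show ?thesis using s[of i] that by auto
        qed
        show "\<not> fst (s (k - r))" using s[of "k - r"] by auto
      qed (use assms in auto)
    qed
  qed simp
  finally show ?thesis .
qed

lemma integrable_activity: "integrable (activity_pmf \<rho> \<rho>\<^sub>f K) (f :: _ \<Rightarrow> real)"
  by (rule integrable_measure_pmf_finite[OF finite_set_activity_pmf])

lemma mean_mono:
  assumes "\<And>s. s \<in> set_pmf (activity_pmf \<rho> \<rho>\<^sub>f K) \<Longrightarrow> f s \<le> f' s"
  shows "activity_mean f \<le> activity_mean f'"
  by (rule integral_mono_AE[OF integrable_activity integrable_activity])
    (use assms in \<open>simp add: AE_measure_pmf_iff\<close>)

lemma mean_count:
  "activity_mean (\<lambda>s. \<Sum>k\<in>A. of_bool (Q k s)) = (\<Sum>k\<in>A. activity_prob (Q k))"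
proof -
  have "activity_mean (\<lambda>s. of_bool (Q k s)) = activity_prob (Q k)" for k
  proof -
    have "activity_mean (\<lambda>s. of_bool (Q k s)) = activity_mean (indicator {s. Q k s})"
      by (rule Bochner_Integration.integral_cong) (auto simp: indicator_def)
    then show ?thesis by simp
  qed
  then show ?thesis by (simp add: Bochner_Integration.integral_sum integrable_activity)
qed

context
  fixes D :: nat and RU RE_avg g :: real and RE :: "activity \<Rightarrow> nat \<Rightarrow> real"
  assumes K: "2 \<le> K" and g: "0 \<le> g" and RE: "\<And>s k. 0 \<le> RE s k"
    and avg: "RE_avg \<le> activity_mean (\<lambda>s. (1 / real K) * (\<Sum>k\<in>active_set K s. RE s k))"
    and lb: "\<And>s. s \<in> set_pmf (activity_pmf \<rho> \<rho>\<^sub>f K) \<Longrightarrow> local_bounds D K s RU (user_rate K s RU (RE s)) g"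
begin

lemma total_rate:
  "(\<Sum>k = 1..K. user_rate K s RU (RE s) k)
    = (\<Sum>k\<in>active_set K s. RE s k) + RU * (\<Sum>k = 1..K. of_bool (k \<in> urllc_set K s))"
proof -
  have "(\<Sum>k = 1..K. if k \<in> active_set K s then RE s k else 0) = (\<Sum>k\<in>active_set K s. RE s k)"
    by (rule sum.mono_neutral_cong_right) (auto simp: active_set_def)
  moreover have "(\<Sum>k = 1..K. if k \<in> urllc_set K s then RU else 0) = RU * (\<Sum>k = 1..K. of_bool (k \<in> urllc_set K s))"
    unfolding sum_distrib_left by (rule sum.cong) auto
  ultimately show ?thesis by (simp add: user_rate_def sum.distrib)
qed

lemma avg_le: "real K * RE_avg \<le> activity_mean (\<lambda>s. \<Sum>k\<in>active_set K s. RE s k)"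
  using avg K by (simp add: field_simps)

text \<open>The number \<open>J\<close> truncates the series: only runs of at most J blocks are
  counted, and only at users beyond J (D + 2), where such a run and the inactive user before it fit
  into the network. Discarding the other block ends becomes harmless once \<open>K\<close> and then
  \<open>J\<close> grow.\<close>

lemma expected_sum_rate:
  assumes J: "J * (D + 2) \<le> K"
  shows "real K * RE_avg + real K * (\<rho> * \<rho>\<^sub>f * RU)
    \<le> (real K * \<rho> - real (K - J * (D + 2)) * (\<Sum>j = 1..J. (1 - \<rho>) * \<rho> ^ (j * (D + 2)))) * g"
proof -
  let ?F = "\<lambda>s. \<Sum>k\<in>active_set K s. RE s k" and ?U = "\<lambda>s. \<Sum>k = 1..K. of_bool (k \<in> urllc_set K s) :: real"
    and ?A = "\<lambda>s. \<Sum>k = 1..K. of_bool (k \<in> active_set K s) :: real"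
    and ?E = "\<lambda>s. \<Sum>k\<in>{J * (D + 2) + 1..K}. \<Sum>j = 1..J. of_bool (runlen s k = j * (D + 2)) :: real"
  have pt: "?F s + RU * ?U s \<le> (?A s - ?E s) * g" if s: "s \<in> set_pmf (activity_pmf \<rho> \<rho>\<^sub>f K)" for s
  proof -
    have "?F s + RU * ?U s \<le> (\<Sum>i = 1..K. of_bool (fst (s i)) - of_bool (block_end D s i)) * g"
      unfolding total_rate[symmetric]
      by (rule sum_rates_le[OF lb[OF s] g]) (auto simp: user_rate_def active_set_def urllc_set_def)
    also have "\<dots> \<le> (?A s - ?E s) * g"
    proof (rule mult_right_mono[OF _ g])
      \<comment> \<open>At most one j matches the run length at k, so no block end is counted
        twice.\<close>
      have "?E s \<le> (\<Sum>k\<in>{J * (D + 2) + 1..K}. of_bool (block_end D s k))"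
      proof (rule sum_mono)
        fix k
        have "(\<Sum>j = 1..J. of_bool (runlen s k = j * (D + 2)) :: real)
            = real (card {j \<in> {1..J}. runlen s k = j * (D + 2)})"
          by (simp add: of_bool_def sum.If_cases Int_def)
        also have "\<dots> \<le> of_bool (block_end D s k)"
        proof (cases "\<exists>j\<in>{1..J}. runlen s k = j * (D + 2)")
          case True
          then obtain j where j: "j \<in> {1..J}" "runlen s k = j * (D + 2)" by auto
          have sub: "{j \<in> {1..J}. runlen s k = j * (D + 2)} \<subseteq> {j}"
          proof (rule subsetI)
            fix j' assume "j' \<in> {j \<in> {1..J}. runlen s k = j * (D + 2)}"
            then have "j' * (D + 2) = j * (D + 2)" using j(2) by simp
            then show "j' \<in> {j}" by (simp only: mult_cancel2) simp
          qed
          have "card {j \<in> {1..J}. runlen s k = j * (D + 2)} \<le> card {j}"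
            by (rule card_mono[OF _ sub]) simp
          moreover have "block_end D s k"
            unfolding block_end_def j(2) using j(1) by (intro conjI dvd_triv_right) simp
          ultimately show ?thesis by simp
        next
          case False
          then have "{j \<in> {1..J}. runlen s k = j * (D + 2)} = {}" by blast
          then show ?thesis by (simp only: card.empty of_nat_0) simp
        qed
        finally show "(\<Sum>j = 1..J. of_bool (runlen s k = j * (D + 2)) :: real) \<le> of_bool (block_end D s k)" .
      qed
      also have "\<dots> \<le> (\<Sum>k = 1..K. of_bool (block_end D s k))"
        by (rule sum_mono2) auto
      finally have "?E s \<le> (\<Sum>k = 1..K. of_bool (block_end D s k))" .
      moreover have "(\<Sum>k = 1..K. of_bool (fst (s k))) = ?A s"
        by (rule sum.cong) (auto simp: active_set_def)
      ultimately show "(\<Sum>i = 1..K. of_bool (fst (s i)) - of_bool (block_end D s i)) \<le> ?A s - ?E s"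
        by (simp add: sum_subtractf)
    qed
    finally show ?thesis .
  qed
  have U: "activity_mean ?U = real K * (\<rho> * \<rho>\<^sub>f)"
    unfolding mean_count using prob_urllc by simp
  have A: "activity_mean ?A = real K * \<rho>"
    unfolding mean_count using prob_active by simp
  have E: "real (K - J * (D + 2)) * (\<Sum>j = 1..J. (1 - \<rho>) * \<rho> ^ (j * (D + 2))) \<le> activity_mean ?E"
  proof -
    have "real (K - J * (D + 2)) * (\<Sum>j = 1..J. (1 - \<rho>) * \<rho> ^ (j * (D + 2)))
        = (\<Sum>k\<in>{J * (D + 2) + 1..K}. \<Sum>j = 1..J. (1 - \<rho>) * \<rho> ^ (j * (D + 2)))" by simp
    also have "\<dots> \<le> (\<Sum>k\<in>{J * (D + 2) + 1..K}. \<Sum>j = 1..J. activity_prob (\<lambda>s. runlen s k = j * (D + 2)))"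
    proof (intro sum_mono prob_runlen)
      fix k j assume "k \<in> {J * (D + 2) + 1..K}" "j \<in> {1..J}"
      moreover from this have "j * (D + 2) \<le> J * (D + 2)" by (intro mult_le_mono1) auto
      ultimately show "j * (D + 2) < k" "k \<le> K" by (auto simp del: mult_le_cancel2)
    qed
    also have "\<dots> = (\<Sum>k\<in>{J * (D + 2) + 1..K}. activity_mean (\<lambda>s. \<Sum>j = 1..J. of_bool (runlen s k = j * (D + 2))))"
      unfolding mean_count by (rule refl)
    also have "\<dots> = activity_mean ?E"
      by (rule Bochner_Integration.integral_sum[symmetric]) (rule integrable_activity)
    finally show ?thesis .
  qed
  have "activity_mean ?F + RU * activity_mean ?U = activity_mean (\<lambda>s. ?F s + RU * ?U s)"
    by (simp only: Bochner_Integration.integral_add[OF integrable_activity integrable_activity]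
        integral_mult_right_zero)
  also have "\<dots> \<le> activity_mean (\<lambda>s. (?A s - ?E s) * g)" by (rule mean_mono[OF pt])
  also have "\<dots> = (activity_mean ?A - activity_mean ?E) * g"
    by (simp only: Bochner_Integration.integral_diff[OF integrable_activity integrable_activity]
        integral_mult_left_zero)
  also have "\<dots> \<le> (real K * \<rho> - real (K - J * (D + 2)) * (\<Sum>j = 1..J. (1 - \<rho>) * \<rho> ^ (j * (D + 2)))) * g"
    using E A by (intro mult_right_mono[OF _ g]) linarith
  finally show ?thesis using avg_le U by (simp add: algebra_simps)
qed

lemma expected_weighted_rate:
  "real K * RE_avg + real K * (\<rho> * \<rho>\<^sub>f * RU) + real (K - 1) * (\<rho> * (\<rho> * \<rho>\<^sub>f) * RU) \<le> real K * \<rho> * g"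
proof -
  let ?F = "\<lambda>s. \<Sum>k\<in>active_set K s. RE s k" and ?U = "\<lambda>s. \<Sum>k = 1..K. of_bool (k \<in> urllc_set K s) :: real"
    and ?A = "\<lambda>s. \<Sum>k = 1..K. of_bool (k \<in> active_set K s) :: real"
    and ?N = "\<lambda>s. \<Sum>k\<in>{1..<K}. of_bool (k \<in> urllc_set K s \<and> k + 1 \<in> active_set K s) :: real"
  have pt: "?F s + RU * ?U s + RU * ?N s \<le> ?A s * g" if s: "s \<in> set_pmf (activity_pmf \<rho> \<rho>\<^sub>f K)" for s
  proof -
    let ?L = "user_rate K s RU (RE s)"
    have split: "{1..K} = insert 1 (Suc ` {1..<K})" using K by (auto simp: image_Suc_atLeastLessThan)
    have sum_split: "(\<Sum>k = 1..K. f k) = f 1 + (\<Sum>k\<in>{1..<K}. f (k + 1))" for f :: "nat \<Rightarrow> real"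
      unfolding split by (subst sum.insert) (auto simp: sum.reindex simp del: image_Suc_atLeastLessThan)
    have one: "?L k \<le> of_bool (k \<in> active_set K s) * g" for k
      using lb[OF s] by (auto simp: local_bounds_def user_rate_def active_set_def urllc_set_def)
    have two: "?L (k + 1) + RU * of_bool (k \<in> urllc_set K s \<and> k + 1 \<in> active_set K s)
        \<le> of_bool (k + 1 \<in> active_set K s) * g" for k
    proof (cases "k \<in> urllc_set K s \<and> k + 1 \<in> active_set K s")
      case True
      then show ?thesis using lb[OF s] by (auto simp: local_bounds_def)
    next
      case False
      then show ?thesis using one[of "k + 1"] by auto
    qed
    have "?F s + RU * ?U s + RU * ?N s = ?L 1 + (\<Sum>k\<in>{1..<K}. ?L (k + 1)
        + RU * of_bool (k \<in> urllc_set K s \<and> k + 1 \<in> active_set K s))"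
      unfolding total_rate[symmetric] sum_split[of ?L] by (simp add: sum.distrib sum_distrib_left)
    also have "\<dots> \<le> of_bool (1 \<in> active_set K s) * g + (\<Sum>k\<in>{1..<K}. of_bool (k + 1 \<in> active_set K s) * g)"
      by (intro add_mono one sum_mono two)
    also have "\<dots> = ?A s * g"
      unfolding sum_split[of "\<lambda>k. of_bool (k \<in> active_set K s)"] by (simp add: sum_distrib_right distrib_right)
    finally show ?thesis .
  qed
  have U: "activity_mean ?U = real K * (\<rho> * \<rho>\<^sub>f)"
    unfolding mean_count using prob_urllc by simp
  have A: "activity_mean ?A = real K * \<rho>"
    unfolding mean_count using prob_active by simp
  have N: "activity_mean ?N = real (K - 1) * (\<rho> * (\<rho> * \<rho>\<^sub>f))"
    unfolding mean_count using prob_urllc_active by simp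
  have "activity_mean ?F + RU * activity_mean ?U + RU * activity_mean ?N
      = activity_mean (\<lambda>s. ?F s + RU * ?U s + RU * ?N s)"
    by (simp only: Bochner_Integration.integral_add[OF integrable_activity integrable_activity]
        integral_mult_right_zero)
  also have "\<dots> \<le> activity_mean (\<lambda>s. ?A s * g)" by (rule mean_mono[OF pt])
  also have "\<dots> = activity_mean ?A * g" by (rule integral_mult_left_zero)
  finally show ?thesis unfolding U A N using avg_le by (simp add: algebra_simps)
qed

text \<open>Since \<open>RU\<close> is the same for all patterns, a single pattern of positive
  probability suffices: with every user active and carrying a URLLC message, the neighbour
  inequality for users 1 and 2 contains \<open>RU\<close> twice.\<close>

lemma urllc_rate_le:
  assumes "0 < \<rho>" "0 < \<rho>\<^sub>f"
  shows "2 * RU \<le> g"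
proof -
  define s :: activity where "s k = (if k \<in> {1..K} then (True, True) else (False, False))" for k
  have "pmf (activity_pmf \<rho> \<rho>\<^sub>f K) s = (\<rho> * \<rho>\<^sub>f) ^ K"
    unfolding activity_pmf_def using tx_activity_probs(4)[OF \<rho> \<rho>\<^sub>f] by (subst pmf_Pi') (auto simp: s_def)
  then have "s \<in> set_pmf (activity_pmf \<rho> \<rho>\<^sub>f K)" using assms by (simp add: set_pmf_iff)
  then have "local_bounds D K s RU (user_rate K s RU (RE s)) g" by (rule lb)
  moreover have u: "1 \<in> urllc_set K s" "1 + 1 \<in> active_set K s" "1 + 1 \<in> urllc_set K s"
    using K by (auto simp: s_def urllc_set_def active_set_def)
  ultimately have "RU + user_rate K s RU (RE s) (1 + 1) \<le> g"
    unfolding local_bounds_def by blast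
  then show ?thesis using u RE[of s "1 + 1"] by (simp add: user_rate_def)
qed

end

end

section \<open>Multiplexing gains\<close>

text \<open>The simultaneity clause of \<open>achievable_MG\<close> supplies one pair K, P at which
  both normalised rates are within \<epsilon> of their gains. A linear bound valid for all large K
  and P therefore passes to the gains without any calculus of upper limits.\<close>

lemma MG_limit:
  assumes ach: "achievable_MG \<rho> \<rho>\<^sub>f h D SU SE" and nonneg: "0 \<le> \<alpha>" "0 \<le> \<beta>"
    and bound: "\<And>\<epsilon>. 0 < \<epsilon> \<Longrightarrow> \<forall>\<^sub>F K in sequentially. \<forall>\<^sub>F P in at_top. \<forall>RU RE_avg.
      achievable_rates \<rho> \<rho>\<^sub>f h D K P RU RE_avg \<longrightarrow>
      \<alpha> * (\<rho> * \<rho>\<^sub>f * RU) + \<beta> * RE_avg \<le> (B + \<epsilon>) * (log 2 P / 2)"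
  shows "\<alpha> * SU + \<beta> * SE \<le> B"
proof (rule field_le_epsilon)
  fix e :: real assume e: "0 < e"
  define \<epsilon> where "\<epsilon> = e / (1 + \<alpha> + \<beta>)"
  have \<epsilon>: "0 < \<epsilon>" using e nonneg by (simp add: \<epsilon>_def)
  obtain RU :: "nat \<Rightarrow> real \<Rightarrow> real" and RE_avg where
    rates: "\<And>K P. 1 \<le> K \<Longrightarrow> 0 < P \<Longrightarrow> achievable_rates \<rho> \<rho>\<^sub>f h D K P (RU K P) (RE_avg K P)"
    and freq: "\<And>\<epsilon>. 0 < \<epsilon> \<Longrightarrow> \<exists>\<^sub>F K in sequentially. \<exists>\<^sub>F P in at_top.
           SU - \<epsilon> < \<rho> * \<rho>\<^sub>f * (RU K P / (1 / 2 * log 2 P)) \<and>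
           SE - \<epsilon> < RE_avg K P / (1 / 2 * log 2 P)"
    using ach unfolding achievable_MG_def by blast
  have "\<forall>\<^sub>F K in sequentially. 1 \<le> K \<and> (\<forall>\<^sub>F P in at_top. \<forall>RU RE_avg.
      achievable_rates \<rho> \<rho>\<^sub>f h D K P RU RE_avg \<longrightarrow>
      \<alpha> * (\<rho> * \<rho>\<^sub>f * RU) + \<beta> * RE_avg \<le> (B + \<epsilon>) * (log 2 P / 2))"
    by (intro eventually_conj eventually_ge_at_top bound \<epsilon>)
  from frequently_ex[OF frequently_eventually_frequently[OF freq[OF \<epsilon>] this]]
  obtain K where K: "1 \<le> K" and fP: "\<exists>\<^sub>F P in at_top.
           SU - \<epsilon> < \<rho> * \<rho>\<^sub>f * (RU K P / (1 / 2 * log 2 P)) \<and> SE - \<epsilon> < RE_avg K P / (1 / 2 * log 2 P)"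
    and eP: "\<forall>\<^sub>F P in at_top. \<forall>RU RE_avg. achievable_rates \<rho> \<rho>\<^sub>f h D K P RU RE_avg \<longrightarrow>
      \<alpha> * (\<rho> * \<rho>\<^sub>f * RU) + \<beta> * RE_avg \<le> (B + \<epsilon>) * (log 2 P / 2)" by blast
  have "\<forall>\<^sub>F P in at_top. (2::real) \<le> P \<and> (\<forall>RU RE_avg. achievable_rates \<rho> \<rho>\<^sub>f h D K P RU RE_avg \<longrightarrow>
      \<alpha> * (\<rho> * \<rho>\<^sub>f * RU) + \<beta> * RE_avg \<le> (B + \<epsilon>) * (log 2 P / 2))"
    by (intro eventually_conj eventually_ge_at_top eP)
  from frequently_ex[OF frequently_eventually_frequently[OF fP this]]
  obtain P where P: "2 \<le> P" and SU: "SU - \<epsilon> < \<rho> * \<rho>\<^sub>f * (RU K P / (1 / 2 * log 2 P))"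
    and SE: "SE - \<epsilon> < RE_avg K P / (1 / 2 * log 2 P)"
    and le: "achievable_rates \<rho> \<rho>\<^sub>f h D K P (RU K P) (RE_avg K P) \<Longrightarrow>
      \<alpha> * (\<rho> * \<rho>\<^sub>f * RU K P) + \<beta> * RE_avg K P \<le> (B + \<epsilon>) * (log 2 P / 2)" by blast
  define l where "l = log 2 P / 2"
  have l: "0 < l" using P by (simp add: l_def)
  have le': "\<alpha> * (\<rho> * \<rho>\<^sub>f * RU K P) + \<beta> * RE_avg K P \<le> (B + \<epsilon>) * l"
    unfolding l_def by (rule le[OF rates[OF K]]) (use P in simp)
  have "SU - \<epsilon> \<le> \<rho> * \<rho>\<^sub>f * RU K P / l" "SE - \<epsilon> \<le> RE_avg K P / l"
    using SU SE by (simp_all add: l_def)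
  then have "\<alpha> * (SU - \<epsilon>) + \<beta> * (SE - \<epsilon>) \<le> \<alpha> * (\<rho> * \<rho>\<^sub>f * RU K P / l) + \<beta> * (RE_avg K P / l)"
    using nonneg by (intro add_mono mult_left_mono)
  also have "\<dots> = (\<alpha> * (\<rho> * \<rho>\<^sub>f * RU K P) + \<beta> * RE_avg K P) / l"
    by (simp add: add_divide_distrib)
  also have "\<dots> \<le> B + \<epsilon>" using le' l by (simp add: pos_divide_le_eq)
  finally have "\<alpha> * SU + \<beta> * SE \<le> B + \<epsilon> * (1 + \<alpha> + \<beta>)" by (simp add: algebra_simps)
  also have "\<epsilon> * (1 + \<alpha> + \<beta>) = e" using nonneg by (simp add: \<epsilon>_def)
  finally show "\<alpha> * SU + \<beta> * SE \<le> B + e" .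
qed

lemma eventually_log_dominates:
  assumes "0 < \<delta>"
  shows "\<forall>\<^sub>F P in at_top. 1 \<le> P \<and> 0 < log 2 P / 2 \<and> C \<le> \<delta> * (log 2 P / 2)"
proof -
  let ?m = "max 1 (2 * C / \<delta>)"
  show ?thesis
    using eventually_ge_at_top[of "2 powr ?m"]
  proof eventually_elim
    case (elim P)
    have "1 \<le> 2 powr ?m" by (rule ge_one_powr_ge_zero) auto
    then have P: "1 \<le> P" using elim by linarith
    then have "?m \<le> log 2 P" using elim by (subst le_log_iff) auto
    then have "2 * C / \<delta> \<le> log 2 P" "1 \<le> log 2 P" by auto
    then show ?case using P assms by (simp add: field_simps)
  qed
qed

theorem theorem6:
  fixes \<rho> \<rho>\<^sub>f :: real and h :: "nat \<Rightarrow> nat \<Rightarrow> real" and D :: nat and SU SE :: real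
  assumes "0 < \<rho>" "\<rho> < 1" and "0 \<le> \<rho>\<^sub>f" "\<rho>\<^sub>f \<le> 1"
    and "even D" "0 < D"
    and "\<And>i k. 0 \<le> h i k"
    and "\<And>k. 1 \<le> k \<Longrightarrow> 0 < h k (k + 1) \<and> 0 < h (k + 1) k"
    and "achievable_MG \<rho> \<rho>\<^sub>f h D SU SE"
  shows "SU \<le> \<rho> * \<rho>\<^sub>f / 2 \<and>
         SE + SU \<le> \<rho> - (1 - \<rho>) * \<rho> ^ (D + 2) / (1 - \<rho> ^ (D + 2)) \<and>
         SE + (1 + \<rho>) * SU \<le> \<rho>"
proof -
  note \<rho> = assms(1,2) and \<rho>\<^sub>f = assms(3,4) and h = assms(7,8) and ach = assms(9)
  have \<rho>': "0 \<le> \<rho>" "\<rho> \<le> 1" using \<rho> by auto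
  define \<gamma> where "\<gamma> J = (\<Sum>j = 1..J. (1 - \<rho>) * \<rho> ^ (j * (D + 2)))" for J
  have \<gamma>_nonneg: "0 \<le> \<gamma> J" for J
    using \<rho> unfolding \<gamma>_def by (intro sum_nonneg) simp
  \<comment> \<open>For fixed \<open>K\<close> and large P the constant \<open>C\<close> disappears
    in the factor 1 + \<delta>; only the effects of the border and of the truncation remain.\<close>
  have main: "\<forall>\<^sub>F P in at_top. \<forall>RU RE_avg. achievable_rates \<rho> \<rho>\<^sub>f h D K P RU RE_avg \<longrightarrow>
      \<rho> * \<rho>\<^sub>f * RU \<le> \<rho> * \<rho>\<^sub>f / 2 * ((1 + \<delta>) * (log 2 P / 2)) \<and>
      real K * RE_avg + real K * (\<rho> * \<rho>\<^sub>f * RU) + real (K - 1) * (\<rho> * (\<rho> * \<rho>\<^sub>f) * RU)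
        \<le> real K * \<rho> * ((1 + \<delta>) * (log 2 P / 2)) \<and>
      (\<forall>J. J * (D + 2) \<le> K \<longrightarrow> real K * RE_avg + real K * (\<rho> * \<rho>\<^sub>f * RU)
        \<le> (real K * \<rho> - real (K - J * (D + 2)) * \<gamma> J) * ((1 + \<delta>) * (log 2 P / 2)))"
    if K: "2 \<le> K" and \<delta>: "0 < \<delta>" for K \<delta>
  proof -
    obtain C where C: "0 \<le> C"
      and loc: "\<And>\<rho> \<rho>\<^sub>f P RU RE_avg. 1 \<le> P \<Longrightarrow> achievable_rates \<rho> \<rho>\<^sub>f h D K P RU RE_avg \<Longrightarrow>
      \<exists>RE. (\<forall>s k. 0 \<le> RE s k) \<and>
        RE_avg \<le> measure_pmf.expectation (activity_pmf \<rho> \<rho>\<^sub>f K)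
                   (\<lambda>s. (1 / real K) * (\<Sum>k\<in>active_set K s. RE s k)) \<and>
        (\<forall>s\<in>set_pmf (activity_pmf \<rho> \<rho>\<^sub>f K).
          local_bounds D K s RU (user_rate K s RU (RE s)) (log 2 P / 2 + C))"
      using local_bounds_of_achievable[of K h D, OF K h] by blast
    show ?thesis
      using eventually_log_dominates[OF \<delta>, of C]
    proof eventually_elim
      case (elim P)
      let ?g = "(1 + \<delta>) * (log 2 P / 2)"
      have g: "0 \<le> ?g" using elim \<delta> by simp
      have gC: "log 2 P / 2 + C \<le> ?g" using elim by (simp add: algebra_simps)
      show ?case
      proof (intro allI impI)
        fix RU RE_avg assume r: "achievable_rates \<rho> \<rho>\<^sub>f h D K P RU RE_avg"
        obtain RE where RE: "\<And>s k. 0 \<le> RE s k"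
          and avg: "RE_avg \<le> measure_pmf.expectation (activity_pmf \<rho> \<rho>\<^sub>f K)
                   (\<lambda>s. (1 / real K) * (\<Sum>k\<in>active_set K s. RE s k))"
          and lb0: "\<And>s. s \<in> set_pmf (activity_pmf \<rho> \<rho>\<^sub>f K) \<Longrightarrow>
            local_bounds D K s RU (user_rate K s RU (RE s)) (log 2 P / 2 + C)"
          using loc[OF _ r] elim by blast
        have lb: "local_bounds D K s RU (user_rate K s RU (RE s)) ?g"
          if "s \<in> set_pmf (activity_pmf \<rho> \<rho>\<^sub>f K)" for s
          by (rule local_bounds_mono[OF lb0[OF that] gC])
        \<comment> \<open>If \<open>\<rho>\<^sub>f\<close> is 0, no URLLC message ever occurs and
          \<open>RU\<close> is unconstrained, yet both sides vanish.\<close>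
        have one: "\<rho> * \<rho>\<^sub>f * RU \<le> \<rho> * \<rho>\<^sub>f / 2 * ?g"
        proof (cases "\<rho>\<^sub>f = 0")
          case False
          have "2 * RU \<le> ?g"
            by (rule urllc_rate_le[where RE = RE, OF \<rho>' \<rho>\<^sub>f K g RE avg lb]) (use False \<rho> \<rho>\<^sub>f in auto)
          then have "\<rho> * \<rho>\<^sub>f / 2 * (2 * RU) \<le> \<rho> * \<rho>\<^sub>f / 2 * ?g"
            using \<rho> \<rho>\<^sub>f by (intro mult_left_mono) auto
          then show ?thesis by simp
        qed simp
        show "\<rho> * \<rho>\<^sub>f * RU \<le> \<rho> * \<rho>\<^sub>f / 2 * ?g \<and>
          real K * RE_avg + real K * (\<rho> * \<rho>\<^sub>f * RU) + real (K - 1) * (\<rho> * (\<rho> * \<rho>\<^sub>f) * RU)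
            \<le> real K * \<rho> * ?g \<and>
          (\<forall>J. J * (D + 2) \<le> K \<longrightarrow> real K * RE_avg + real K * (\<rho> * \<rho>\<^sub>f * RU)
            \<le> (real K * \<rho> - real (K - J * (D + 2)) * \<gamma> J) * ?g)"
          unfolding \<gamma>_def
          using one expected_weighted_rate[where RE = RE, OF \<rho>' \<rho>\<^sub>f K g RE avg lb]
            expected_sum_rate[where RE = RE, OF \<rho>' \<rho>\<^sub>f K g RE avg lb] by blast
      qed
    qed
  qed
  have first: "1 * SU + 0 * SE \<le> \<rho> * \<rho>\<^sub>f / 2"
  proof (rule MG_limit[OF ach])
    fix \<epsilon> :: real assume \<epsilon>: "0 < \<epsilon>"
    show "\<forall>\<^sub>F K in sequentially. \<forall>\<^sub>F P in at_top. \<forall>RU RE_avg. achievable_rates \<rho> \<rho>\<^sub>f h D K P RU RE_avg \<longrightarrow>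
      1 * (\<rho> * \<rho>\<^sub>f * RU) + 0 * RE_avg \<le> (\<rho> * \<rho>\<^sub>f / 2 + \<epsilon>) * (log 2 P / 2)"
      using eventually_ge_at_top[of 2]
    proof eventually_elim
      case (elim K)
      show ?case using main[OF elim \<epsilon>] eventually_log_dominates[OF \<epsilon>, of 0]
      proof eventually_elim
        case (elim P)
        have "\<rho> * \<rho>\<^sub>f \<le> 1 * 1" using \<rho> \<rho>\<^sub>f by (intro mult_mono) auto
        then have "\<rho> * \<rho>\<^sub>f / 2 * \<epsilon> \<le> 1 * \<epsilon>" using \<epsilon> by (intro mult_right_mono) auto
        then have "\<rho> * \<rho>\<^sub>f / 2 * (1 + \<epsilon>) * (log 2 P / 2) \<le> (\<rho> * \<rho>\<^sub>f / 2 + \<epsilon>) * (log 2 P / 2)"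
          using elim by (intro mult_right_mono) (auto simp: algebra_simps)
        then have *: "\<rho> * \<rho>\<^sub>f / 2 * ((1 + \<epsilon>) * (log 2 P / 2)) \<le> (\<rho> * \<rho>\<^sub>f / 2 + \<epsilon>) * (log 2 P / 2)"
          by (simp only: mult.assoc)
        show ?case
        proof (intro allI impI)
          fix RU RE_avg assume "achievable_rates \<rho> \<rho>\<^sub>f h D K P RU RE_avg"
          then have "\<rho> * \<rho>\<^sub>f * RU \<le> \<rho> * \<rho>\<^sub>f / 2 * ((1 + \<epsilon>) * (log 2 P / 2))" using elim by blast
          then show "1 * (\<rho> * \<rho>\<^sub>f * RU) + 0 * RE_avg \<le> (\<rho> * \<rho>\<^sub>f / 2 + \<epsilon>) * (log 2 P / 2)"
            using * by simp
        qed
      qed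
    qed
  qed auto
  have second: "1 * SU + 1 * SE \<le> \<rho> - \<gamma> J" for J
  proof (rule MG_limit[OF ach])
    fix \<epsilon> :: real assume \<epsilon>: "0 < \<epsilon>"
    \<comment> \<open>One half of \<epsilon> pays for the J (D + 2) users at the left border, the
      other half for the factor 1 + \<delta>.\<close>
    define \<delta> where "\<delta> = \<epsilon> / 2"
    have \<delta>: "0 < \<delta>" using \<epsilon> by (simp add: \<delta>_def)
    show "\<forall>\<^sub>F K in sequentially. \<forall>\<^sub>F P in at_top. \<forall>RU RE_avg. achievable_rates \<rho> \<rho>\<^sub>f h D K P RU RE_avg \<longrightarrow>
      1 * (\<rho> * \<rho>\<^sub>f * RU) + 1 * RE_avg \<le> (\<rho> - \<gamma> J + \<epsilon>) * (log 2 P / 2)"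
      using eventually_ge_at_top[of "max 2 (max (J * (D + 2)) (nat \<lceil>real (J * (D + 2)) * \<gamma> J / \<delta>\<rceil>))"]
    proof eventually_elim
      case (elim K)
      then have K: "2 \<le> K" "J * (D + 2) \<le> K" "nat \<lceil>real (J * (D + 2)) * \<gamma> J / \<delta>\<rceil> \<le> K" by auto
      have "real (J * (D + 2)) * \<gamma> J / \<delta> \<le> real K" using K(3) by linarith
      then have small: "real (J * (D + 2)) * \<gamma> J \<le> \<delta> * real K" using \<delta> by (simp add: field_simps)
      show ?case using main[OF K(1) \<delta>] eventually_log_dominates[OF \<delta>, of 0]
      proof eventually_elim
        case (elim P)
        show ?case
        proof (intro allI impI)
          fix RU RE_avg assume "achievable_rates \<rho> \<rho>\<^sub>f h D K P RU RE_avg"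
          then have le: "real K * RE_avg + real K * (\<rho> * \<rho>\<^sub>f * RU)
            \<le> (real K * \<rho> - real (K - J * (D + 2)) * \<gamma> J) * ((1 + \<delta>) * (log 2 P / 2))"
            using elim K(2) by blast
          have w: "real K * \<rho> - real (K - J * (D + 2)) * \<gamma> J \<le> real K * (\<rho> - \<gamma> J + \<delta>)"
            using small K(2) by (simp add: of_nat_diff algebra_simps)
          have "real K * \<rho> \<le> real K" using \<rho> by (simp add: mult_left_le)
          moreover have "0 \<le> real (K - J * (D + 2)) * \<gamma> J" using \<gamma>_nonneg by simp
          ultimately have "(real K * \<rho> - real (K - J * (D + 2)) * \<gamma> J) * \<delta> \<le> real K * \<delta>"
            using \<delta> by (intro mult_right_mono) auto
          then have "(real K * \<rho> - real (K - J * (D + 2)) * \<gamma> J) * (1 + \<delta>) \<le> real K * (\<rho> - \<gamma> J + \<epsilon>)"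
            using w by (simp add: \<delta>_def algebra_simps)
          then have "(real K * \<rho> - real (K - J * (D + 2)) * \<gamma> J) * (1 + \<delta>) * (log 2 P / 2)
              \<le> real K * (\<rho> - \<gamma> J + \<epsilon>) * (log 2 P / 2)"
            using elim by (intro mult_right_mono) auto
          moreover have "real K * (RE_avg + \<rho> * \<rho>\<^sub>f * RU) = real K * RE_avg + real K * (\<rho> * \<rho>\<^sub>f * RU)"
            by (rule distrib_left)
          ultimately have "real K * (RE_avg + \<rho> * \<rho>\<^sub>f * RU) \<le> real K * ((\<rho> - \<gamma> J + \<epsilon>) * (log 2 P / 2))"
            using le by (simp only: mult.assoc[of _ "1 + \<delta>"] mult.assoc[of "real K" "\<rho> - \<gamma> J + \<epsilon>"])
          then show "1 * (\<rho> * \<rho>\<^sub>f * RU) + 1 * RE_avg \<le> (\<rho> - \<gamma> J + \<epsilon>) * (log 2 P / 2)"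
            using K(1) by (simp add: mult_le_cancel_left_pos)
        qed
      qed
    qed
  qed auto
  have third: "(1 + \<rho>) * SU + 1 * SE \<le> \<rho>"
  proof (rule MG_limit[OF ach])
    fix \<epsilon> :: real assume \<epsilon>: "0 < \<epsilon>"
    \<comment> \<open>Expanding (\<rho> + \<delta>)(1 + \<delta>) leaves the errors \<delta>, \<rho>
      \<delta> and \<delta>^2, each at most \<delta> because \<rho> and \<delta> are at most
      1.\<close>
    define \<delta> where "\<delta> = min 1 (\<epsilon> / 3)"
    have \<delta>: "0 < \<delta>" "\<delta> \<le> 1" "3 * \<delta> \<le> \<epsilon>" using \<epsilon> by (auto simp: \<delta>_def min_def)
    show "\<forall>\<^sub>F K in sequentially. \<forall>\<^sub>F P in at_top. \<forall>RU RE_avg. achievable_rates \<rho> \<rho>\<^sub>f h D K P RU RE_avg \<longrightarrow>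
      (1 + \<rho>) * (\<rho> * \<rho>\<^sub>f * RU) + 1 * RE_avg \<le> (\<rho> + \<epsilon>) * (log 2 P / 2)"
      using eventually_ge_at_top[of "max 2 (nat \<lceil>1 / \<delta>\<rceil>)"]
    proof eventually_elim
      case (elim K)
      then have K: "2 \<le> K" "nat \<lceil>1 / \<delta>\<rceil> \<le> K" by auto
      have "1 / \<delta> \<le> real K" using K(2) by linarith
      then have small: "1 \<le> \<delta> * real K" using \<delta> by (simp add: field_simps)
      show ?case using main[OF K(1) \<delta>(1)] eventually_log_dominates[OF \<delta>(1), of 0]
      proof eventually_elim
        case (elim P)
        let ?g = "(1 + \<delta>) * (log 2 P / 2)"
        have g: "0 \<le> ?g" using elim \<delta> by simp
        show ?case
        proof (intro allI impI)
          fix RU RE_avg assume "achievable_rates \<rho> \<rho>\<^sub>f h D K P RU RE_avg"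
          then have le: "real K * RE_avg + real K * (\<rho> * \<rho>\<^sub>f * RU) + real (K - 1) * (\<rho> * (\<rho> * \<rho>\<^sub>f) * RU)
              \<le> real K * \<rho> * ?g" and u: "\<rho> * \<rho>\<^sub>f * RU \<le> \<rho> * \<rho>\<^sub>f / 2 * ?g"
            using elim by blast+
          \<comment> \<open>The neighbour term is available for only \<open>K - 1\<close> users. The
            missing summand is at most \<open>?g\<close> by the URLLC bound, hence at most \<delta>
            times K units.\<close>
          have "\<rho> * (\<rho> * \<rho>\<^sub>f / 2) \<le> 1 * (1 * 1 / 2)"
            using \<rho> \<rho>\<^sub>f by (intro mult_mono divide_right_mono) auto
          then have "\<rho> * (\<rho> * \<rho>\<^sub>f / 2) * ?g \<le> 1 * ?g" using g by (intro mult_right_mono) auto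
          moreover have "\<rho> * (\<rho> * \<rho>\<^sub>f * RU) \<le> \<rho> * (\<rho> * \<rho>\<^sub>f / 2 * ?g)"
            using u \<rho>'(1) by (rule mult_left_mono)
          moreover have "1 * ?g \<le> \<delta> * real K * ?g" using small g by (rule mult_right_mono)
          ultimately have last: "\<rho> * (\<rho> * \<rho>\<^sub>f * RU) \<le> real K * (\<delta> * ?g)"
            by (simp only: mult_ac)
          have "real K * RE_avg + real K * (\<rho> * \<rho>\<^sub>f * RU) + real K * (\<rho> * (\<rho> * \<rho>\<^sub>f) * RU)
              \<le> real K * \<rho> * ?g + real K * (\<delta> * ?g)"
          proof -
            have "real (K - 1) * (\<rho> * (\<rho> * \<rho>\<^sub>f) * RU)
                = real K * (\<rho> * (\<rho> * \<rho>\<^sub>f) * RU) - \<rho> * (\<rho> * \<rho>\<^sub>f * RU)"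
              using K(1) by (simp add: of_nat_diff algebra_simps)
            then show ?thesis using le last by linarith
          qed
          moreover have "real K * (RE_avg + (1 + \<rho>) * (\<rho> * \<rho>\<^sub>f * RU))
              = real K * RE_avg + real K * (\<rho> * \<rho>\<^sub>f * RU) + real K * (\<rho> * (\<rho> * \<rho>\<^sub>f) * RU)"
            by (simp add: algebra_simps)
          moreover have "real K * ((\<rho> + \<delta>) * ?g) = real K * \<rho> * ?g + real K * (\<delta> * ?g)"
            by (simp only: distrib_right distrib_left mult.assoc)
          ultimately have "real K * (RE_avg + (1 + \<rho>) * (\<rho> * \<rho>\<^sub>f * RU)) \<le> real K * ((\<rho> + \<delta>) * ?g)"
            by linarith
          then have "RE_avg + (1 + \<rho>) * (\<rho> * \<rho>\<^sub>f * RU) \<le> (\<rho> + \<delta>) * ?g"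
            using K(1) by (simp add: mult_le_cancel_left_pos)
          also have "\<dots> \<le> (\<rho> + \<epsilon>) * (log 2 P / 2)"
          proof -
            have "\<rho> * \<delta> \<le> \<delta>" "\<delta> * \<delta> \<le> \<delta>" using \<rho> \<delta> by (simp_all add: mult_le_cancel_right1 mult_left_le)
            then have "(\<rho> + \<delta>) * (1 + \<delta>) \<le> \<rho> + \<epsilon>" using \<delta>(3) by (simp add: algebra_simps)
            then have "(\<rho> + \<delta>) * (1 + \<delta>) * (log 2 P / 2) \<le> (\<rho> + \<epsilon>) * (log 2 P / 2)"
              using elim by (intro mult_right_mono) auto
            then show ?thesis by (simp only: mult.assoc)
          qed
          finally show "(1 + \<rho>) * (\<rho> * \<rho>\<^sub>f * RU) + 1 * RE_avg \<le> (\<rho> + \<epsilon>) * (log 2 P / 2)" by simp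
        qed
      qed
    qed
  qed (use \<rho> in auto)
  \<comment> \<open>The bound holds for every truncation \<open>J\<close>; letting \<open>J\<close>
    grow turns the partial sums into the full geometric series.\<close>
  have "SE + SU \<le> \<rho> - (1 - \<rho>) * \<rho> ^ (D + 2) / (1 - \<rho> ^ (D + 2))"
  proof (rule LIMSEQ_le_const)
    define q where "q = \<rho> ^ (D + 2)"
    have q: "0 \<le> q" "q < 1"
      using \<rho> power_Suc_less_one[of \<rho> "Suc D"] by (simp_all add: q_def)
    have \<gamma>: "\<gamma> J = (1 - \<rho>) * (q * ((1 - q ^ J) / (1 - q)))" for J
    proof -
      have "\<gamma> J = (\<Sum>j = 1..J. (1 - \<rho>) * q ^ j)"
        unfolding \<gamma>_def q_def by (simp only: power_mult[symmetric] mult.commute[of _ "D + 2"])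
      also have "\<dots> = (\<Sum>j<J. (1 - \<rho>) * (q * q ^ j))"
        by (simp add: sum.atLeast1_atMost_eq)
      also have "\<dots> = (1 - \<rho>) * (q * (\<Sum>j<J. q ^ j))"
        by (simp only: sum_distrib_left)
      also have "(\<Sum>j<J. q ^ j) = (1 - q ^ J) / (1 - q)"
        using q by (simp add: sum_gp_strict)
      finally show ?thesis .
    qed
    have "(\<lambda>J. \<rho> - (1 - \<rho>) * (q * ((1 - q ^ J) / (1 - q)))) \<longlonglongrightarrow> \<rho> - (1 - \<rho>) * (q * ((1 - 0) / (1 - q)))"
      using q by (intro tendsto_intros LIMSEQ_power_zero) auto
    then show "(\<lambda>J. \<rho> - \<gamma> J) \<longlonglongrightarrow> \<rho> - (1 - \<rho>) * \<rho> ^ (D + 2) / (1 - \<rho> ^ (D + 2))"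
      unfolding \<gamma> q_def[symmetric] by simp
    show "\<exists>N. \<forall>n\<ge>N. SE + SU \<le> \<rho> - \<gamma> n"
      using second by (auto simp: add.commute)
  qed
  then show ?thesis using first third by (simp add: add.commute)
qed

end
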